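(* For each character $\chi \in \widehat{\mathcal{O}^{\times}}$ and for each integer $m \geq c(\chi)$, the $K$-module $\mathcal{H}_{\chi,m}(S^{n-1})$ is irreducible, and we have the orthogonal decompositions \[C^{\infty}(S^{n-1})_{\chi}^{K(\mathfrak{p}^m)} = \bigoplus_{\ell = c(\chi)}^{m} \mathcal{H}_{\chi,\ell}(S^{n-1}),\] \[C^{\infty}(S^{n-1}) = \bigoplus_{m=0}^{\infty} \ \bigoplus_{\substack{\chi \in \widehat{\mathcal{O}^{\times}} \\ 0 \leq c(\chi) \leq m}} \mathcal{H}_{\chi,m}(S^{n-1}).\]
   Context: Let $F$ be a nonarchimedean local field with ring of integers $\mathcal{O}$, maximal ideal $\mathfrak{p}$, uniformiser $\varpi$, residue field of order $q$, and absolute value normalised by $|\varpi| = q^{-1}$. Fix $n \geq 2$ and let $K = \mathrm{GL}_n(\mathcal{O})$ with Haar probability measure $dk$. Let $S^{n-1} = \{x = (x_1,\ldots,x_n) \in F^n : \max\{|x_1|,\ldots,|x_n|\} = 1\}$ (row vectors), on which $K$ acts by $k \cdot x = xk$, and let $e_n = (0,\ldots,0,1)$. $C^{\infty}(S^{n-1})$ is the space of locally constant functions $f : S^{n-1} \to \mathbb{C}$, on which $K$ acts by right translation, $(k \cdot f)(x) = f(xk)$, with the $K$-invariant inner product $\langle f_1,f_2\rangle = \int_K f_1(e_n k)\overline{f_2(e_n k)}\,dk$; orthogonality is with respect to this inner product. For an integer $m \geq 0$, $K(\mathfrak{p}^m) = \{k \in K : k - 1_n \in \mathrm{Mat}_{n\times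 n}(\mathfrak{p}^m)\}$. $\widehat{\mathcal{O}^{\times}}$ is the set of continuous characters $\chi : \mathcal{O}^{\times} \to \mathbb{C}^{\times}$. The conductor exponent $c(\chi)$ is the least nonnegative integer $m$ such that $\chi$ is trivial on $1+\mathfrak{p}^m$ (on $\mathcal{O}^{\times}$ if $m=0$). Let $C^{\infty}(S^{n-1})^{K(\mathfrak{p}^m)}$ be the subspace of $f$ with $f(xk) = f(x)$ for all $x \in S^{n-1}$, $k \in K(\mathfrak{p}^m)$, and let $C^{\infty}(S^{n-1})_{\chi}^{K(\mathfrak{p}^m)}$ be the subspace of those $f \in C^{\infty}(S^{n-1})^{K(\mathfrak{p}^m)}$ with $f(ax) = \chi(a) f(x)$ for all $a \in \mathcal{O}^{\times}$, $x \in S^{n-1}$. For $m \geq c(\chi)$, define $\mathcal{H}_{\chi,m}(S^{n-1}) = C^{\infty}(S^{n-1})_{\chi}^{K(\mathfrak{p}^{c(\chi)})}$ if $m = c(\chi)$, and if $m > c(\chi)$ define $\mathcal{H}_{\chi,m}(S^{n-1})$ to be the orthogonal complement of $C^{\infty}(S^{n-1})_{\chi}^{K(\mathfrak{p}^{m-1})}$ in $C^{\infty}(S^{n-1})_{\chi}^{K(\mathfrak{p}^m)}$. *)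

theory Defs
  imports "HOL-Probability.Probability" "HOL-Library.Function_Algebras"
begin

text \<open>Nonarchimedean local fields: complete discretely valued fields with finite residue field.
  The absolute value is \<open>absv\<close>, and the topology is the one it induces, so that the library
  topology on \<open>'a^'n\<close> and \<open>'a^'n^'n\<close> is the product topology.\<close>

class nonarch_valued_field = field + metric_space +
  fixes absv :: "'a \<Rightarrow> real"
  assumes dist_absv: "dist x y = absv (x - y)"
    and absv_mult: "absv (x * y) = absv x * absv y"
    and absv_add: "absv (x + y) \<le> max (absv x) (absv y)"
begin

definition integers :: "'a set"
  where "integers = {x. absv x \<le> 1}"

definition maximal_ideal :: "'a set"
  where "maximal_ideal = {x. absv x < 1}"

definition residue_field :: "'a set set"
  where "residue_field =
    integers // {(x, y). x \<in> integers \<and> y \<in> integers \<and> x - y \<in> maximal_ideal}"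

definition uniformiser :: "'a \<Rightarrow> bool"
  where "uniformiser \<pi> \<longleftrightarrow> maximal_ideal = (\<lambda>y. \<pi> * y) ` integers"

definition integer_units :: "'a set"
  where "integer_units = {x \<in> integers. \<exists>y\<in>integers. x * y = 1}"

text \<open>The power \<open>\<pp>\<^sup>m = \<pi>\<^sup>m \<O>\<close> of the maximal ideal, which does not depend on the uniformiser \<open>\<pi>\<close>.\<close>

definition ideal_power :: "nat \<Rightarrow> 'a set"
  where "ideal_power m = {\<pi> ^ m * y |\<pi> y. uniformiser \<pi> \<and> y \<in> integers}"

end

class nonarch_local_field = nonarch_valued_field + complete_space +
  assumes finite_residue_field: "finite residue_field"
    and normalised_uniformiser: "\<exists>\<pi>. uniformiser \<pi> \<and> absv \<pi> = 1 / real (card residue_field)"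


definition integer_matrices :: "('a::nonarch_local_field^'n^'n) set"
  where "integer_matrices = {k. \<forall>i j. k $ i $ j \<in> integers}"

definition GLO :: "('a::nonarch_local_field^'n^'n) set"
  where "GLO = {k \<in> integer_matrices. \<exists>k'\<in>integer_matrices. k ** k' = mat 1 \<and> k' ** k = mat 1}"

definition congruence_subgroup :: "nat \<Rightarrow> ('a::nonarch_local_field^'n^'n) set"
  where "congruence_subgroup m = {k \<in> GLO. \<forall>i j. (k - mat 1) $ i $ j \<in> ideal_power m}"

definition haar_probability :: "('a::nonarch_local_field^'n^'n) measure \<Rightarrow> bool"
  where "haar_probability \<mu> \<longleftrightarrow>
    prob_space \<mu> \<and> sets \<mu> = sets (restrict_space borel GLO) \<and>
    (\<forall>k\<in>GLO. distr \<mu> \<mu> (\<lambda>g. k ** g) = \<mu>)"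

definition unit_sphere :: "('a::nonarch_local_field^'n) set"
  where "unit_sphere = {x. Max (range (\<lambda>i. absv (x $ i))) = 1}"

definition last_basis_vector :: "'a::nonarch_local_field^'n::{finite,linorder}"
  where "last_basis_vector = axis (Max UNIV) 1"


text \<open>Functions on the unit sphere are represented by their extension by zero to the whole space,
  so that spaces of such functions are subspaces of the complex vector space of all functions.\<close>

definition cscale :: "complex \<Rightarrow> ('b \<Rightarrow> complex) \<Rightarrow> 'b \<Rightarrow> complex"
  where "cscale c f = (\<lambda>x. c * f x)"

global_interpretation cfun: vector_space "cscale :: complex \<Rightarrow> ('b \<Rightarrow> complex) \<Rightarrow> 'b \<Rightarrow> complex"
  by unfold_locales (auto simp: cscale_def fun_eq_iff algebra_simps)

definition smooth_functions :: "('a::nonarch_local_field^'n \<Rightarrow> complex) set"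
  where "smooth_functions = {f.
    (\<forall>x\<in>unit_sphere. \<exists>U. open U \<and> x \<in> U \<and> (\<forall>y\<in>U \<inter> unit_sphere. f y = f x)) \<and>
    (\<forall>x. x \<notin> unit_sphere \<longrightarrow> f x = 0)}"

definition invariants :: "nat \<Rightarrow> ('a::nonarch_local_field^'n \<Rightarrow> complex) set"
  where "invariants m = {f \<in> smooth_functions.
    \<forall>x\<in>unit_sphere. \<forall>k\<in>congruence_subgroup m. f (x v* k) = f x}"

text \<open>Characters of the unit group are likewise extended by zero, so that distinct elements of
  \<open>characters\<close> are distinct characters.\<close>

definition characters :: "('a::nonarch_local_field \<Rightarrow> complex) set"
  where "characters = {\<omega>.
    continuous_on integer_units \<omega> \<and>
    (\<forall>a\<in>integer_units. \<omega> a \<noteq> 0) \<and>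
    (\<forall>a\<in>integer_units. \<forall>b\<in>integer_units. \<omega> (a * b) = \<omega> a * \<omega> b) \<and>
    (\<forall>a. a \<notin> integer_units \<longrightarrow> \<omega> a = 0)}"

definition conductor :: "('a::nonarch_local_field \<Rightarrow> complex) \<Rightarrow> nat"
  where "conductor \<omega> = (LEAST m.
    \<forall>a \<in> (if m = 0 then integer_units else {1 + x |x. x \<in> ideal_power m}). \<omega> a = 1)"

definition isotypic_invariants ::
    "('a::nonarch_local_field \<Rightarrow> complex) \<Rightarrow> nat \<Rightarrow> ('a^'n \<Rightarrow> complex) set"
  where "isotypic_invariants \<omega> m = {f \<in> invariants m.
    \<forall>a\<in>integer_units. \<forall>x\<in>unit_sphere. f (a *s x) = \<omega> a * f x}"

definition inner_prod :: "('a::nonarch_local_field^'n::{finite,linorder}^'n::{finite,linorder}) measure \<Rightarrow>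
    ('a^'n::{finite,linorder} \<Rightarrow> complex) \<Rightarrow> ('a^'n::{finite,linorder} \<Rightarrow> complex) \<Rightarrow> complex"
  where "inner_prod \<mu> f\<^sub>1 f\<^sub>2 =
    (LINT k|\<mu>. f\<^sub>1 (last_basis_vector v* k) * cnj (f\<^sub>2 (last_basis_vector v* k)))"

definition harmonics :: "('a::nonarch_local_field^'n::{finite,linorder}^'n::{finite,linorder}) measure \<Rightarrow>
    ('a \<Rightarrow> complex) \<Rightarrow> nat \<Rightarrow> ('a^'n::{finite,linorder} \<Rightarrow> complex) set"
  where "harmonics \<mu> \<omega> m =
    (if m = conductor \<omega> then isotypic_invariants \<omega> (conductor \<omega>)
     else {f \<in> isotypic_invariants \<omega> m.
       \<forall>g\<in>isotypic_invariants \<omega> (m - 1). inner_prod \<mu> f g = 0})"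


definition right_translation :: "('a::nonarch_local_field^'n^'n) \<Rightarrow>
    ('a^'n \<Rightarrow> complex) \<Rightarrow> 'a^'n \<Rightarrow> complex"
  where "right_translation k f = (\<lambda>x. f (x v* k))"

definition K_submodule :: "('a::nonarch_local_field^'n \<Rightarrow> complex) set \<Rightarrow> bool"
  where "K_submodule V \<longleftrightarrow> cfun.subspace V \<and> V \<subseteq> smooth_functions \<and>
    (\<forall>k\<in>GLO. \<forall>f\<in>V. right_translation k f \<in> V)"

definition irreducible_K_module :: "('a::nonarch_local_field^'n \<Rightarrow> complex) set \<Rightarrow> bool"
  where "irreducible_K_module V \<longleftrightarrow> K_submodule V \<and> V \<noteq> {0} \<and>
    (\<forall>W. K_submodule W \<and> W \<subseteq> V \<longrightarrow> W = {0} \<or> W = V)"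

text \<open>\<open>W\<close> is the internal (algebraic) direct sum of the pairwise orthogonal subspaces \<open>V i\<close>,
  \<open>i \<in> I\<close>; for infinite \<open>I\<close>, its elements are the finite sums.\<close>

definition orthogonal_direct_sum ::
    "('a::nonarch_local_field^'n::{finite,linorder}^'n::{finite,linorder}) measure \<Rightarrow> 'i set \<Rightarrow>
     ('i \<Rightarrow> ('a^'n::{finite,linorder} \<Rightarrow> complex) set) \<Rightarrow> ('a^'n::{finite,linorder} \<Rightarrow> complex) set \<Rightarrow> bool"
  where "orthogonal_direct_sum \<mu> I V W \<longleftrightarrow>
    (\<forall>i\<in>I. cfun.subspace (V i)) \<and>
    W = {\<Sum>i\<in>J. v i |J v. finite J \<and> J \<subseteq> I \<and> (\<forall>i\<in>J. v i \<in> V i)} \<and>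
    (\<forall>J v. finite J \<and> J \<subseteq> I \<and> (\<forall>i\<in>J. v i \<in> V i) \<and> (\<Sum>i\<in>J. v i) = 0 \<longrightarrow> (\<forall>i\<in>J. v i = 0)) \<and>
    (\<forall>i\<in>I. \<forall>j\<in>I. i \<noteq> j \<longrightarrow> (\<forall>f\<in>V i. \<forall>g\<in>V j. inner_prod \<mu> f g = 0))"

end

theory Submission imports Defs begin

text \<open>
  Since \<open>K(\<pp>\<^sup>m)\<close> is normal of finite index in \<open>K\<close>, the inner product of two \<open>K(\<pp>\<^sup>m)\<close>-invariant functions is
  an average over any set of coset representatives; right invariance follows from this although the
  measure is only assumed to be left invariant.

  For irreducibility, let \<open>m \<ge> 1\<close> and let \<open>B\<close> be the group of \<open>b \<in> K\<close> preserving the line of \<open>e\<^sub>n\<close> modulo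
  \<open>\<pp>\<^sup>m\<close>. Call \<open>u\<close> zonal if \<open>u(xb) = \<chi>(b\<^sub>n\<^sub>n) u(x)\<close> for all \<open>b \<in> B\<close>. The value of a zonal function at \<open>x\<close> is determined
  by \<open>x\<^sub>n\<close> and the distance from \<open>x\<close> to the line of \<open>e\<^sub>n\<close>, and it vanishes at distances exceeding
  \<open>q\<close> to the power \<open>-c(\<chi>)\<close>. So the zonal functions of level \<open>m\<close> are spanned by those of level \<open>m - 1\<close> and one more
  function supported near the line, and a zonal element of \<open>\<H>\<^sub>\<chi>\<^sub>,\<^sub>m\<close> that vanishes at \<open>e\<^sub>n\<close> is zero. Averaging over
  \<open>B\<close> produces in every nonzero submodule \<open>W\<close> a zonal function not vanishing at \<open>e\<^sub>n\<close>; any element of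
  \<open>\<H>\<^sub>\<chi>\<^sub>,\<^sub>m\<close> orthogonal to \<open>W\<close>, and each of its translates, must then vanish at \<open>e\<^sub>n\<close>.
\<close>

section \<open>The valuation and residues modulo powers of the maximal ideal\<close>

text \<open>Zonality carries the factor chi(b_nn) because \<open>B\<close> moves e_n to a unit
  multiple of itself modulo p^m. Weighting the average by the conjugate of that factor makes the
  terms at e_n add up instead of cancelling, so the average of \<open>f\<close> takes a positive
  multiple of f(e_n) there. If \<open>f\<close> is orthogonal to a zonal \<open>z\<close> with
  z(e_n) nonzero, its average is orthogonal to \<open>z\<close> and, both being determined by their
  values at e_n, proportional to \<open>z\<close>. So it is zero, and f(e_n) = 0. Above the
  conductor, that determination rests on disjoint supports. A zonal harmonic \<open>u\<close> with
  u(e_n) = 0 vanishes on the ball carrying the extra function. Adding the multiple of that function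
  which brings \<open>u\<close> down to level m - 1 leaves the product with \<open>u\<close>
  unchanged, while by definition of the harmonics this product is zero; so <u, u> = 0. Level 0
  stands apart since b_nn need not be a unit there. Topology enters to show that every smooth
  function has a level and every character a conductor; afterwards all integrals are finite
  averages.\<close>

lemma absv_nonneg [simp]: "0 \<le> absv (x::'a::nonarch_valued_field)"
  using zero_le_dist[of x 0] by (simp add: dist_absv del: zero_le_dist)

lemma absv_eq_0_iff [simp]: "absv (x::'a::nonarch_valued_field) = 0 \<longleftrightarrow> x = 0"
  using dist_eq_0_iff[of x 0] by (simp add: dist_absv del: dist_eq_0_iff)

lemma absv_zero [simp]: "absv (0::'a::nonarch_valued_field) = 0"
  by simp

lemma absv_pos [simp]: "0 < absv (x::'a::nonarch_valued_field) \<longleftrightarrow> x \<noteq> 0"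
  using absv_nonneg[of x] absv_eq_0_iff[of x] by (auto simp del: absv_nonneg absv_eq_0_iff)

lemma absv_one [simp]: "absv (1::'a::nonarch_valued_field) = 1"
  using absv_mult[of "1::'a" 1] absv_eq_0_iff[of "1::'a"] by (simp del: absv_eq_0_iff)

lemma absv_minus [simp]: "absv (- (x::'a::nonarch_valued_field)) = absv x"
  using dist_commute[of x 0] by (simp add: dist_absv)

lemma absv_minus_commute: "absv ((x::'a::nonarch_valued_field) - y) = absv (y - x)"
  using dist_commute[of x y] by (simp add: dist_absv)

lemma absv_power: "absv ((x::'a::nonarch_valued_field) ^ m) = absv x ^ m"
  by (induction m) (auto simp: absv_mult)

lemma absv_inverse: "absv (inverse (x::'a::nonarch_valued_field)) = inverse (absv x)"
proof (cases "x = 0")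
  case False
  then have "absv x * absv (inverse x) = 1"
    by (simp flip: absv_mult)
  then show ?thesis
    using inverse_unique by metis
qed auto

lemma absv_divide: "absv ((x::'a::nonarch_valued_field) / y) = absv x / absv y"
  by (simp add: divide_inverse absv_mult absv_inverse)

lemma absv_add_le: "absv (x::'a::nonarch_valued_field) \<le> c \<Longrightarrow> absv y \<le> c \<Longrightarrow> absv (x + y) \<le> c"
  using absv_add[of x y] by linarith

lemma absv_diff_le: "absv (x::'a::nonarch_valued_field) \<le> c \<Longrightarrow> absv y \<le> c \<Longrightarrow> absv (x - y) \<le> c"
  using absv_add_le[of x c "- y"] by simp

text \<open>Isosceles property of the ultrametric. It keeps unit coordinates units, and large
  distances unchanged, under reduction modulo an ideal.\<close>

lemma absv_eqI:
  assumes "absv (y - (x::'a::nonarch_valued_field)) < absv x"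
  shows "absv y = absv x"
proof -
  have "absv y \<le> absv x"
    using absv_add[of x "y - x"] assms by simp
  moreover have "absv x \<le> max (absv y) (absv (y - x))"
    using absv_add[of y "x - y"] absv_minus_commute[of x y] by simp
  ultimately show ?thesis
    using assms by linarith
qed

lemma absv_sum_le:
  assumes "\<And>i. i \<in> I \<Longrightarrow> absv (f i ::'a::nonarch_valued_field) \<le> c" "0 \<le> c"
  shows "absv (\<Sum>i\<in>I. f i) \<le> c"
  using assms by (induction I rule: infinite_finite_induct) (auto intro: absv_add_le)

lemma integers_iff: "(x::'a::nonarch_valued_field) \<in> integers \<longleftrightarrow> absv x \<le> 1"
  by (simp add: integers_def)

lemma integer_units_iff: "(x::'a::nonarch_valued_field) \<in> integer_units \<longleftrightarrow> absv x = 1"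
proof
  assume "x \<in> integer_units"
  then obtain y where "absv x \<le> 1" "absv y \<le> 1" "x * y = 1"
    by (auto simp: integer_units_def integers_iff)
  then have "absv x * absv y = 1"
    by (simp flip: absv_mult)
  then show "absv x = 1"
    using \<open>absv x \<le> 1\<close> \<open>absv y \<le> 1\<close>
    by (metis absv_nonneg mult_left_le mult.commute order_antisym)
next
  assume x: "absv x = 1"
  then have "x \<noteq> 0"
    by auto
  then have "x * inverse x = 1" "absv (inverse x) \<le> 1"
    using x by (auto simp: absv_inverse)
  then show "x \<in> integer_units"
    using x by (auto simp: integer_units_def integers_iff intro!: bexI[of _ "inverse x"])
qed


section \<open>A fixed uniformiser and the powers of the maximal ideal\<close>

definition prime_elt :: "'a::nonarch_local_field"
  where "prime_elt = (SOME \<pi>. uniformiser \<pi> \<and> absv \<pi> = 1 / real (card (residue_field :: 'a set set)))"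

lemma prime_elt:
  "uniformiser (prime_elt :: 'a::nonarch_local_field)"
  "absv (prime_elt :: 'a) = 1 / real (card (residue_field :: 'a set set))"
  using someI_ex[OF normalised_uniformiser[where 'a='a]] unfolding prime_elt_def by auto

lemma card_residue_field: "0 < card (residue_field :: 'a::nonarch_local_field set set)"
proof -
  have "(residue_field :: 'a set set) \<noteq> {}"
    unfolding residue_field_def quotient_def by (auto simp: integers_iff intro!: exI[of _ 0])
  then show ?thesis
    using finite_residue_field by (simp add: card_gt_0_iff)
qed

lemma prime_elt_nz [simp]: "(prime_elt :: 'a::nonarch_local_field) \<noteq> 0"
  using prime_elt(2)[where 'a='a] card_residue_field[where 'a='a] by fastforce

text \<open>Discreteness of the valuation: the nonunits are the integral multiples of
  \<open>prime_elt\<close>, so no absolute value lies strictly between that of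
  \<open>prime_elt\<close> and 1.\<close>

lemma less_one_iff: "absv (x :: 'a) < 1 \<longleftrightarrow> absv x \<le> absv (prime_elt :: 'a::nonarch_local_field)"
  and absv_prime_elt_less: "absv (prime_elt :: 'a::nonarch_local_field) < 1"
proof -
  have u: "{x::'a. absv x < 1} = (\<lambda>y. prime_elt * y) ` {x. absv x \<le> 1}"
    using prime_elt(1)[where 'a='a] unfolding uniformiser_def maximal_ideal_def integers_def .
  have "prime_elt * 1 \<in> {x::'a. absv x < 1}"
    unfolding u by (rule imageI) simp
  then show less: "absv (prime_elt :: 'a) < 1"
    by simp
  show "absv x < 1 \<longleftrightarrow> absv x \<le> absv (prime_elt :: 'a)"
  proof
    assume "absv x < 1"
    then obtain y where "x = prime_elt * y" and y: "absv y \<le> 1"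
      using u by blast
    then show "absv x \<le> absv (prime_elt :: 'a)"
      using mult_left_le[OF y absv_nonneg] by (metis absv_mult)
  qed (use less in linarith)
qed

text \<open>Two uniformisers divide each other. Hence the union over all uniformisers in
  \<open>ideal_power\<close> is a single ball.\<close>

lemma uniformiser_absv:
  assumes "uniformiser (\<pi> :: 'a::nonarch_local_field)"
  shows "absv \<pi> = absv (prime_elt :: 'a)"
proof -
  have u: "{x::'a. absv x < 1} = (\<lambda>y. \<pi> * y) ` {x. absv x \<le> 1}"
    using assms unfolding uniformiser_def maximal_ideal_def integers_def .
  have "\<pi> * 1 \<in> {x::'a. absv x < 1}"
    unfolding u by (rule imageI) simp
  then have "absv \<pi> \<le> absv (prime_elt :: 'a)"
    using less_one_iff[of \<pi>] by simp
  moreover have "prime_elt \<in> {x::'a. absv x < 1}"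
    using absv_prime_elt_less[where 'a='a] by simp
  then obtain y where "prime_elt = \<pi> * y" and y: "absv y \<le> 1"
    using u by blast
  then have "absv (prime_elt :: 'a) \<le> absv \<pi>"
    using mult_left_le[OF y absv_nonneg] by (metis absv_mult)
  ultimately show ?thesis
    by simp
qed

lemma ideal_power_iff:
  "(x :: 'a) \<in> ideal_power m \<longleftrightarrow> absv x \<le> absv ((prime_elt :: 'a::nonarch_local_field) ^ m)"
proof
  assume "x \<in> ideal_power m"
  then obtain \<pi> y where "x = \<pi> ^ m * y" "uniformiser \<pi>" and y: "absv y \<le> 1"
    by (auto simp: ideal_power_def integers_iff)
  then have "absv x = absv ((prime_elt :: 'a) ^ m) * absv y"
    by (simp add: absv_mult absv_power uniformiser_absv)
  then show "absv x \<le> absv ((prime_elt :: 'a) ^ m)"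
    using mult_left_le[OF y absv_nonneg] by metis
next
  assume x: "absv x \<le> absv ((prime_elt :: 'a) ^ m)"
  have "x = prime_elt ^ m * (x / prime_elt ^ m)"
    by simp
  moreover have "x / prime_elt ^ m \<in> integers"
    using x by (simp add: integers_iff absv_divide divide_le_eq_1)
  ultimately show "x \<in> ideal_power m"
    unfolding ideal_power_def using prime_elt(1)[where 'a='a] by blast
qed

lemma ideal_power_0: "ideal_power 0 = (integers :: 'a::nonarch_local_field set)"
  by (auto simp: ideal_power_iff integers_iff)

lemma ideal_power_antimono:
  assumes "m \<le> m'"
  shows "(ideal_power m' :: 'a::nonarch_local_field set) \<subseteq> ideal_power m"
proof -
  have "absv (prime_elt :: 'a) ^ m' \<le> absv (prime_elt :: 'a) ^ m"
    using absv_prime_elt_less[where 'a='a] by (intro power_decreasing[OF assms]) auto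
  then show ?thesis
    by (auto simp: ideal_power_iff absv_power)
qed

lemma ideal_power_integer: "x \<in> ideal_power m \<Longrightarrow> absv (x :: 'a::nonarch_local_field) \<le> 1"
  using ideal_power_antimono[of 0 m, where 'a='a] by (auto simp: ideal_power_0 integers_iff)

lemma ideal_power_less_1: "x \<in> ideal_power m \<Longrightarrow> m \<noteq> 0 \<Longrightarrow> absv (x :: 'a::nonarch_local_field) < 1"
  using ideal_power_antimono[of 1 m, where 'a='a] by (auto simp: ideal_power_iff less_one_iff)

text \<open>Division by \<open>prime_elt ^ m\<close> reduces this to \<open>less_one_iff\<close>.
  Between two consecutive levels it leaves a single possible distance, on which the comparison of
  zonal functions of these levels depends.\<close>

lemma ideal_power_Suc_iff:
  "(x :: 'a) \<in> ideal_power (Suc m) \<longleftrightarrow> absv x < absv ((prime_elt :: 'a::nonarch_local_field) ^ m)"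
proof -
  have "x \<in> ideal_power (Suc m) \<longleftrightarrow> absv (x / prime_elt ^ m) \<le> absv (prime_elt :: 'a)"
    by (simp add: ideal_power_iff absv_divide absv_mult pos_divide_le_eq)
  also have "\<dots> \<longleftrightarrow> absv (x / prime_elt ^ m) < 1"
    using less_one_iff[of "x / prime_elt ^ m"] by simp
  finally show ?thesis
    by (simp add: absv_divide pos_divide_less_eq)
qed

lemma ideal_power_zero [simp]: "(0 :: 'a::nonarch_local_field) \<in> ideal_power m"
  by (simp add: ideal_power_iff)

lemma ideal_power_add: "x \<in> ideal_power m \<Longrightarrow> y \<in> ideal_power m \<Longrightarrow> x + y \<in> ideal_power m"
  for x y :: "'a::nonarch_local_field"
  by (auto simp: ideal_power_iff intro: absv_add_le)

lemma ideal_power_diff: "x \<in> ideal_power m \<Longrightarrow> y \<in> ideal_power m \<Longrightarrow> x - y \<in> ideal_power m"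
  for x y :: "'a::nonarch_local_field"
  by (auto simp: ideal_power_iff intro: absv_diff_le)

lemma ideal_power_diff_commute: "x - y \<in> ideal_power m \<longleftrightarrow> y - x \<in> ideal_power m"
  for x y :: "'a::nonarch_local_field"
  using absv_minus_commute[of x y] by (simp add: ideal_power_iff)

lemma ideal_power_mult: "x \<in> ideal_power m \<Longrightarrow> absv y \<le> 1 \<Longrightarrow> y * x \<in> ideal_power m"
  for x y :: "'a::nonarch_local_field"
  using mult_mono[of "absv y" 1 "absv x" "absv ((prime_elt :: 'a) ^ m)"]
  by (auto simp: ideal_power_iff absv_mult)

lemma ideal_power_sum: "(\<And>i. i \<in> I \<Longrightarrow> f i \<in> ideal_power m) \<Longrightarrow> (\<Sum>i\<in>I. f i) \<in> ideal_power m"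
  for f :: "'b \<Rightarrow> 'a::nonarch_local_field"
  by (auto simp: ideal_power_iff intro: absv_sum_le)

lemma ideal_power_trans: "x - y \<in> ideal_power m \<Longrightarrow> y - z \<in> ideal_power m \<Longrightarrow> x - z \<in> ideal_power m"
  for x y z :: "'a::nonarch_local_field"
  using ideal_power_add[of "x - y" m "y - z"] by simp

lemma ex_ideal_power_radius:
  assumes "0 < e"
  shows "\<exists>m. \<forall>x\<in>ideal_power m. absv (x::'a::nonarch_local_field) < e"
proof -
  obtain m where "absv (prime_elt::'a) ^ m < e"
    using real_arch_pow_inv[OF assms] absv_prime_elt_less by blast
  then show ?thesis
    by (metis absv_power ideal_power_iff order_le_less_trans)
qed

text \<open>Representatives are truncated expansions in powers of \<open>prime_elt\<close>, with
  digits representing the finite residue field.\<close>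

lemma finite_residues:
  "\<exists>F. finite F \<and> F \<subseteq> integers \<and> (\<forall>x\<in>integers. \<exists>r\<in>F. x - r \<in> (ideal_power m :: 'a::nonarch_local_field set))"
proof (induction m)
  case 0
  show ?case
    by (rule exI[of _ "{0}"]) (auto simp: integers_iff ideal_power_0)
next
  case (Suc m)
  then obtain F where F: "finite F" "F \<subseteq> integers"
    "\<And>x. x \<in> integers \<Longrightarrow> \<exists>r\<in>F. x - r \<in> (ideal_power m :: 'a set)"
    by blast
  define rel where "rel = {(x, y). x \<in> integers \<and> y \<in> integers \<and> x - y \<in> (maximal_ideal :: 'a set)}"
  define G where "G = (\<lambda>C. SOME x. x \<in> C) ` (residue_field :: 'a set set)"
  have "finite G"
    unfolding G_def using finite_residue_field by blast
  have G: "\<exists>s\<in>G. s \<in> integers \<and> absv (y - s) < 1" if "y \<in> integers" for y :: 'a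
  proof -
    have rf: "rel `` {y} \<in> residue_field"
      unfolding residue_field_def rel_def[symmetric] using that by (rule quotientI)
    have "y \<in> rel `` {y}"
      using that by (simp add: rel_def maximal_ideal_def)
    then have "(SOME x. x \<in> rel `` {y}) \<in> rel `` {y}"
      by (rule someI)
    then show ?thesis
      unfolding G_def by (intro bexI[OF _ imageI[OF rf]]) (auto simp: rel_def maximal_ideal_def)
  qed
  define F' where "F' = (\<lambda>(r, s). r + prime_elt ^ m * s) ` (F \<times> (G \<inter> integers))"
  have "finite F'"
    unfolding F'_def using \<open>finite F\<close> \<open>finite G\<close> by blast
  moreover have "F' \<subseteq> integers"
  proof -
    have "absv (r + prime_elt ^ m * s) \<le> 1" if "absv r \<le> 1" "absv s \<le> 1" for r s :: 'a
      using that absv_prime_elt_less[where 'a='a]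
      by (intro absv_add_le) (auto simp: absv_mult absv_power intro!: mult_le_one power_le_one)
    then show ?thesis
      unfolding F'_def using F(2) by (auto simp: integers_iff)
  qed
  moreover have "\<exists>r\<in>F'. x - r \<in> ideal_power (Suc m)" if x: "x \<in> integers" for x
  proof -
    obtain r where r: "r \<in> F" "x - r \<in> ideal_power m"
      using F(3)[OF x] by blast
    define y where "y = (x - r) / prime_elt ^ m"
    have y: "x - r = prime_elt ^ m * y"
      by (simp add: y_def)
    have "y \<in> integers"
      using r(2) by (simp add: ideal_power_iff y_def integers_iff absv_divide divide_le_eq_1)
    then obtain s where s: "s \<in> G" "s \<in> integers" "absv (y - s) < 1"
      using G by blast
    have "x - (r + prime_elt ^ m * s) = prime_elt ^ m * (y - s)"
      using y by (simp add: algebra_simps)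
    then have "x - (r + prime_elt ^ m * s) \<in> ideal_power (Suc m)"
      using s(3) by (simp add: ideal_power_Suc_iff absv_mult)
    then show ?thesis
      unfolding F'_def using r(1) s(1,2) by (intro bexI[of _ "r + prime_elt ^ m * s"]) auto
  qed
  ultimately show ?case
    by blast
qed

section \<open>Row vectors and the action of the integral matrix group\<close>

lemma absv_row_mult_le:
  fixes x :: "'a::nonarch_local_field^'n"
  assumes "k \<in> integer_matrices" "\<And>i. absv (x $ i) \<le> c"
  shows "absv ((x v* k) $ j) \<le> c"
proof -
  have "absv (k $ i $ j * x $ i) \<le> c" for i
  proof -
    have "absv (k $ i $ j) * absv (x $ i) \<le> 1 * c"
      using assms by (intro mult_mono) (auto simp: integer_matrices_def integers_iff)
    then show ?thesis
      by (simp add: absv_mult)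
  qed
  moreover have "0 \<le> c"
    using assms(2) absv_nonneg order_trans by blast
  ultimately show ?thesis
    unfolding vector_matrix_mult_def by (simp add: absv_sum_le mult.commute)
qed

lemma absv_row_mult_less:
  fixes x :: "'a::nonarch_local_field^'n"
  assumes "k \<in> integer_matrices" "\<And>i. absv (x $ i) < c"
  shows "absv ((x v* k) $ j) < c"
proof -
  \<comment> \<open>The largest coordinate turns the strict bounds into a uniform non-strict one, to
    which \<open>absv_row_mult_le\<close> applies.\<close>
  define d where "d = Max (range (\<lambda>i. absv (x $ i)))"
  have "absv (x $ i) \<le> d" for i
    unfolding d_def by (rule Max_ge) auto
  then have "absv ((x v* k) $ j) \<le> d"
    by (rule absv_row_mult_le[OF assms(1)])
  moreover have "d < c"
    using assms(2) by (simp add: d_def)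
  ultimately show ?thesis
    by linarith
qed

lemma GLO_integer_matrices: "k \<in> GLO \<Longrightarrow> k \<in> integer_matrices"
  by (simp add: GLO_def)

lemma GLO_inverse:
  assumes "k \<in> GLO"
  obtains k' where "k' \<in> GLO" "k ** k' = mat 1" "k' ** k = mat 1"
  using assms unfolding GLO_def by blast

lemma integer_matrices_mult:
  "k \<in> integer_matrices \<Longrightarrow> l \<in> integer_matrices \<Longrightarrow> k ** l \<in> integer_matrices"
  for k l :: "'a::nonarch_local_field^'n^'n"
  unfolding integer_matrices_def matrix_matrix_mult_def
  by (auto simp: integers_iff absv_mult intro!: absv_sum_le mult_le_one)

lemma GLO_mult:
  assumes "k \<in> GLO" "l \<in> GLO"
  shows "k ** l \<in> (GLO :: ('a::nonarch_local_field^'n^'n) set)"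
proof -
  obtain k' where k: "k' \<in> GLO" "k ** k' = mat 1" "k' ** k = mat 1"
    using GLO_inverse[OF assms(1)] .
  obtain l' where l: "l' \<in> GLO" "l ** l' = mat 1" "l' ** l = mat 1"
    using GLO_inverse[OF assms(2)] .
  have "(k ** l) ** (l' ** k') = k ** (l ** l') ** k'" "(l' ** k') ** (k ** l) = l' ** (k' ** k) ** l"
    by (simp_all add: matrix_mul_assoc)
  then have "(k ** l) ** (l' ** k') = mat 1" "(l' ** k') ** (k ** l) = mat 1"
    using k l by simp_all
  then show ?thesis
    using assms k l unfolding GLO_def by (blast intro: integer_matrices_mult)
qed

lemma GLO_one: "mat 1 \<in> (GLO :: ('a::nonarch_local_field^'n^'n) set)"
proof -
  have "mat 1 \<in> (integer_matrices :: ('a^'n^'n) set)"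
    by (auto simp: integer_matrices_def mat_def integers_iff)
  then show ?thesis
    unfolding GLO_def by (auto intro!: bexI[of _ "mat 1"])
qed

lemma vector_matrix_mul_assoc: "(x v* k) v* l = x v* (k ** l)"
  for x :: "'a::nonarch_local_field^'n"
  unfolding vector_matrix_mult_def matrix_matrix_mult_def vec_eq_iff
  by (auto simp: sum_distrib_left sum_distrib_right mult_ac intro: sum.swap)

lemma scale_row_mult: "(a *s x) v* k = a *s (x v* k)"
  for x :: "'a::nonarch_local_field^'n"
  unfolding vector_matrix_mult_def vec_eq_iff
  by (auto simp: sum_distrib_left mult_ac)

lemma row_mult_diff: "(x v* k - y v* k) = (x - y) v* k"
  for x :: "'a::nonarch_local_field^'n"
  unfolding vector_matrix_mult_def vec_eq_iff
  by (auto simp: algebra_simps sum_subtractf)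

lemma vec_mat_1 [simp]: "x v* mat 1 = x"
  for x :: "'a::nonarch_local_field^'n"
  unfolding vector_matrix_mult_def mat_def vec_eq_iff
  by (simp add: if_distrib[of "\<lambda>z. _ * z"] cong: if_cong)

lemma unit_sphere_iff:
  "x \<in> unit_sphere \<longleftrightarrow> (\<forall>i. absv (x $ i) \<le> 1) \<and> (\<exists>i. absv (x $ i) = 1)"
  for x :: "'a::nonarch_local_field^'n"
proof -
  have "Max (range (\<lambda>i. absv (x $ i))) = 1 \<longleftrightarrow>
      1 \<in> range (\<lambda>i. absv (x $ i)) \<and> (\<forall>a\<in>range (\<lambda>i. absv (x $ i)). a \<le> 1)"
    by (rule Max_eq_iff) auto
  moreover have "1 \<in> range (\<lambda>i. absv (x $ i)) \<longleftrightarrow> (\<exists>i. absv (x $ i) = 1)"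
    by (metis rangeE rangeI)
  ultimately show ?thesis
    unfolding unit_sphere_def by auto
qed

text \<open>Neither an integral matrix nor its integral inverse can increase the maximum
  norm.\<close>

lemma unit_sphere_GLO:
  fixes x :: "'a::nonarch_local_field^'n"
  assumes "k \<in> GLO"
  shows "x v* k \<in> unit_sphere \<longleftrightarrow> x \<in> unit_sphere"
proof -
  have *: "x v* k \<in> unit_sphere" if xk: "x \<in> unit_sphere" "k \<in> GLO"
    for x :: "'a^'n" and k
  proof (rule ccontr)
    assume "x v* k \<notin> unit_sphere"
    moreover have le: "absv ((x v* k) $ i) \<le> 1" for i
      using xk by (intro absv_row_mult_le) (auto simp: unit_sphere_iff GLO_integer_matrices)
    ultimately have "absv ((x v* k) $ i) \<noteq> 1" for i
      by (auto simp: unit_sphere_iff)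
    then have lt: "absv ((x v* k) $ i) < 1" for i
      using le[of i] by (simp add: order_less_le)
    obtain k' where "k' \<in> GLO" "k ** k' = mat 1"
      using GLO_inverse[OF xk(2)] .
    have "absv (((x v* k) v* k') $ i) < 1" for i
      by (rule absv_row_mult_less[OF GLO_integer_matrices[OF \<open>k' \<in> GLO\<close>] lt])
    then have "absv (x $ i) < 1" for i
      using \<open>k ** k' = mat 1\<close> by (simp add: vector_matrix_mul_assoc)
    then show False
      using xk(1) unfolding unit_sphere_iff by (metis less_irrefl)
  qed
  obtain k' where "k' \<in> GLO" "k ** k' = mat 1"
    using GLO_inverse[OF assms] .
  then show ?thesis
    using *[of x k] *[of "x v* k" k'] assms by (auto simp: vector_matrix_mul_assoc)
qed

lemma unit_sphere_scale:
  "absv a = 1 \<Longrightarrow> a *s x \<in> unit_sphere \<longleftrightarrow> x \<in> unit_sphere"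
  for x :: "'a::nonarch_local_field^'n"
  by (simp add: unit_sphere_iff absv_mult)

section \<open>Congruences modulo powers of the maximal ideal and the orbits of the congruence
  subgroups\<close>

definition vec_cong :: "nat \<Rightarrow> 'a::nonarch_local_field^'n \<Rightarrow> 'a^'n \<Rightarrow> bool"
  where "vec_cong m x y \<longleftrightarrow> (\<forall>i. x $ i - y $ i \<in> ideal_power m)"

lemma vec_cong_refl [simp]: "vec_cong m x x"
  by (simp add: vec_cong_def)

lemma vec_cong_sym: "vec_cong m x y \<Longrightarrow> vec_cong m y x"
  using ideal_power_diff_commute unfolding vec_cong_def by blast

lemma vec_cong_trans: "vec_cong m x y \<Longrightarrow> vec_cong m y z \<Longrightarrow> vec_cong m x z"
  using ideal_power_trans unfolding vec_cong_def by blast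

lemma vec_cong_antimono: "m \<le> m' \<Longrightarrow> vec_cong m' x y \<Longrightarrow> vec_cong m x y"
  using ideal_power_antimono unfolding vec_cong_def by blast

lemma vec_cong_0: "x \<in> unit_sphere \<Longrightarrow> y \<in> unit_sphere \<Longrightarrow> vec_cong 0 x y"
  unfolding vec_cong_def by (auto simp: unit_sphere_iff ideal_power_0 integers_iff intro: absv_diff_le)

lemma vec_cong_row_mult:
  assumes "k \<in> integer_matrices" "vec_cong m x y"
  shows "vec_cong m (x v* k) (y v* k)"
proof -
  have "absv (((x - y) v* k) $ i) \<le> absv ((prime_elt :: 'a) ^ m)" for i
    using assms by (intro absv_row_mult_le) (auto simp: vec_cong_def ideal_power_iff)
  then show ?thesis
    by (simp add: vec_cong_def ideal_power_iff flip: row_mult_diff)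
qed

lemma vec_cong_scale: "absv a \<le> 1 \<Longrightarrow> vec_cong m x y \<Longrightarrow> vec_cong m (a *s x) (a *s y)"
  unfolding vec_cong_def by (simp add: ideal_power_mult flip: right_diff_distrib)

definition mat_cong :: "nat \<Rightarrow> 'a::nonarch_local_field^'n^'n \<Rightarrow> 'a^'n^'n \<Rightarrow> bool"
  where "mat_cong m g h \<longleftrightarrow> (\<forall>i. vec_cong m (g $ i) (h $ i))"

lemma mat_cong_refl [simp]: "mat_cong m x x"
  by (simp add: mat_cong_def)

lemma mat_cong_sym: "mat_cong m x y \<Longrightarrow> mat_cong m y x"
  using vec_cong_sym unfolding mat_cong_def by blast

lemma mat_cong_trans: "mat_cong m x y \<Longrightarrow> mat_cong m y z \<Longrightarrow> mat_cong m x z"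
  using vec_cong_trans unfolding mat_cong_def by blast

lemma matrix_mult_row: "(g ** k) $ i = (g $ i) v* k"
  for g :: "'a::nonarch_local_field^'n^'n"
  by (simp add: matrix_matrix_mult_def vector_matrix_mult_def vec_eq_iff mult.commute)

lemma mat_cong_mult_right:
  "k \<in> integer_matrices \<Longrightarrow> mat_cong m g h \<Longrightarrow> mat_cong m (g ** k) (h ** k)"
  unfolding mat_cong_def by (simp add: matrix_mult_row vec_cong_row_mult)

lemma vec_cong_mult_mat:
  fixes x :: "'a::nonarch_local_field^'n"
  assumes "\<And>i. absv (x $ i) \<le> 1" "mat_cong m g h"
  shows "vec_cong m (x v* g) (x v* h)"
proof -
  have "(\<Sum>i\<in>UNIV. x $ i * (g $ i $ j - h $ i $ j)) \<in> ideal_power m" for j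
    using assms by (intro ideal_power_sum ideal_power_mult) (auto simp: mat_cong_def vec_cong_def)
  then show ?thesis
    by (simp add: vec_cong_def vector_matrix_mult_def algebra_simps sum_subtractf)
qed

lemma mat_cong_mult_left:
  "k \<in> integer_matrices \<Longrightarrow> mat_cong m g h \<Longrightarrow> mat_cong m (k ** g) (k ** h)"
  unfolding mat_cong_def[of m "k ** g"]
  by (auto simp: matrix_mult_row integer_matrices_def integers_iff intro!: vec_cong_mult_mat)

lemma congruence_subgroup_iff: "k \<in> congruence_subgroup m \<longleftrightarrow> k \<in> GLO \<and> mat_cong m k (mat 1)"
  by (auto simp: congruence_subgroup_def mat_cong_def vec_cong_def)

text \<open>The matrix \<open>1 + e\<^sub>i\<^sup>T d\<close>, which acts on row vectors by \<open>x \<mapsto> x + x\<^sub>i d\<close>.\<close>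

definition row_shift :: "'n \<Rightarrow> 'a::nonarch_local_field^'n \<Rightarrow> 'a^'n^'n"
  where "row_shift i d = (\<chi> r s. (if r = i then d $ s else 0) + (if r = s then 1 else 0))"

lemma row_mult_row_shift: "x v* row_shift i d = x + (x $ i) *s d"
  for x :: "'a::nonarch_local_field^'n"
proof -
  have "(\<Sum>r\<in>UNIV. ((if r = i then d $ s else 0) + (if r = s then 1 else 0)) * x $ r)
      = (\<Sum>r\<in>UNIV. (if r = i then d $ s * x $ r else 0)) + (\<Sum>r\<in>UNIV. (if r = s then x $ r else 0))" for s
    by (subst sum.distrib[symmetric]) (auto intro!: sum.cong simp: algebra_simps)
  then show ?thesis
    unfolding vector_matrix_mult_def row_shift_def vec_eq_iff by (simp add: mult.commute)
qed

text \<open>Exchanging \<open>x\<close> and \<open>y\<close> in the construction gives the inverse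
  matrix, and equality of the \<open>i\<close>-th absolute values makes that one integral
  too.\<close>

lemma GLO_row_shift:
  fixes x y :: "'a::nonarch_local_field^'n"
  assumes "absv (y $ i) = absv (x $ i)" "x $ i \<noteq> 0" "\<And>l. absv (y $ l - x $ l) \<le> absv (x $ i)"
  defines "k \<equiv> row_shift i ((1 / x $ i) *s (y - x))"
  shows "k \<in> GLO" "x v* k = y"
proof -
  have yi: "y $ i \<noteq> 0"
    using assms(1,2) by (metis absv_eq_0_iff)
  have int: "row_shift i ((1 / u $ i) *s (v - u)) \<in> integer_matrices"
    if "\<And>l. absv (v $ l - u $ l) \<le> absv (u $ i)" for u v :: "'a^'n"
  proof -
    have "absv (((1 / u $ i) *s (v - u)) $ l) \<le> 1" for l
      using that[of l] by (simp add: absv_divide divide_le_eq_1 flip: diff_divide_distrib)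
    then show ?thesis
      unfolding integer_matrices_def row_shift_def
      by (auto simp: integers_iff simp del: vector_smult_component intro!: absv_add_le)
  qed
  have inv: "row_shift i ((1 / u $ i) *s (v - u)) ** row_shift i ((1 / v $ i) *s (u - v)) = mat 1"
    if "u $ i \<noteq> 0" "v $ i \<noteq> 0" for u v :: "'a^'n"
  proof -
    have "z v* (row_shift i ((1 / u $ i) *s (v - u)) ** row_shift i ((1 / v $ i) *s (u - v))) = z" for z
      using that by (simp add: row_mult_row_shift vec_eq_iff field_simps flip: vector_matrix_mul_assoc)
    \<comment> \<open>A matrix is determined by its action on row vectors, its rows being the images
      of the basis vectors.\<close>
    moreover have "A $ r = axis r 1 v* A" for r and A :: "'a^'n^'n"
      by (simp add: vector_matrix_mult_def axis_def vec_eq_iff if_distrib[of "\<lambda>z. z * _"] cong: if_cong)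
    ultimately show ?thesis
      by (metis vec_eq_iff vec_mat_1)
  qed
  have "absv (x $ l - y $ l) \<le> absv (y $ i)" for l
    using assms(1,3) by (metis absv_minus_commute)
  then have "row_shift i ((1 / y $ i) *s (x - y)) \<in> integer_matrices"
    by (rule int)
  then show "k \<in> GLO"
    unfolding GLO_def k_def using int[OF assms(3)] inv[OF assms(2) yi] inv[OF yi assms(2)] by blast
  show "x v* k = y"
    using assms(2) by (simp add: k_def row_mult_row_shift vec_eq_iff)
qed

text \<open>This turns invariance under \<open>congruence_subgroup m\<close> into dependence on
  \<open>x\<close> modulo p^m alone. For m > 0 a unit coordinate of \<open>x\<close> is one of
  \<open>y\<close> as well, and one row shift suffices. For m = 0 they may share no unit coordinate,
  so two shifts are composed.\<close>

lemma congruence_subgroup_moving: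
  fixes x y :: "'a::nonarch_local_field^'n"
  assumes S: "x \<in> unit_sphere" "y \<in> unit_sphere" and xy: "vec_cong m x y"
  shows "\<exists>k\<in>congruence_subgroup m. x v* k = y"
proof (cases "m = 0")
  case True
  obtain i where i: "absv (x $ i) = 1"
    using S by (auto simp: unit_sphere_iff)
  obtain j where j: "absv (y $ j) = 1"
    using S by (auto simp: unit_sphere_iff)
  text \<open>A vector sharing a unit coordinate with each of \<open>x\<close> and \<open>y\<close>.\<close>
  define z where "z = (\<chi> l. if l = i then x $ i else if l = j then y $ j else 0)"
  have ij: "absv (z $ i) = 1" "absv (z $ j) = 1" "absv (z $ l) \<le> 1" for l
    using i j by (auto simp: z_def)
  have nz: "x $ i \<noteq> 0" "z $ j \<noteq> 0"
    using i ij by auto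
  have le: "absv (z $ l - x $ l) \<le> 1" "absv (y $ l - z $ l) \<le> 1" for l
    using S ij by (auto simp: unit_sphere_iff intro!: absv_diff_le)
  obtain k1 where "k1 \<in> GLO" "x v* k1 = z"
    using GLO_row_shift[of z i x] i ij le nz by auto
  moreover obtain k2 where "k2 \<in> GLO" "z v* k2 = y"
    using GLO_row_shift[of y j z] j ij le nz by auto
  ultimately have "k1 ** k2 \<in> GLO" "x v* (k1 ** k2) = y"
    by (auto simp: GLO_mult simp flip: vector_matrix_mul_assoc)
  moreover have "k1 ** k2 \<in> congruence_subgroup m"
    using \<open>k1 ** k2 \<in> GLO\<close> True
    by (auto simp: congruence_subgroup_iff mat_cong_def vec_cong_def ideal_power_0 integers_iff GLO_def
        integer_matrices_def mat_def intro!: absv_diff_le)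
  ultimately show ?thesis
    by blast
next
  case False
  obtain i where i: "absv (x $ i) = 1"
    using S by (auto simp: unit_sphere_iff)
  have yx: "y $ l - x $ l \<in> ideal_power m" for l
    using vec_cong_sym[OF xy] by (simp add: vec_cong_def)
  have yi: "absv (y $ i) = absv (x $ i)"
    using ideal_power_less_1[OF yx False] i by (intro absv_eqI) simp
  have nz: "x $ i \<noteq> 0"
    using i by auto
  define k where "k = row_shift i ((1 / x $ i) *s (y - x))"
  have k: "k \<in> GLO" "x v* k = y"
    using GLO_row_shift[OF yi nz] ideal_power_integer[OF yx] i unfolding k_def by auto
  have "((1 / x $ i) *s (y - x)) $ l \<in> ideal_power m" for l
    using ideal_power_mult[OF yx, of "1 / x $ i"] i by (simp add: absv_divide flip: diff_divide_distrib)
  then have "mat_cong m k (mat 1)"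
    by (auto simp: k_def mat_cong_def vec_cong_def row_shift_def mat_def simp del: vector_smult_component)
  then show ?thesis
    using k by (auto simp: congruence_subgroup_iff)
qed

lemma GLO_transitive:
  fixes x y :: "'a::nonarch_local_field^'n"
  assumes "x \<in> unit_sphere" "y \<in> unit_sphere"
  shows "\<exists>k\<in>GLO. x v* k = y"
  using congruence_subgroup_moving[OF assms vec_cong_0[OF assms]] by (auto simp: congruence_subgroup_iff)

section \<open>Invariant functions and coset representatives\<close>

lemma sum_fun_apply: "(\<Sum>i\<in>I. f i) x = (\<Sum>i\<in>I. f i x)"
  for f :: "'i \<Rightarrow> 'b \<Rightarrow> complex"
  by (induction I rule: infinite_finite_induct) auto

text \<open>Smoothness is implied by the congruence condition, because a ball around a point of the
  sphere lies in one congruence class. From here on invariance is used in this form.\<close>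

lemma invariants_iff:
  fixes f :: "'a::nonarch_local_field^'n \<Rightarrow> complex"
  shows "f \<in> invariants m \<longleftrightarrow> (\<forall>x. x \<notin> unit_sphere \<longrightarrow> f x = 0) \<and>
    (\<forall>x\<in>unit_sphere. \<forall>y\<in>unit_sphere. vec_cong m x y \<longrightarrow> f x = f y)" (is "_ \<longleftrightarrow> ?R")
proof
  assume f: "f \<in> invariants m"
  have "f x = f y" if "x \<in> unit_sphere" "y \<in> unit_sphere" "vec_cong m x y" for x y
    using congruence_subgroup_moving[OF that] f that(1) unfolding invariants_def by force
  moreover have "f x = 0" if "x \<notin> unit_sphere" for x
    using f that by (simp add: invariants_def smooth_functions_def)
  ultimately show ?R
    by metis
next
  assume R: ?R
  then have f0: "f x = 0" if "x \<notin> unit_sphere" for x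
    using that by metis
  have f: "f x = f y" if "x \<in> unit_sphere" "y \<in> unit_sphere" "vec_cong m x y" for x y
    using R that by metis
  have "\<exists>U. open U \<and> x \<in> U \<and> (\<forall>y\<in>U \<inter> unit_sphere. f y = f x)" if x: "x \<in> unit_sphere" for x
  proof (intro exI[of _ "ball x (absv ((prime_elt :: 'a) ^ m))"] conjI ballI)
    fix y assume y: "y \<in> ball x (absv ((prime_elt :: 'a) ^ m)) \<inter> unit_sphere"
    have "absv (x $ i - y $ i) \<le> dist x y" for i
      using dist_vec_nth_le[of x i y] by (simp add: dist_absv)
    then have "vec_cong m x y"
      using y by (auto simp: vec_cong_def ideal_power_iff intro: order_trans less_imp_le)
    then show "f y = f x"
      using f[of x y] x y by simp
  qed auto
  moreover have "f (x v* k) = f x" if x: "x \<in> unit_sphere" and k: "k \<in> congruence_subgroup m" for x k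
  proof -
    have "k \<in> GLO" "mat_cong m k (mat 1)"
      using k by (auto simp: congruence_subgroup_iff)
    then have "x v* k \<in> unit_sphere" "vec_cong m (x v* k) x"
      using vec_cong_mult_mat[of x m k "mat 1"] x by (auto simp: unit_sphere_GLO) (auto simp: unit_sphere_iff)
    then show ?thesis
      using f[OF _ x] by simp
  qed
  ultimately show "f \<in> invariants m"
    using f0 unfolding invariants_def smooth_functions_def by simp
qed

lemma invariants_zero: "f \<in> invariants m \<Longrightarrow> x \<notin> unit_sphere \<Longrightarrow> f x = 0"
  by (simp add: invariants_iff)

lemma invariants_cong:
  "f \<in> invariants m \<Longrightarrow> x \<in> unit_sphere \<Longrightarrow> y \<in> unit_sphere \<Longrightarrow> vec_cong m x y \<Longrightarrow> f x = f y"
  unfolding invariants_iff by metis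

lemma invariants_mono: "m \<le> m' \<Longrightarrow> invariants m \<subseteq> invariants m'"
  unfolding invariants_iff subset_iff using vec_cong_antimono by metis

lemma invariants_smooth: "invariants m \<subseteq> smooth_functions"
  by (auto simp: invariants_def)

lemma invariantsI:
  assumes "\<And>x. x \<notin> unit_sphere \<Longrightarrow> f x = 0"
    and "\<And>x y. x \<in> unit_sphere \<Longrightarrow> y \<in> unit_sphere \<Longrightarrow> vec_cong m x y \<Longrightarrow> f x = f y"
  shows "f \<in> invariants m"
  unfolding invariants_iff by (intro conjI allI ballI impI; rule assms)

lemma subspace_invariants: "cfun.subspace (invariants m)"
proof (rule cfun.subspaceI)
  fix f g :: "'a^'n \<Rightarrow> complex" and c assume f: "f \<in> invariants m"
  show "cscale c f \<in> invariants m"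
  proof (rule invariantsI)
    fix x y :: "'a^'n" assume "x \<in> unit_sphere" "y \<in> unit_sphere" "vec_cong m x y"
    from invariants_cong[OF f this] show "cscale c f x = cscale c f y"
      by (simp add: cscale_def)
  qed (simp add: cscale_def invariants_zero[OF f])
  assume g: "g \<in> invariants m"
  show "f + g \<in> invariants m"
  proof (rule invariantsI)
    fix x y :: "'a^'n" assume "x \<in> unit_sphere" "y \<in> unit_sphere" "vec_cong m x y"
    from invariants_cong[OF f this] invariants_cong[OF g this] show "(f + g) x = (f + g) y"
      by simp
  qed (simp add: invariants_zero[OF f] invariants_zero[OF g])
qed (simp add: invariants_iff)

lemma finite_vec_residues:
  "\<exists>F. finite F \<and> (\<forall>x. (\<forall>i. absv (x $ i) \<le> 1) \<longrightarrow> (\<exists>r\<in>F. vec_cong m x (r::'a::nonarch_local_field^'n)))"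
proof -
  obtain F where F: "finite F" "\<And>x::'a. x \<in> integers \<Longrightarrow> \<exists>r\<in>F. x - r \<in> ideal_power m"
    using finite_residues[of m] by blast
  define V where "V = {r :: 'a^'n. \<forall>i. r $ i \<in> F}"
  have "r \<in> vec_lambda ` (UNIV \<rightarrow>\<^sub>E F)" if "r \<in> V" for r
    using that by (intro image_eqI[of _ _ "vec_nth r"]) (auto simp: V_def)
  then have "V \<subseteq> vec_lambda ` (UNIV \<rightarrow>\<^sub>E F)"
    by blast
  then have "finite V"
    using F(1) by (simp add: finite_PiE finite_subset)
  moreover have "\<exists>r\<in>V. vec_cong m x r" if x: "\<forall>i. absv (x $ i) \<le> 1" for x
  proof -
    have "\<forall>i. \<exists>r\<in>F. x $ i - r \<in> ideal_power m"
      using F(2) x by (simp add: integers_iff)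
    then obtain r where "\<forall>i. r i \<in> F \<and> x $ i - r i \<in> ideal_power m"
      by metis
    then show ?thesis
      by (intro bexI[of _ "\<chi> i. r i"]) (auto simp: V_def vec_cong_def)
  qed
  ultimately show ?thesis
    by blast
qed

text \<open>Closedness gives completeness because the field is complete, and finiteness of the
  residues gives total boundedness.\<close>

lemma compact_unit_sphere: "compact (unit_sphere :: ('a::nonarch_local_field^'n) set)"
  unfolding compact_eq_totally_bounded complete_eq_closed
proof (intro conjI allI impI)
  have "closed ((\<Inter>i. {x :: 'a^'n. dist (x $ i) 0 \<le> 1}) \<inter> (\<Union>i. {x. dist (x $ i) 0 = 1}))"
    by (intro closed_Int closed_INT closed_UN ballI closed_Collect_le closed_Collect_eq continuous_intros)
      auto
  moreover have "(\<Inter>i. {x :: 'a^'n. dist (x $ i) 0 \<le> 1}) \<inter> (\<Union>i. {x. dist (x $ i) 0 = 1}) = unit_sphere"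
    by (auto simp: unit_sphere_iff dist_absv)
  ultimately show "closed (unit_sphere :: ('a^'n) set)"
    by simp
next
  fix e :: real assume "0 < e"
  \<comment> \<open>The Euclidean combination of the coordinate distances is at most their sum; the
    added 1 makes the final inequality strict.\<close>
  define d where "d = e / (real CARD('n) + 1)"
  have "0 < d"
    using \<open>0 < e\<close> by (simp add: d_def)
  then obtain m where m: "\<And>x::'a. x \<in> ideal_power m \<Longrightarrow> absv x < d"
    using ex_ideal_power_radius by blast
  obtain F where F: "finite F"
    "\<And>x::'a^'n. (\<forall>i. absv (x $ i) \<le> 1) \<Longrightarrow> \<exists>r\<in>F. vec_cong m x r"
    using finite_vec_residues[of m] by blast
  have "x \<in> (\<Union>r\<in>F. ball r e)" if x: "x \<in> unit_sphere" for x
  proof -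
    obtain r where r: "r \<in> F" "vec_cong m x r"
      using F(2) x by (auto simp: unit_sphere_iff)
    have "dist r x \<le> (\<Sum>i\<in>UNIV. dist (r $ i) (x $ i))"
      unfolding dist_vec_def by (rule L2_set_le_sum) simp
    also have "\<dots> \<le> (\<Sum>i\<in>(UNIV::'n set). d)"
    proof (rule sum_mono)
      fix i
      show "dist (r $ i) (x $ i) \<le> d"
        using m[of "r $ i - x $ i"] vec_cong_sym[OF r(2)] by (simp add: vec_cong_def dist_absv less_imp_le)
    qed
    also have "\<dots> < e"
      using \<open>0 < e\<close> by (simp add: d_def field_simps)
    finally show ?thesis
      using r(1) by auto
  qed
  then show "\<exists>k. finite k \<and> (unit_sphere :: ('a^'n) set) \<subseteq> (\<Union>x\<in>k. ball x e)"
    using F(1) by blast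
qed

text \<open>Compactness makes local constancy uniform: the cover by open sets of constancy has a
  Lebesgue number \<open>e\<close>, and congruence modulo a high power of p forces a distance below
  \<open>e\<close>.\<close>

lemma smooth_invariants:
  fixes f :: "'a::nonarch_local_field^'n \<Rightarrow> complex"
  assumes "f \<in> smooth_functions"
  shows "\<exists>m. f \<in> invariants m"
proof -
  have "\<forall>x\<in>unit_sphere. \<exists>U. open U \<and> x \<in> U \<and> (\<forall>y\<in>U \<inter> unit_sphere. f y = f x)"
    using assms by (simp add: smooth_functions_def)
  then obtain U where U: "\<And>x. x \<in> unit_sphere \<Longrightarrow> open (U x) \<and> x \<in> U x \<and> (\<forall>y\<in>U x \<inter> unit_sphere. f y = f x)"
    by metis
  then have "unit_sphere \<subseteq> \<Union> (U ` unit_sphere)" "\<And>G. G \<in> U ` unit_sphere \<Longrightarrow> open G"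
    by blast+
  then obtain e where e: "0 < e" "\<And>x. x \<in> unit_sphere \<Longrightarrow> \<exists>G\<in>U ` unit_sphere. ball x e \<subseteq> G"
    using Heine_Borel_lemma[OF compact_unit_sphere] by metis
  define d where "d = e / (real CARD('n) + 1)"
  have "0 < d"
    using \<open>0 < e\<close> by (simp add: d_def)
  then obtain m where m: "\<And>x::'a. x \<in> ideal_power m \<Longrightarrow> absv x < d"
    using ex_ideal_power_radius by blast
  have "f x = f y" if xy: "x \<in> unit_sphere" "y \<in> unit_sphere" "vec_cong m x y" for x y
  proof -
    have "dist x y \<le> (\<Sum>i\<in>UNIV. dist (x $ i) (y $ i))"
      unfolding dist_vec_def by (rule L2_set_le_sum) simp
    also have "\<dots> \<le> (\<Sum>i\<in>(UNIV::'n set). d)"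
    proof (rule sum_mono)
      fix i
      show "dist (x $ i) (y $ i) \<le> d"
        using m[of "x $ i - y $ i"] xy(3) by (simp add: vec_cong_def dist_absv less_imp_le)
    qed
    also have "\<dots> < e"
      using \<open>0 < e\<close> by (simp add: d_def field_simps)
    finally have "y \<in> ball x e"
      by simp
    moreover obtain z where z: "z \<in> unit_sphere" "ball x e \<subseteq> U z"
      using e(2)[OF xy(1)] by blast
    moreover have "x \<in> ball x e"
      using e(1) by simp
    ultimately have "x \<in> U z \<inter> unit_sphere" "y \<in> U z \<inter> unit_sphere"
      using xy(1,2) by auto
    then show ?thesis
      using U[OF z(1)] by metis
  qed
  then show ?thesis
    using assms unfolding invariants_iff smooth_functions_def by blast
qed

lemma smooth_eq: "smooth_functions = (\<Union>m. invariants m)"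
  using smooth_invariants invariants_smooth by blast

lemma subspace_smooth: "cfun.subspace (smooth_functions :: ('a::nonarch_local_field^'n \<Rightarrow> complex) set)"
proof (rule cfun.subspaceI)
  show "0 \<in> (smooth_functions :: ('a^'n \<Rightarrow> complex) set)"
    using cfun.subspace_0[OF subspace_invariants] invariants_smooth by blast
next
  fix f g :: "'a^'n \<Rightarrow> complex" assume "f \<in> smooth_functions" "g \<in> smooth_functions"
  then obtain m m' where "f \<in> invariants m" "g \<in> invariants m'"
    unfolding smooth_eq by blast
  then have "f + g \<in> invariants (max m m')"
    using invariants_mono[of m "max m m'"] invariants_mono[of m' "max m m'"]
    by (intro cfun.subspace_add[OF subspace_invariants]) auto
  then show "f + g \<in> smooth_functions"
    unfolding smooth_eq by blast
next
  fix c and f :: "'a^'n \<Rightarrow> complex" assume "f \<in> smooth_functions"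
  then show "cscale c f \<in> smooth_functions"
    unfolding smooth_eq using cfun.subspace_scale[OF subspace_invariants] by blast
qed

lemma right_translation_apply: "right_translation k f x = f (x v* k)"
  by (simp add: right_translation_def)

lemma right_translation_mult:
  "right_translation k (right_translation l f) = right_translation (k ** l) f"
  by (simp add: right_translation_def vector_matrix_mul_assoc fun_eq_iff)

lemma right_translation_invariants:
  fixes k :: "'a::nonarch_local_field^'n^'n"
  assumes "k \<in> GLO" "f \<in> invariants m"
  shows "right_translation k f \<in> invariants m"
  unfolding right_translation_def
proof (rule invariantsI)
  fix x :: "'a^'n" assume "x \<notin> unit_sphere"
  then show "f (x v* k) = 0"
    using assms by (intro invariants_zero) (auto simp: unit_sphere_GLO)
next
  fix x y :: "'a^'n" assume "x \<in> unit_sphere" "y \<in> unit_sphere" "vec_cong m x y"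
  then show "f (x v* k) = f (y v* k)"
    using assms by (intro invariants_cong[OF assms(2)] vec_cong_row_mult)
      (auto simp: unit_sphere_GLO GLO_integer_matrices)
qed

lemma right_translation_smooth:
  fixes k :: "'a::nonarch_local_field^'n^'n"
  shows "k \<in> GLO \<Longrightarrow> f \<in> smooth_functions \<Longrightarrow> right_translation k f \<in> smooth_functions"
  unfolding smooth_eq using right_translation_invariants by blast

lemma last_basis_vector_sphere: "last_basis_vector \<in> unit_sphere"
  by (auto simp: last_basis_vector_def unit_sphere_iff axis_def)

section \<open>Finite systems of representatives of the integral matrix group modulo p^m\<close>

definition transversal :: "nat \<Rightarrow> ('a::nonarch_local_field^'n^'n) set \<Rightarrow> bool"
  where "transversal m R \<longleftrightarrow> finite R \<and> R \<subseteq> GLO \<and> (\<forall>g\<in>GLO. \<exists>!r. r \<in> R \<and> mat_cong m g r)"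

text \<open>Reducing the rows leaves finitely many residue matrices, hence finitely many classes.
  The residue matrices themselves need not lie in \<open>GLO\<close>, so representatives are chosen
  inside the classes.\<close>

lemma ex_transversal: "\<exists>R :: ('a::nonarch_local_field^'n^'n) set. transversal m R"
proof -
  obtain F where F: "finite F" "\<And>x::'a^'n. (\<forall>i. absv (x $ i) \<le> 1) \<Longrightarrow> \<exists>r\<in>F. vec_cong m x r"
    using finite_vec_residues[of m] by blast
  define V where "V = {r :: 'a^'n^'n. \<forall>i. r $ i \<in> F}"
  have "r \<in> vec_lambda ` (UNIV \<rightarrow>\<^sub>E F)" if "r \<in> V" for r
    using that by (intro image_eqI[of _ _ "vec_nth r"]) (auto simp: V_def)
  then have "V \<subseteq> vec_lambda ` (UNIV \<rightarrow>\<^sub>E F)"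
    by blast
  then have "finite V"
    using F(1) by (simp add: finite_PiE finite_subset)
  have "\<exists>r\<in>V. mat_cong m g r" if g: "g \<in> GLO" for g
  proof -
    have "\<forall>i. \<exists>r\<in>F. vec_cong m (g $ i) r"
      using F(2) g by (simp add: integers_iff GLO_def integer_matrices_def)
    then obtain r where "\<forall>i. r i \<in> F \<and> vec_cong m (g $ i) (r i)"
      by metis
    then show ?thesis
      by (intro bexI[of _ "\<chi> i. r i"]) (auto simp: V_def mat_cong_def)
  qed
  then obtain \<rho> where \<rho>: "\<And>g. g \<in> GLO \<Longrightarrow> \<rho> g \<in> V \<and> mat_cong m g (\<rho> g)"
    by metis
  define C where "C g = {h \<in> GLO. mat_cong m g h}" for g :: "'a^'n^'n"
  have CC: "C g = C h \<longleftrightarrow> mat_cong m g h" if "g \<in> GLO" "h \<in> GLO" for g h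
  proof
    assume "C g = C h"
    then have "h \<in> C g"
      using that by (simp add: C_def)
    then show "mat_cong m g h"
      by (simp add: C_def)
  next
    assume "mat_cong m g h"
    then show "C g = C h"
      unfolding C_def using mat_cong_trans mat_cong_sym by blast
  qed
  have "C ` GLO \<subseteq> (\<lambda>v. {h \<in> GLO. mat_cong m v h}) ` V"
  proof (rule image_subsetI)
    fix g :: "'a^'n^'n" assume g: "g \<in> GLO"
    then have "C g = {h \<in> GLO. mat_cong m (\<rho> g) h}"
      unfolding C_def using \<rho>[OF g] mat_cong_trans mat_cong_sym by blast
    then show "C g \<in> (\<lambda>v. {h \<in> GLO. mat_cong m v h}) ` V"
      using \<rho>[OF g] by blast
  qed
  then have "finite (C ` GLO)"
    using \<open>finite V\<close> by (meson finite_imageI finite_subset)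
  define R where "R = (\<lambda>c. SOME g. g \<in> c) ` (C ` GLO)"
  have some: "(SOME h. h \<in> C g) \<in> C g" if "g \<in> GLO" for g
  proof (rule someI[of _ g])
    show "g \<in> C g"
      using that by (simp add: C_def)
  qed
  have "transversal m R"
    unfolding transversal_def
  proof (intro conjI ballI ex_ex1I)
    show "finite R"
      unfolding R_def using \<open>finite (C ` GLO)\<close> by blast
    show "R \<subseteq> GLO"
      unfolding R_def using some by (force simp: C_def)
  next
    fix g :: "'a^'n^'n" assume g: "g \<in> GLO"
    show "\<exists>r. r \<in> R \<and> mat_cong m g r"
      using some[OF g] g unfolding R_def by (auto simp: C_def)
  next
    fix g r r' :: "'a^'n^'n"
    assume g: "g \<in> GLO" and r: "r \<in> R \<and> mat_cong m g r" and r': "r' \<in> R \<and> mat_cong m g r'"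
    obtain a where a: "a \<in> GLO" "r = (SOME h. h \<in> C a)"
      using r unfolding R_def by blast
    obtain b where b: "b \<in> GLO" "r' = (SOME h. h \<in> C b)"
      using r' unfolding R_def by blast
    have "mat_cong m a r" "mat_cong m b r'"
      using some[OF a(1)] some[OF b(1)] a(2) b(2) by (auto simp: C_def)
    then have "mat_cong m a b"
      using r r' mat_cong_trans mat_cong_sym by metis
    then have "C a = C b"
      using CC a(1) b(1) by blast
    then show "r = r'"
      using a b by simp
  qed
  then show ?thesis
    by blast
qed

lemma transversalE:
  assumes "transversal m R" "g \<in> GLO"
  obtains s where "s \<in> R" "s \<in> GLO" "mat_cong m g s" "\<And>r. r \<in> R \<Longrightarrow> mat_cong m g r \<Longrightarrow> r = s"
proof -
  have "\<exists>!r. r \<in> R \<and> mat_cong m g r"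
    using assms by (simp add: transversal_def)
  moreover have "R \<subseteq> GLO"
    using assms by (simp add: transversal_def)
  ultimately show ?thesis
    using that by blast
qed

lemma transversal_mult_left:
  assumes R: "transversal m R" and k: "k \<in> GLO"
  shows "transversal m ((**) k ` R)"
proof -
  obtain l where l: "l \<in> GLO" "k ** l = mat 1" "l ** k = mat 1"
    using GLO_inverse[OF k] .
  have ml: "mat_cong m (l ** g) r \<longleftrightarrow> mat_cong m g (k ** r)" for g r
    using mat_cong_mult_left[OF GLO_integer_matrices[OF k], of m "l ** g" r]
      mat_cong_mult_left[OF GLO_integer_matrices[OF l(1)], of m g "k ** r"]
    by (auto simp: matrix_mul_assoc l)
  have *: "\<exists>!r. r \<in> (**) k ` R \<and> mat_cong m g r" if "g \<in> GLO" for g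
  proof -
    have "\<exists>!r. r \<in> R \<and> mat_cong m (l ** g) r"
      using R GLO_mult[OF l(1) that] unfolding transversal_def by blast
    then show ?thesis
      unfolding ml by blast
  qed
  have "finite R" "R \<subseteq> GLO"
    using R by (auto simp: transversal_def)
  then have "finite ((**) k ` R)" "(**) k ` R \<subseteq> GLO"
    using GLO_mult[OF k] by auto
  then show ?thesis
    unfolding transversal_def using * by simp
qed

lemma transversal_mult_right:
  assumes R: "transversal m R" and k: "k \<in> GLO"
  shows "transversal m ((\<lambda>g. g ** k) ` R)"
proof -
  obtain l where l: "l \<in> GLO" "k ** l = mat 1" "l ** k = mat 1"
    using GLO_inverse[OF k] .
  have ml: "mat_cong m (g ** l) r \<longleftrightarrow> mat_cong m g (r ** k)" for g r
    using mat_cong_mult_right[OF GLO_integer_matrices[OF k], of m "g ** l" r]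
      mat_cong_mult_right[OF GLO_integer_matrices[OF l(1)], of m g "r ** k"]
    by (auto simp: l simp flip: matrix_mul_assoc)
  have *: "\<exists>!r. r \<in> (\<lambda>g. g ** k) ` R \<and> mat_cong m g r" if "g \<in> GLO" for g
  proof -
    have "\<exists>!r. r \<in> R \<and> mat_cong m (g ** l) r"
      using R GLO_mult[OF that l(1)] unfolding transversal_def by blast
    then show ?thesis
      unfolding ml by blast
  qed
  have "finite R" "R \<subseteq> GLO"
    using R by (auto simp: transversal_def)
  then have "finite ((\<lambda>g. g ** k) ` R)" "(\<lambda>g. g ** k) ` R \<subseteq> GLO"
    using GLO_mult[OF _ k] by auto
  then show ?thesis
    unfolding transversal_def using * by simp
qed

lemma inj_on_mult_GLO:
  fixes k :: "'a::nonarch_local_field^'n^'n"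
  assumes "k \<in> GLO"
  shows "inj ((**) k)" "inj (\<lambda>g. g ** k)"
proof -
  obtain l where l: "l \<in> GLO" "k ** l = mat 1" "l ** k = mat 1"
    using GLO_inverse[OF assms] .
  show "inj ((**) k)"
    by (rule inj_on_inverseI[of _ "(**) l"]) (simp add: matrix_mul_assoc l)
  show "inj (\<lambda>g. g ** k)"
    by (rule inj_on_inverseI[of _ "\<lambda>g. g ** l"]) (simp add: l flip: matrix_mul_assoc)
qed

text \<open>Reduction modulo \<open>\<pp>\<^sup>m\<close> is a bijection between any two transversals.\<close>

lemma sum_transversal:
  fixes F :: "'a::nonarch_local_field^'n^'n \<Rightarrow> complex"
  assumes R: "transversal m R" and R': "transversal m R'"
    and F: "\<And>g h. g \<in> GLO \<Longrightarrow> h \<in> GLO \<Longrightarrow> mat_cong m g h \<Longrightarrow> F g = F h"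
  shows "sum F R = sum F R'"
proof (rule sum.reindex_bij_witness)
  let ?p = "\<lambda>R g. THE r. r \<in> R \<and> mat_cong m g r"
  have p: "?p R g \<in> R \<and> mat_cong m g (?p R g)" if "transversal m R" "g \<in> GLO" for R and g :: "'a^'n^'n"
    using that theI'[of "\<lambda>r. r \<in> R \<and> mat_cong m g r"] unfolding transversal_def by blast
  have pp: "?p R (?p R' r) = r" if R: "transversal m R" "transversal m R'" "r \<in> R" for R R' and r :: "'a^'n^'n"
  proof -
    have r: "r \<in> GLO"
      using R by (auto simp: transversal_def)
    then have "mat_cong m (?p R' r) r" "?p R' r \<in> GLO"
      using p[OF R(2) r] R(2) mat_cong_sym by (auto simp: transversal_def)
    then show ?thesis
      using R unfolding transversal_def by (intro the1_equality) auto
  qed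
  fix a
  {
    assume a: "a \<in> R"
    then have "a \<in> GLO"
      using R by (auto simp: transversal_def)
    show "?p R (?p R' a) = a" "?p R' a \<in> R'"
      using pp[OF R R' a] p[OF R' \<open>a \<in> GLO\<close>] by auto
    show "F (?p R' a) = F a"
      using p[OF R' \<open>a \<in> GLO\<close>] R' \<open>a \<in> GLO\<close> by (metis F subsetD transversal_def)
  next
    assume a: "a \<in> R'"
    then have "a \<in> GLO"
      using R' by (auto simp: transversal_def)
    show "?p R' (?p R a) = a" "?p R a \<in> R"
      using pp[OF R' R a] p[OF R \<open>a \<in> GLO\<close>] by auto
  }
qed

lemma transversal_nonempty: "transversal m R \<Longrightarrow> R \<noteq> {}"
  unfolding transversal_def using GLO_one by blast

section \<open>The inner product and orthogonal projection\<close>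

definition coset :: "nat \<Rightarrow> 'a::nonarch_local_field^'n^'n \<Rightarrow> ('a^'n^'n) set"
  where "coset m g = {h \<in> GLO. mat_cong m h g}"

text \<open>By the ultrametric inequality each entry of the product is 1-Lipschitz in the right
  factor. Continuity serves to make left translation measurable.\<close>

lemma continuous_matrix_mult_left:
  fixes k :: "'a::nonarch_local_field^'n^'n"
  assumes "k \<in> integer_matrices"
  shows "continuous_on UNIV ((**) k :: 'a^'n^'n \<Rightarrow> _)"
proof -
  have "dist (\<Sum>l\<in>UNIV. k $ i $ l * g $ l $ j) (\<Sum>l\<in>UNIV. k $ i $ l * h $ l $ j) \<le> dist g h"
    for g h :: "'a^'n^'n" and i j :: 'n
  proof -
    have "absv (k $ i $ l * (g $ l $ j - h $ l $ j)) \<le> dist g h" for l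
    proof -
      have "absv (k $ i $ l) * absv (g $ l $ j - h $ l $ j) \<le> 1 * dist (g $ l $ j) (h $ l $ j)"
        using assms by (intro mult_mono) (auto simp: integer_matrices_def integers_iff dist_absv)
      also have "\<dots> \<le> dist g h"
        using dist_vec_nth_le[of "g $ l" j "h $ l"] dist_vec_nth_le[of g l h] by simp
      finally show ?thesis
        by (simp add: absv_mult)
    qed
    then have "absv (\<Sum>l\<in>UNIV. k $ i $ l * (g $ l $ j - h $ l $ j)) \<le> dist g h"
      by (intro absv_sum_le) auto
    then show ?thesis
      by (simp add: dist_absv algebra_simps sum_subtractf)
  qed
  then have "continuous_on UNIV (\<lambda>g :: 'a^'n^'n. \<Sum>l\<in>UNIV. k $ i $ l * g $ l $ j)" for i j :: 'n
    unfolding continuous_on_iff by (blast intro: order_le_less_trans)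
  then show ?thesis
    unfolding matrix_matrix_mult_def by (intro continuous_on_vec_lambda) auto
qed

lemma inner_prod_scale_left: "inner_prod \<mu> (cscale c f) g = c * inner_prod \<mu> f g"
  by (simp add: inner_prod_def cscale_def mult.assoc)

lemma inner_prod_commute: "inner_prod \<mu> g f = cnj (inner_prod \<mu> f g)"
  unfolding inner_prod_def by (simp add: mult.commute flip: Bochner_Integration.integral_cnj)

lemma inner_prod_scale_right: "inner_prod \<mu> f (cscale c g) = cnj c * inner_prod \<mu> f g"
  using inner_prod_commute inner_prod_scale_left by (metis complex_cnj_mult)

lemma inner_prod_zero_left [simp]: "inner_prod \<mu> 0 f = 0"
  and inner_prod_zero_right [simp]: "inner_prod \<mu> f 0 = 0"
  by (simp_all add: inner_prod_def)

lemma smooth_common_invariants: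
  assumes "f \<in> smooth_functions" "g \<in> smooth_functions"
  obtains m where "f \<in> invariants m" "g \<in> invariants m"
proof -
  obtain m m' where "f \<in> invariants m" "g \<in> invariants m'"
    using assms unfolding smooth_eq by blast
  then have "f \<in> invariants (max m m')" "g \<in> invariants (max m m')"
    using invariants_mono[of m "max m m'"] invariants_mono[of m' "max m m'"] by auto
  then show ?thesis
    by (rule that)
qed

context
  fixes \<mu> :: "('a::nonarch_local_field^'n::{finite,linorder}^'n::{finite,linorder}) measure"
  assumes haar: "haar_probability \<mu>"
begin

lemma sets_haar: "sets \<mu> = sets (restrict_space borel GLO)"
  and prob_space_haar: "prob_space \<mu>"
  using haar by (auto simp: haar_probability_def)

lemma space_haar: "space \<mu> = GLO"
  using sets_eq_imp_space_eq[OF sets_haar] by (simp add: space_restrict_space)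

lemma sets_coset: "coset m g \<in> sets \<mu>"
proof -
  let ?C = "{h :: (('a, 'n) vec, 'n) vec. \<forall>i j. dist (h $ i $ j) (g $ i $ j) \<le> absv ((prime_elt :: 'a) ^ m)}"
  have "closed ?C"
    by (intro closed_Collect_all closed_Collect_le continuous_intros)
  then have "GLO \<inter> ?C \<in> sets \<mu>"
    unfolding sets_haar sets_restrict_space by (rule imageI[OF borel_closed])
  moreover have "GLO \<inter> ?C = coset m g"
    by (simp add: coset_def mat_cong_def vec_cong_def ideal_power_iff dist_absv Int_def)
  ultimately show ?thesis
    by simp
qed

text \<open>Left translation by \<open>g\<close> pulls the class of \<open>g\<close> back to the
  class of the identity. The invariance of the measure enters here and nowhere else.\<close>

lemma measure_coset: 
  assumes g: "g \<in> GLO"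
  shows "measure \<mu> (coset m g) = measure \<mu> (coset m (mat 1))"
proof -
  have meas: "(**) g \<in> measurable \<mu> \<mu>"
    unfolding measurable_cong_sets[OF sets_haar sets_haar]
    using borel_measurable_continuous_onI[OF continuous_matrix_mult_left[OF GLO_integer_matrices[OF g]]]
    by (rule measurable_restrict_space3) (auto intro: GLO_mult[OF g])
  obtain l where l: "l \<in> GLO" "g ** l = mat 1" "l ** g = mat 1"
    using GLO_inverse[OF g] .
  have "mat_cong m (g ** h) g \<longleftrightarrow> mat_cong m h (mat 1)" for h
    using mat_cong_mult_left[OF GLO_integer_matrices[OF g], of m h "mat 1"]
      mat_cong_mult_left[OF GLO_integer_matrices[OF l(1)], of m "g ** h" g]
    by (auto simp: matrix_mul_assoc l)
  then have "(**) g -` coset m g \<inter> space \<mu> = coset m (mat 1)"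
    using GLO_mult[OF g] by (auto simp: coset_def space_haar)
  moreover have "distr \<mu> \<mu> ((**) g) = \<mu>"
    using haar g by (simp add: haar_probability_def)
  ultimately show ?thesis
    using measure_distr[OF meas sets_coset, of m g] by simp
qed

text \<open>On \<open>GLO\<close> the integrand is a finite combination of indicators of classes of
  equal measure. The auxiliary formula \<open>int\<close> is proved for all such integrands, so that
  the constant 1 can evaluate this common measure.\<close>

lemma integral_transversal:
  fixes F :: "(('a, 'n) vec, 'n) vec \<Rightarrow> complex"
  assumes R: "transversal m R"
    and F: "\<And>g h. g \<in> GLO \<Longrightarrow> h \<in> GLO \<Longrightarrow> mat_cong m g h \<Longrightarrow> F g = F h"
  shows "integral\<^sup>L \<mu> F = (\<Sum>r\<in>R. F r) / of_nat (card R)"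
proof -
  interpret prob_space \<mu>
    by (rule prob_space_haar)
  have RG: "R \<subseteq> GLO" "finite R"
    using R by (auto simp: transversal_def)
  have int: "integral\<^sup>L \<mu> F = (\<Sum>r\<in>R. measure \<mu> (coset m (mat 1)) *\<^sub>R F r)"
    if F: "\<And>g h. g \<in> GLO \<Longrightarrow> h \<in> GLO \<Longrightarrow> mat_cong m g h \<Longrightarrow> F g = F h"
    for F :: "(('a, 'n) vec, 'n) vec \<Rightarrow> complex"
  proof -
    have "has_bochner_integral \<mu> (\<lambda>g. \<Sum>r\<in>R. indicator (coset m r) g *\<^sub>R F r)
        (\<Sum>r\<in>R. measure \<mu> (coset m r) *\<^sub>R F r)"
      by (intro has_bochner_integral_sum has_bochner_integral_indicator sets_coset)
        (simp flip: top.not_eq_extremum)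
    then have "integral\<^sup>L \<mu> (\<lambda>g. \<Sum>r\<in>R. indicator (coset m r) g *\<^sub>R F r)
        = (\<Sum>r\<in>R. measure \<mu> (coset m r) *\<^sub>R F r)"
      by (rule has_bochner_integral_integral_eq)
    moreover have "(\<Sum>r\<in>R. indicator (coset m r) g *\<^sub>R F r) = F g" if g: "g \<in> GLO" for g
    proof -
      obtain s where s: "s \<in> R" "s \<in> GLO" "mat_cong m g s"
        "\<And>r. r \<in> R \<Longrightarrow> mat_cong m g r \<Longrightarrow> r = s"
        by (rule transversalE[OF R g]) (rule that)
      have "mat_cong m g r \<longleftrightarrow> r = s" if "r \<in> R" for r
        using s(3) s(4)[OF that] by blast
      then have "(\<Sum>r\<in>R. indicator (coset m r) g *\<^sub>R F r) = (\<Sum>r\<in>R. if r = s then F s else 0)"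
        using g by (intro sum.cong refl) (simp add: coset_def indicator_def)
      also have "\<dots> = F s"
        using RG s(1) by simp
      also have "\<dots> = F g"
        using F[OF g s(2,3)] by simp
      finally show ?thesis .
    qed
    then have "integral\<^sup>L \<mu> (\<lambda>g. \<Sum>r\<in>R. indicator (coset m r) g *\<^sub>R F r) = integral\<^sup>L \<mu> F"
      by (intro Bochner_Integration.integral_cong) (auto simp: space_haar)
    moreover have "measure \<mu> (coset m r) *\<^sub>R F r = measure \<mu> (coset m (mat 1)) *\<^sub>R F r" if "r \<in> R" for r
      using measure_coset[of r m] that RG by auto
    ultimately show ?thesis
      by simp
  qed
  have "1 = of_nat (card R) * complex_of_real (measure \<mu> (coset m (mat 1)))"
    using int[of "\<lambda>_. 1"] by (simp add: prob_space scaleR_conv_of_real)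
  then have "complex_of_real (measure \<mu> (coset m (mat 1))) = 1 / of_nat (card R)"
    by (metis mult_zero_left nonzero_eq_divide_eq mult.commute zero_neq_one)
  then show ?thesis
    using int[OF F] by (simp add: scaleR_conv_of_real sum_divide_distrib)
qed

lemma inner_prod_transversal:
  assumes R: "transversal m R" and f: "f \<in> invariants m" and g: "g \<in> invariants m"
  shows "inner_prod \<mu> f g =
    (\<Sum>r\<in>R. f (last_basis_vector v* r) * cnj (g (last_basis_vector v* r))) / of_nat (card R)"
  unfolding inner_prod_def
proof (rule integral_transversal[OF R])
  fix k l :: "(('a, 'n) vec, 'n) vec" assume kl: "k \<in> GLO" "l \<in> GLO" "mat_cong m k l"
  have "absv ((last_basis_vector :: ('a, 'n) vec) $ i) \<le> 1" for i
    using last_basis_vector_sphere unfolding unit_sphere_iff by blast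
  then have "vec_cong m (last_basis_vector v* k) (last_basis_vector v* l)"
    by (rule vec_cong_mult_mat[OF _ kl(3)])
  moreover have "last_basis_vector v* k \<in> unit_sphere" "last_basis_vector v* l \<in> unit_sphere"
    using kl by (auto simp: unit_sphere_GLO last_basis_vector_sphere)
  ultimately have "f (last_basis_vector v* k) = f (last_basis_vector v* l)"
    "g (last_basis_vector v* k) = g (last_basis_vector v* l)"
    using invariants_cong f g by blast+
  then show "f (last_basis_vector v* k) * cnj (g (last_basis_vector v* k)) =
      f (last_basis_vector v* l) * cnj (g (last_basis_vector v* l))"
    by simp
qed

text \<open>At a common level both sides are finite averages, which makes integrability conditions
  unnecessary.\<close>

lemma inner_prod_add_left:
  assumes f: "f \<in> smooth_functions" and g: "g \<in> smooth_functions" and h: "h \<in> smooth_functions"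
  shows "inner_prod \<mu> (f + g) h = inner_prod \<mu> f h + inner_prod \<mu> g h"
proof -
  obtain m1 where m1: "f \<in> invariants m1" "g \<in> invariants m1"
    using smooth_common_invariants[OF f g] .
  obtain m2 where m2: "h \<in> invariants m2"
    using smooth_common_invariants[OF h h] .
  define m where "m = max m1 m2"
  have m: "f \<in> invariants m" "g \<in> invariants m" "h \<in> invariants m"
    using m1 m2 invariants_mono[of m1 m] invariants_mono[of m2 m] by (auto simp: m_def)
  then have fg: "f + g \<in> invariants m"
    by (intro cfun.subspace_add[OF subspace_invariants])
  obtain R :: "((('a, 'n) vec, 'n) vec) set" where R: "transversal m R"
    using ex_transversal by blast
  show ?thesis
    unfolding inner_prod_transversal[OF R fg m(3)] inner_prod_transversal[OF R m(1,3)]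
      inner_prod_transversal[OF R m(2,3)]
    by (simp add: algebra_simps sum.distrib add_divide_distrib)
qed

lemma inner_prod_add_right:
  assumes "f \<in> smooth_functions" "g \<in> smooth_functions" "h \<in> smooth_functions"
  shows "inner_prod \<mu> h (f + g) = inner_prod \<mu> h f + inner_prod \<mu> h g"
  using inner_prod_add_left[OF assms] inner_prod_commute by (metis complex_cnj_add)

lemma inner_prod_diff_left:
  assumes f: "f \<in> smooth_functions" and g: "g \<in> smooth_functions" and h: "h \<in> smooth_functions"
  shows "inner_prod \<mu> (f - g) h = inner_prod \<mu> f h - inner_prod \<mu> g h"
  using inner_prod_add_left[OF cfun.subspace_diff[OF subspace_smooth f g] g h] by simp

lemma inner_prod_sum_left:
  assumes "\<And>i. i \<in> I \<Longrightarrow> f i \<in> smooth_functions" "h \<in> smooth_functions"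
  shows "inner_prod \<mu> (\<Sum>i\<in>I. f i) h = (\<Sum>i\<in>I. inner_prod \<mu> (f i) h)"
  using assms
proof (induction I rule: infinite_finite_induct)
  case (insert i I)
  then have "(\<Sum>i\<in>I. f i) \<in> smooth_functions"
    by (intro cfun.subspace_sum[OF subspace_smooth]) auto
  then show ?case
    using insert inner_prod_add_left[of "f i" "\<Sum>i\<in>I. f i" h]
    by (simp add: plus_fun_def)
qed auto

text \<open>A vanishing sum of squares makes \<open>f\<close> zero at the images of e_n under the
  representatives. By transitivity these meet every congruence class of the sphere.\<close>

lemma inner_prod_definite:
  assumes f: "f \<in> smooth_functions" and ff: "inner_prod \<mu> f f = 0"
  shows "f = 0"
proof -
  obtain m where m: "f \<in> invariants m"
    using smooth_invariants[OF f] by blast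
  obtain R :: "((('a, 'n) vec, 'n) vec) set" where R: "transversal m R"
    using ex_transversal by blast
  then have RG: "R \<subseteq> GLO" "finite R" "R \<noteq> {}"
    using transversal_nonempty by (auto simp: transversal_def)
  have "(\<Sum>r\<in>R. f (last_basis_vector v* r) * cnj (f (last_basis_vector v* r))) = 0"
    using ff RG unfolding inner_prod_transversal[OF R m m] by simp
  then have "complex_of_real (\<Sum>r\<in>R. (cmod (f (last_basis_vector v* r)))\<^sup>2) = 0"
    by (simp only: of_real_sum complex_norm_square)
  then have "(\<Sum>r\<in>R. (cmod (f (last_basis_vector v* r)))\<^sup>2) = 0"
    by (simp only: of_real_eq_0_iff)
  then have fr: "f (last_basis_vector v* r) = 0" if "r \<in> R" for r
    using that RG by (simp add: sum_nonneg_eq_0_iff)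
  have "f x = 0" for x
  proof (cases "x \<in> unit_sphere")
    case True
    then obtain k where k: "k \<in> GLO" "last_basis_vector v* k = x"
      using GLO_transitive[OF last_basis_vector_sphere] by blast
    obtain r where r: "r \<in> R" "mat_cong m k r"
      using transversalE[OF R k(1)] .
    have "vec_cong m x (last_basis_vector v* r)"
      unfolding k(2)[symmetric] using last_basis_vector_sphere[unfolded unit_sphere_iff]
      by (intro vec_cong_mult_mat r(2)) blast
    moreover have "last_basis_vector v* r \<in> unit_sphere"
      using r RG by (auto simp: unit_sphere_GLO last_basis_vector_sphere)
    ultimately show ?thesis
      using invariants_cong[OF m True] fr[OF r(1)] by metis
  qed (rule invariants_zero[OF m])
  then show ?thesis
    by auto
qed

lemma inner_prod_right_translation:
  assumes f: "f \<in> smooth_functions" and g: "g \<in> smooth_functions" and k: "k \<in> GLO"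
  shows "inner_prod \<mu> (right_translation k f) (right_translation k g) = inner_prod \<mu> f g"
proof -
  obtain m where m: "f \<in> invariants m" "g \<in> invariants m"
    using smooth_common_invariants[OF f g] .
  obtain R :: "((('a, 'n) vec, 'n) vec) set" where R: "transversal m R"
    using ex_transversal by blast
  note inj = inj_on_subset[OF inj_on_mult_GLO(2)[OF k] subset_UNIV]
  \<comment> \<open>The average is read off the right translate of \<open>R\<close> by
    \<open>k\<close>, which is again a transversal.\<close>
  have "inner_prod \<mu> f g =
      (\<Sum>r\<in>(\<lambda>g. g ** k) ` R. f (last_basis_vector v* r) * cnj (g (last_basis_vector v* r)))
        / of_nat (card ((\<lambda>g. g ** k) ` R))"
    by (rule inner_prod_transversal[OF transversal_mult_right[OF R k] m])
  also have "\<dots> = (\<Sum>r\<in>R. f (last_basis_vector v* (r ** k)) * cnj (g (last_basis_vector v* (r ** k))))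
        / of_nat (card R)"
    by (simp add: sum.reindex[OF inj] card_image[OF inj])
  also have "\<dots> = inner_prod \<mu> (right_translation k f) (right_translation k g)"
    unfolding inner_prod_transversal[OF R right_translation_invariants[OF k m(1)] right_translation_invariants[OF k m(2)]]
    by (simp add: right_translation_def vector_matrix_mul_assoc)
  finally show ?thesis
    by simp
qed

end

section \<open>Finite dimension, orthogonal projection and direct sums\<close>

lemma finite_dimensional_invariants:
  "\<exists>D. finite D \<and> (invariants m :: ('a::nonarch_local_field^'n \<Rightarrow> complex) set) \<subseteq> cfun.span D"
proof -
  obtain F where F: "finite F"
    "\<And>x::'a^'n. (\<forall>i. absv (x $ i) \<le> 1) \<Longrightarrow> \<exists>r\<in>F. vec_cong m x r"
    using finite_vec_residues[of m] by blast
  define d :: "'a^'n \<Rightarrow> 'a^'n \<Rightarrow> complex"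
    where "d r x = (if x \<in> unit_sphere \<and> vec_cong m x r then 1 else 0)" for r x
  \<comment> \<open>Summing over the set of indicator functions instead of over \<open>F\<close>
    counts a class with several representatives once. A class missing the sphere has zero indicator,
    and any value of \<open>p\<close> serves for it.\<close>
  define p where "p c = (SOME x. c x = (1::complex))" for c :: "'a^'n \<Rightarrow> complex"
  have eq: "f = (\<Sum>c\<in>d ` F. cscale (f (p c)) c)" if f: "f \<in> invariants m" for f
  proof
    fix x
    show "f x = (\<Sum>c\<in>d ` F. cscale (f (p c)) c) x"
    proof (cases "x \<in> unit_sphere")
      case True
      then obtain r where r: "r \<in> F" "vec_cong m x r"
        using F(2) by (auto simp: unit_sphere_iff)
      have uniq: "d s x = (if d s = d r then 1 else 0)" for s
      proof (cases "vec_cong m x s")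
        case True
        then have "vec_cong m y s \<longleftrightarrow> vec_cong m y r" for y
          using r(2) vec_cong_trans vec_cong_sym by metis
        then have "d s = d r"
          by (simp add: d_def fun_eq_iff)
        then show ?thesis
          using r(2) \<open>x \<in> unit_sphere\<close> by (simp add: d_def)
      next
        case False
        then have "d s x = 0" "d r x = 1"
          using r(2) \<open>x \<in> unit_sphere\<close> by (simp_all add: d_def)
        then show ?thesis
          by (metis zero_neq_one)
      qed
      have "d r (p (d r)) = 1"
        unfolding p_def by (rule someI[of _ x]) (use r True in \<open>simp add: d_def\<close>)
      then have p: "p (d r) \<in> unit_sphere" "vec_cong m (p (d r)) r"
        by (auto simp: d_def split: if_splits)
      have "(\<Sum>c\<in>d ` F. cscale (f (p c)) c) x = (\<Sum>c\<in>d ` F. if c = d r then f (p (d r)) else 0)"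
        unfolding sum_fun_apply cscale_def using uniq by (intro sum.cong) auto
      also have "\<dots> = f (p (d r))"
        using F(1) r(1) by simp
      also have "\<dots> = f x"
        using vec_cong_trans[OF p(2) vec_cong_sym[OF r(2)]] by (rule invariants_cong[OF f p(1) True])
      finally show ?thesis
        by simp
    next
      case False
      then have "(\<Sum>c\<in>d ` F. cscale (f (p c)) c) x = 0"
        unfolding sum_fun_apply cscale_def by (intro sum.neutral) (auto simp: d_def)
      then show ?thesis
        using invariants_zero[OF f False] by simp
    qed
  qed
  have "f \<in> cfun.span (d ` F)" if "f \<in> invariants m" for f
    by (subst eq[OF that]) (intro cfun.span_sum cfun.span_scale cfun.span_base)
  then have "invariants m \<subseteq> cfun.span (d ` F)"
    by (rule subsetI)
  then show ?thesis
    using F(1) by blast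
qed

lemma finite_basis_subspace_invariants:
  fixes W :: "('a::nonarch_local_field^'n \<Rightarrow> complex) set"
  assumes "cfun.subspace W" "W \<subseteq> invariants m"
  obtains B where "finite B" "cfun.span B = W"
proof -
  obtain D where D: "finite D" "W \<subseteq> cfun.span D"
    using finite_dimensional_invariants[of m, where 'a='a and 'n='n] assms(2) by blast
  obtain B where B: "B \<subseteq> W" "cfun.independent B" "W \<subseteq> cfun.span B"
    using cfun.maximal_independent_subset[of W] by blast
  have "B \<subseteq> cfun.span D"
    using B(1) D(2) by blast
  then have "finite B"
    using cfun.independent_span_bound[OF D(1) B(2)] by blast
  moreover have "cfun.span B = W"
    using cfun.span_subspace[OF B(1,3) assms(1)] .
  ultimately show ?thesis
    by (rule that)
qed

text \<open>Lets the spanning half of \<open>orthogonal_direct_sum\<close>, for finite and infinite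
  index sets alike, be proved through spans.\<close>

lemma sums_eq_span:
  fixes V :: "'i \<Rightarrow> ('b \<Rightarrow> complex) set"
  assumes V: "\<And>i. i \<in> I \<Longrightarrow> cfun.subspace (V i)"
  shows "{\<Sum>i\<in>J. v i |J v. finite J \<and> J \<subseteq> I \<and> (\<forall>i\<in>J. v i \<in> V i)} = cfun.span (\<Union>i\<in>I. V i)"
    (is "?S = ?T")
proof
  show "?S \<subseteq> ?T"
    by (auto intro!: cfun.span_sum intro: cfun.span_base)
  have "cfun.subspace ?S"
  proof (rule cfun.subspaceI)
    show "0 \<in> ?S"
      by (auto intro!: exI[of _ "{}"])
  next
    fix x y assume "x \<in> ?S" "y \<in> ?S"
    then obtain J v K w where
      J: "x = (\<Sum>i\<in>J. v i)" "finite J" "J \<subseteq> I" "\<forall>i\<in>J. v i \<in> V i" and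
      K: "y = (\<Sum>i\<in>K. w i)" "finite K" "K \<subseteq> I" "\<forall>i\<in>K. w i \<in> V i"
      by blast
    \<comment> \<open>Both families are extended by zero, so that they can be added over the union
      of their index sets.\<close>
    define u where "u i = (if i \<in> J then v i else 0) + (if i \<in> K then w i else 0)" for i
    have "u i \<in> V i" if "i \<in> J \<union> K" for i
      unfolding u_def using that J K V[of i] by (intro cfun.subspace_add) (auto simp: cfun.subspace_0)
    moreover have "x + y = (\<Sum>i\<in>J \<union> K. u i)"
      unfolding u_def sum.distrib using J K
      by (simp add: sum.If_cases Int_absorb1 Int_absorb2 flip: sum.inter_restrict)
    ultimately show "x + y \<in> ?S"
      using J(2,3) K(2,3) by blast
  next
    fix c x assume "x \<in> ?S"
    then obtain J v where
      J: "x = (\<Sum>i\<in>J. v i)" "finite J" "J \<subseteq> I" "\<forall>i\<in>J. v i \<in> V i"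
      by blast
    have "cscale c x = (\<Sum>i\<in>J. cscale c (v i))"
      unfolding J(1) by (rule cfun.scale_sum_right)
    moreover have "cscale c (v i) \<in> V i" if "i \<in> J" for i
      using that J V[of i] by (intro cfun.subspace_scale) auto
    ultimately show "cscale c x \<in> ?S"
      using J(2,3) by blast
  qed
  moreover have "x \<in> ?S" if "i \<in> I" "x \<in> V i" for i x
  proof -
    have "x = (\<Sum>j\<in>{i}. x)"
      by simp
    then show ?thesis
      using that by blast
  qed
  then have "(\<Union>i\<in>I. V i) \<subseteq> ?S"
    by blast
  ultimately show "?T \<subseteq> ?S"
    by (intro cfun.span_minimal)
qed

context
  fixes \<mu> :: "('a::nonarch_local_field^'n::{finite,linorder}^'n::{finite,linorder}) measure"
  assumes haar: "haar_probability \<mu>"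
begin

lemma inner_prod_span_eq_0:
  assumes h: "h \<in> smooth_functions" and B: "B \<subseteq> smooth_functions"
    and orth: "\<And>b. b \<in> B \<Longrightarrow> inner_prod \<mu> h b = 0" and w: "w \<in> cfun.span B"
  shows "inner_prod \<mu> h w = 0"
proof -
  have "cfun.subspace {w \<in> smooth_functions. inner_prod \<mu> h w = 0}"
    using h by (intro cfun.subspaceI)
      (auto simp: inner_prod_add_right[OF haar] inner_prod_scale_right inner_prod_zero_right
        cfun.subspace_0[OF subspace_smooth] intro: cfun.subspace_add[OF subspace_smooth]
        cfun.subspace_scale[OF subspace_smooth])
  then have "cfun.span B \<subseteq> {w \<in> smooth_functions. inner_prod \<mu> h w = 0}"
    using B orth by (intro cfun.span_minimal) auto
  then show ?thesis
    using w by auto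
qed

text \<open>Gram-Schmidt, one vector at a time. The induction leaves \<open>f\<close> arbitrary
  because its hypothesis is applied to the new vector \<open>b\<close> as well as to
  \<open>f\<close>.\<close>

lemma ex_projection_span:
  assumes "finite B" "B \<subseteq> smooth_functions" "f \<in> smooth_functions"
  shows "\<exists>p\<in>cfun.span B. \<forall>w\<in>cfun.span B. inner_prod \<mu> (f - p) w = 0"
  using assms
proof (induction B arbitrary: f rule: finite_induct)
  case empty
  then show ?case
    by (auto simp: inner_prod_zero_right simp flip: zero_fun_def)
next
  case (insert b B)
  have B: "B \<subseteq> smooth_functions" "b \<in> smooth_functions"
    using insert.prems(1) by auto
  have sp: "cfun.span B \<subseteq> smooth_functions"
    using B(1) subspace_smooth by (rule cfun.span_minimal)
  have spi: "cfun.span B \<subseteq> cfun.span (insert b B)" "b \<in> cfun.span (insert b B)"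
    using cfun.span_mono[OF subset_insertI[of B b]] cfun.span_base[of b "insert b B"] by auto
  obtain q where q: "q \<in> cfun.span B" "\<forall>w\<in>cfun.span B. inner_prod \<mu> (b - q) w = 0"
    using insert.IH[OF B] by blast
  obtain p where p: "p \<in> cfun.span B" "\<forall>w\<in>cfun.span B. inner_prod \<mu> (f - p) w = 0"
    using insert.IH[OF B(1) insert.prems(2)] by blast
  have qs: "q \<in> smooth_functions" and ps: "p \<in> smooth_functions"
    using p(1) q(1) sp by auto
  define b' where "b' = b - q"
  \<comment> \<open>If the denominator is zero, then \<open>b'\<close> is zero by definiteness, and
    the value of \<open>c\<close> does not matter.\<close>
  define c where "c = inner_prod \<mu> (f - p) b' / inner_prod \<mu> b' b'"
  define p' where "p' = p + cscale c b'"
  have b's: "b' \<in> smooth_functions"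
    unfolding b'_def using B(2) qs by (rule cfun.subspace_diff[OF subspace_smooth])
  have fps: "f - p \<in> smooth_functions"
    using insert.prems(2) ps by (rule cfun.subspace_diff[OF subspace_smooth])
  have cbs: "cscale c b' \<in> smooth_functions"
    using b's by (rule cfun.subspace_scale[OF subspace_smooth])
  have eq: "inner_prod \<mu> (f - p') w = inner_prod \<mu> (f - p) w - c * inner_prod \<mu> b' w"
    if "w \<in> smooth_functions" for w
    using inner_prod_diff_left[OF haar fps cbs that]
    by (simp add: p'_def diff_diff_eq inner_prod_scale_left)
  have f's: "f - p' \<in> smooth_functions"
    using cfun.subspace_diff[OF subspace_smooth fps cbs] by (simp add: p'_def diff_diff_eq)
  have "inner_prod \<mu> (f - p') w = 0" if "w \<in> B" for w
    using that eq[of w] B(1) p(2) q(2) cfun.span_base[OF that] by (auto simp: b'_def)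
  moreover have "inner_prod \<mu> (f - p') q = 0"
    using eq[OF qs] q p(2) by (simp add: b'_def)
  moreover have "inner_prod \<mu> (f - p') b' = 0"
  proof (cases "inner_prod \<mu> b' b' = 0")
    case True
    then show ?thesis
      using inner_prod_definite[OF haar b's] by (simp add: inner_prod_zero_right)
  next
    case False
    then show ?thesis
      using eq[OF b's] by (simp add: c_def)
  qed
  moreover have "b = b' + q"
    by (simp add: b'_def)
  ultimately have "inner_prod \<mu> (f - p') w = 0" if "w \<in> insert b B" for w
    using that inner_prod_add_right[OF haar b's qs f's] by auto
  then have "\<forall>w\<in>cfun.span (insert b B). inner_prod \<mu> (f - p') w = 0"
    using inner_prod_span_eq_0[OF f's insert.prems(1)] by blast
  moreover have "p' \<in> cfun.span (insert b B)"
    unfolding p'_def b'_def using p(1) q(1) spi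
    by (intro cfun.span_add cfun.span_scale cfun.span_diff) auto
  ultimately show ?case
    by blast
qed

lemma ex_projection:
  assumes "cfun.subspace W" "W \<subseteq> invariants m" "f \<in> smooth_functions"
  obtains p where "p \<in> W" "\<And>w. w \<in> W \<Longrightarrow> inner_prod \<mu> (f - p) w = 0"
proof -
  obtain B where B: "finite B" "cfun.span B = W"
    using finite_basis_subspace_invariants[OF assms(1,2)] by blast
  then have "B \<subseteq> smooth_functions"
    using assms(2) invariants_smooth cfun.span_superset by blast
  then show ?thesis
    using ex_projection_span[OF B(1) _ assms(3)] that B(2) by blast
qed

text \<open>Independence follows from orthogonality: pairing a vanishing sum with one of its terms
  leaves the squared norm of that term.\<close>

lemma orthogonal_direct_sumI:
  assumes V: "\<And>i. i \<in> I \<Longrightarrow> cfun.subspace (V i)" "\<And>i. i \<in> I \<Longrightarrow> V i \<subseteq> smooth_functions"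
    and orth: "\<And>i j f g. i \<in> I \<Longrightarrow> j \<in> I \<Longrightarrow> i \<noteq> j \<Longrightarrow> f \<in> V i \<Longrightarrow> g \<in> V j \<Longrightarrow> inner_prod \<mu> f g = 0"
    and W: "W = cfun.span (\<Union>i\<in>I. V i)"
  shows "orthogonal_direct_sum \<mu> I V W"
proof -
  have indep: "v i = 0" if J: "finite J" "J \<subseteq> I" "\<And>i. i \<in> J \<Longrightarrow> v i \<in> V i" "(\<Sum>i\<in>J. v i) = 0" and i: "i \<in> J" for J v i
  proof -
    have sm: "v j \<in> smooth_functions" if "j \<in> J" for j
      using J V(2) that by blast
    have "0 = inner_prod \<mu> (\<Sum>j\<in>J. v j) (v i)"
      using J(4) by (simp add: inner_prod_zero_left)
    also have "\<dots> = (\<Sum>j\<in>J. inner_prod \<mu> (v j) (v i))"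
      using sm i by (intro inner_prod_sum_left[OF haar]) auto
    also have "\<dots> = (\<Sum>j\<in>J. if j = i then inner_prod \<mu> (v i) (v i) else 0)"
    proof (rule sum.cong[OF refl])
      fix j assume "j \<in> J"
      then show "inner_prod \<mu> (v j) (v i) = (if j = i then inner_prod \<mu> (v i) (v i) else 0)"
        using orth[of j i "v j" "v i"] J(2,3) i by auto
    qed
    also have "\<dots> = inner_prod \<mu> (v i) (v i)"
      using J(1) i by simp
    finally show ?thesis
      using inner_prod_definite[OF haar sm[OF i]] by simp
  qed
  show ?thesis
    unfolding orthogonal_direct_sum_def
  proof (intro conjI)
    show "W = {\<Sum>i\<in>J. v i |J v. finite J \<and> J \<subseteq> I \<and> (\<forall>i\<in>J. v i \<in> V i)}"
      unfolding W by (rule sums_eq_span[symmetric]) (rule V(1))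
    show "\<forall>J v. finite J \<and> J \<subseteq> I \<and> (\<forall>i\<in>J. v i \<in> V i) \<and> (\<Sum>i\<in>J. v i) = 0 \<longrightarrow> (\<forall>i\<in>J. v i = 0)"
    proof (intro allI impI ballI, elim conjE)
      fix J v i assume "finite J" "J \<subseteq> I" "\<forall>i\<in>J. v i \<in> V i" "(\<Sum>i\<in>J. v i) = 0" "i \<in> J"
      then show "v i = 0"
        by (intro indep[of J v i]) simp_all
    qed
  qed (use V(1) orth in \<open>simp_all\<close>)
qed

end

section \<open>Characters of the unit group and isotypic decomposition\<close>

text \<open>The subgroup \<open>1 + \<pp>\<^sup>m\<close> of \<open>\<O>\<^sup>\<times>\<close>, which is all of \<open>\<O>\<^sup>\<times>\<close> for \<open>m = 0\<close>.\<close>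

definition unit_subgroup :: "nat \<Rightarrow> 'a::nonarch_local_field set"
  where "unit_subgroup m = {a. absv a = 1 \<and> a - 1 \<in> ideal_power m}"

lemma unit_subgroup_eq:
  "(if m = 0 then integer_units else {1 + x |x. x \<in> ideal_power m}) = (unit_subgroup m :: 'a::nonarch_local_field set)"
proof (cases "m = 0")
  case True
  then show ?thesis
    by (auto simp: unit_subgroup_def integer_units_iff ideal_power_0 integers_iff intro: absv_diff_le)
next
  case False
  have "absv (1 + x) = 1" if "x \<in> ideal_power m" for x :: 'a
    using ideal_power_less_1[OF that False] absv_eqI[of "1 + x" 1] by simp
  then show ?thesis
    using False by (auto simp: unit_subgroup_def intro!: exI[of _ "_ - 1"])
qed

lemma conductor_eq: "conductor \<omega> = (LEAST m. \<forall>a\<in>unit_subgroup m. \<omega> a = 1)"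
  unfolding conductor_def unit_subgroup_eq ..

lemma unit_subgroup_antimono: "m \<le> m' \<Longrightarrow> unit_subgroup m' \<subseteq> (unit_subgroup m :: 'a::nonarch_local_field set)"
  unfolding unit_subgroup_def using ideal_power_antimono by blast

lemma unit_subgroup_divide:
  fixes a b :: "'a::nonarch_local_field"
  assumes "absv a = 1" "absv b = 1" "a - b \<in> ideal_power m"
  shows "a / b \<in> unit_subgroup m"
proof -
  have "b \<noteq> 0"
    using assms(2) by auto
  then have "a / b - 1 = (1 / b) * (a - b)"
    by (simp add: field_simps)
  then have "a / b - 1 \<in> ideal_power m"
    using ideal_power_mult[OF assms(3), of "1 / b"] assms(2) by (simp add: absv_divide)
  then show ?thesis
    using assms by (simp add: unit_subgroup_def absv_divide)
qed

lemma unit_subgroup_mult: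
  "a \<in> unit_subgroup m \<Longrightarrow> b \<in> unit_subgroup m \<Longrightarrow> a * b \<in> unit_subgroup m"
  for a b :: "'a::nonarch_local_field"
  using ideal_power_add[OF ideal_power_mult[of "b - 1" m a], of "a - 1"]
  by (simp add: unit_subgroup_def absv_mult algebra_simps)

lemma unit_subgroup_power: "a \<in> unit_subgroup m \<Longrightarrow> a ^ k \<in> unit_subgroup m"
  for a :: "'a::nonarch_local_field"
  by (induction k) (auto intro: unit_subgroup_mult, simp add: unit_subgroup_def)

text \<open>Pigeonhole: two powers of \<open>a\<close> have the same residue. This makes the values
  of characters roots of unity and translation by \<open>a\<close> periodic on functions of level
  \<open>m\<close>.\<close>

lemma ex_power_unit_subgroup:
  fixes a :: "'a::nonarch_local_field"
  assumes a: "absv a = 1"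
  shows "\<exists>N>0. a ^ N \<in> unit_subgroup m"
proof -
  obtain F where F: "finite F" "\<And>x::'a. x \<in> integers \<Longrightarrow> \<exists>r\<in>F. x - r \<in> ideal_power m"
    using finite_residues[of m] by blast
  have "\<exists>r\<in>F. a ^ j - r \<in> ideal_power m" for j :: nat
    using a by (intro F(2)) (simp add: integers_iff absv_power)
  then obtain r where r: "\<And>j::nat. r j \<in> F \<and> a ^ j - r j \<in> ideal_power m"
    by metis
  then have "finite (range r)"
    using F(1) by (meson finite_subset image_subsetI)
  then have "\<not> inj r"
    using finite_imageD infinite_UNIV_nat by blast
  then obtain i j where ij: "i < j" "r i = r j"
    by (metis injI linorder_neqE_nat)
  have "a ^ j - a ^ i \<in> ideal_power m"
    using ideal_power_trans[of "a ^ j" "r j" m "a ^ i"] r[of i] r[of j] ij(2)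
    by (simp add: ideal_power_diff_commute)
  then have "a ^ j / a ^ i \<in> unit_subgroup m"
    using a by (intro unit_subgroup_divide) (auto simp: absv_power)
  moreover have "a ^ j / a ^ i = a ^ (j - i)"
    using a ij(1) by (subst power_diff) auto
  ultimately show ?thesis
    using ij(1) by (intro exI[of _ "j - i"]) auto
qed

text \<open>\<open>\<complex>\<^sup>\<times>\<close> has no nontrivial subgroup close to \<open>1\<close>: squaring moves \<open>z\<close> away from \<open>1\<close> by the
  factor \<open>\<bar>z + 1\<bar> \<ge> 3/2\<close>.\<close>

lemma powers_near_1_imp_eq_1:
  fixes z :: complex
  assumes z: "\<And>k. cmod (z ^ k - 1) \<le> 1 / 2"
  shows "z = 1"
proof -
  have le: "(3 / 2) ^ j * cmod (z - 1) \<le> cmod (z ^ (2 ^ j) - 1)" for j :: nat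
  proof (induction j)
    case (Suc j)
    define w where "w = z ^ (2 ^ j)"
    have "cmod 2 \<le> cmod (w + 1) + cmod (w - 1)"
      using norm_triangle_ineq4[of "w + 1" "w - 1"] by simp
    then have "3 / 2 \<le> cmod (w + 1)"
      using z[of "2 ^ j"] by (simp add: w_def)
    then have "(3 / 2) * ((3 / 2) ^ j * cmod (z - 1)) \<le> cmod (w + 1) * cmod (w - 1)"
      using Suc by (intro mult_mono) (auto simp: w_def)
    also have "\<dots> = cmod (z ^ (2 ^ Suc j) - 1)"
      by (simp add: w_def power_mult power2_eq_square algebra_simps mult_2 power_add flip: norm_mult)
    finally show ?case
      by (simp add: mult.assoc)
  qed simp
  show ?thesis
  proof (rule ccontr)
    assume "z \<noteq> 1"
    then obtain j where "1 / cmod (z - 1) < (3 / 2) ^ j"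
      using real_arch_pow[of "3 / 2" "1 / cmod (z - 1)"] by auto
    then have "1 < (3 / 2) ^ j * cmod (z - 1)"
      using \<open>z \<noteq> 1\<close> by (simp add: pos_divide_less_eq)
    then show False
      using le[of j] z[of "2 ^ j"] by linarith
  qed
qed

section \<open>Values of characters and the isotypic spaces\<close>

lemma character_mult:
  "\<omega> \<in> characters \<Longrightarrow> absv a = 1 \<Longrightarrow> absv b = 1 \<Longrightarrow> \<omega> (a * b) = \<omega> a * \<omega> b"
  by (simp add: characters_def integer_units_iff)

lemma character_nz: "\<omega> \<in> characters \<Longrightarrow> absv a = 1 \<Longrightarrow> \<omega> a \<noteq> 0"
  by (simp add: characters_def integer_units_iff)

lemma character_zero: "\<omega> \<in> characters \<Longrightarrow> absv a \<noteq> 1 \<Longrightarrow> \<omega> a = 0"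
  by (simp add: characters_def integer_units_iff)

lemma character_one: "\<omega> \<in> characters \<Longrightarrow> \<omega> 1 = 1"
  using character_mult[of \<omega> 1 1] character_nz[of \<omega> 1] by simp

lemma character_power: "\<omega> \<in> characters \<Longrightarrow> absv a = 1 \<Longrightarrow> \<omega> (a ^ k) = \<omega> a ^ k"
  by (induction k) (auto simp: character_one character_mult absv_power)

text \<open>Makes the \<open>LEAST\<close> in \<open>conductor\<close> meaningful. By continuity
  some subgroup 1 + p^m is mapped into the disc of radius 1/2 about 1, and closure under powers
  collapses its image to 1.\<close>

lemma ex_trivial_unit_subgroup:
  fixes \<omega> :: "'a::nonarch_local_field \<Rightarrow> complex"
  assumes \<omega>: "\<omega> \<in> characters"
  shows "\<exists>m. \<forall>a\<in>unit_subgroup m. \<omega> a = 1"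
proof -
  have cont: "continuous_on integer_units \<omega>" "1 \<in> integer_units"
    using \<omega> by (auto simp: characters_def integer_units_iff)
  then obtain d where d: "0 < d" "\<And>a. a \<in> integer_units \<Longrightarrow> dist a 1 < d \<Longrightarrow> dist (\<omega> a) (\<omega> 1) < 1 / 2"
    using cont(1)[unfolded continuous_on_iff, rule_format, OF cont(2), of "1 / 2"] by auto
  obtain m where m: "\<And>x::'a. x \<in> ideal_power m \<Longrightarrow> absv x < d"
    using ex_ideal_power_radius[OF d(1)] by blast
  have near: "cmod (\<omega> a - 1) \<le> 1 / 2" if "a \<in> unit_subgroup m" for a
    using d(2)[of a] m[of "a - 1"] that
    by (auto simp: unit_subgroup_def integer_units_iff dist_absv dist_norm character_one[OF \<omega>])
  have "\<omega> a = 1" if a: "a \<in> unit_subgroup m" for a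
  proof (rule powers_near_1_imp_eq_1)
    fix k
    show "cmod (\<omega> a ^ k - 1) \<le> 1 / 2"
      using near[OF unit_subgroup_power[OF a, of k]] a character_power[OF \<omega>]
      by (simp add: unit_subgroup_def)
  qed
  then show ?thesis
    by blast
qed

lemma character_eq_1:
  assumes \<omega>: "\<omega> \<in> characters" and m: "conductor \<omega> \<le> m" and a: "a \<in> unit_subgroup m"
  shows "\<omega> a = 1"
proof -
  have "\<forall>a\<in>unit_subgroup (conductor \<omega>). \<omega> a = 1"
    unfolding conductor_eq by (rule LeastI_ex[OF ex_trivial_unit_subgroup[OF \<omega>]])
  then show ?thesis
    using a unit_subgroup_antimono[OF m] by blast
qed

lemma ex_character_neq_1: "m < conductor \<omega> \<Longrightarrow> \<exists>a\<in>unit_subgroup m. \<omega> a \<noteq> 1"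
  unfolding conductor_eq using not_less_Least by blast

lemma character_cong:
  assumes \<omega>: "\<omega> \<in> characters" and m: "conductor \<omega> \<le> m"
    and ab: "absv a = 1" "absv b = 1" "a - b \<in> ideal_power m"
  shows "\<omega> a = \<omega> b"
proof -
  have "b \<noteq> 0"
    using ab(2) by auto
  have "\<omega> (a / b) = 1"
    using character_eq_1[OF \<omega> m unit_subgroup_divide[OF ab]] .
  then show ?thesis
    using character_mult[OF \<omega>, of "a / b" b] ab \<open>b \<noteq> 0\<close> by (simp add: absv_divide)
qed

text \<open>Unitarity is not part of the definition of \<open>characters\<close>: it holds because
  some power of \<open>a\<close> lies in the subgroup on which the character is trivial.\<close>

lemma cmod_character:
  assumes \<omega>: "\<omega> \<in> characters" and a: "absv a = 1"
  shows "cmod (\<omega> a) = 1"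
proof -
  obtain N where N: "0 < N" "a ^ N \<in> unit_subgroup (conductor \<omega>)"
    using ex_power_unit_subgroup[OF a] by blast
  then have "\<omega> a ^ N = 1"
    using character_eq_1[OF \<omega> order_refl N(2)] character_power[OF \<omega> a] by simp
  then have "cmod (\<omega> a) ^ N = 1"
    by (metis norm_one norm_power)
  then show ?thesis
    using N(1) by (metis norm_ge_zero power_eq_1_iff less_numeral_extra(3) norm_one power_eq_iff_eq_base power_one zero_le_one)
qed

lemma character_mult_cnj: "\<omega> \<in> characters \<Longrightarrow> absv a = 1 \<Longrightarrow> \<omega> a * cnj (\<omega> a) = 1"
  using cmod_character[of \<omega> a] by (simp flip: complex_norm_square)

lemma isotypic_scale:
  "f \<in> isotypic_invariants \<omega> m \<Longrightarrow> absv a = 1 \<Longrightarrow> f (a *s x) = \<omega> a * f x"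
  for x :: "'a::nonarch_local_field^'n"
  using invariants_zero[of f m x] invariants_zero[of f m "a *s x"] unit_sphere_scale[of a x]
  by (cases "x \<in> unit_sphere") (auto simp: isotypic_invariants_def integer_units_iff)

lemma isotypic_invariants_subset: "isotypic_invariants \<omega> m \<subseteq> invariants m"
  by (auto simp: isotypic_invariants_def)

lemma isotypicI:
  assumes "f \<in> invariants m" "\<And>a x. absv a = 1 \<Longrightarrow> x \<in> unit_sphere \<Longrightarrow> f (a *s x) = \<omega> a * f x"
  shows "f \<in> isotypic_invariants \<omega> m"
  using assms by (simp add: isotypic_invariants_def integer_units_iff)

lemma isotypic_mono: "m \<le> m' \<Longrightarrow> isotypic_invariants \<omega> m \<subseteq> isotypic_invariants \<omega> m'"
  using invariants_mono by (fastforce simp: isotypic_invariants_def)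

lemma subspace_isotypic:
  "cfun.subspace (isotypic_invariants \<omega> m :: ('a::nonarch_local_field^'n \<Rightarrow> complex) set)"
proof (rule cfun.subspaceI)
  show "0 \<in> (isotypic_invariants \<omega> m :: ('a^'n \<Rightarrow> complex) set)"
    using cfun.subspace_0[OF subspace_invariants] by (intro isotypicI) auto
next
  fix f g :: "'a^'n \<Rightarrow> complex" assume fg: "f \<in> isotypic_invariants \<omega> m" "g \<in> isotypic_invariants \<omega> m"
  then have "f + g \<in> invariants m"
    using isotypic_invariants_subset by (intro cfun.subspace_add[OF subspace_invariants]) auto
  then show "f + g \<in> isotypic_invariants \<omega> m"
    using isotypic_scale[OF fg(1)] isotypic_scale[OF fg(2)] by (intro isotypicI) (auto simp: algebra_simps)
next
  fix c and f :: "'a^'n \<Rightarrow> complex" assume f: "f \<in> isotypic_invariants \<omega> m"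
  then have "cscale c f \<in> invariants m"
    using isotypic_invariants_subset by (intro cfun.subspace_scale[OF subspace_invariants]) auto
  then show "cscale c f \<in> isotypic_invariants \<omega> m"
    using isotypic_scale[OF f] by (intro isotypicI) (auto simp: cscale_def)
qed

lemma right_translation_isotypic:
  fixes k :: "'a::nonarch_local_field^'n^'n"
  assumes k: "k \<in> GLO" and f: "f \<in> isotypic_invariants \<omega> m"
  shows "right_translation k f \<in> isotypic_invariants \<omega> m"
  using right_translation_invariants[OF k, of f m] f isotypic_invariants_subset isotypic_scale[OF f]
  by (intro isotypicI) (auto simp: right_translation_apply scale_row_mult)

section \<open>Simultaneous eigenvectors of the unit group\<close>

definition unit_translation :: "'a::nonarch_local_field \<Rightarrow> ('a^'n \<Rightarrow> complex) \<Rightarrow> 'a^'n \<Rightarrow> complex"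
  where "unit_translation a f x = f (a *s x)"

definition joint_eigenvectors :: "nat \<Rightarrow> 'a::nonarch_local_field set \<Rightarrow> ('a^'n \<Rightarrow> complex) set"
  where "joint_eigenvectors m A = {f \<in> invariants m. \<forall>a\<in>A. \<exists>c. unit_translation a f = cscale c f}"

lemma unit_translation_invariants:
  fixes f :: "'a::nonarch_local_field^'n \<Rightarrow> complex"
  assumes "absv a = 1" "f \<in> invariants m"
  shows "unit_translation a f \<in> invariants m"
proof (rule invariantsI)
  fix x :: "'a^'n" assume "x \<notin> unit_sphere"
  then show "unit_translation a f x = 0"
    unfolding unit_translation_def using assms(1)
    by (intro invariants_zero[OF assms(2)]) (simp add: unit_sphere_scale)
next
  fix x y :: "'a^'n" assume "x \<in> unit_sphere" "y \<in> unit_sphere" "vec_cong m x y"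
  then show "unit_translation a f x = unit_translation a f y"
    unfolding unit_translation_def using assms(1)
    by (intro invariants_cong[OF assms(2)] vec_cong_scale) (auto simp: unit_sphere_scale)
qed

lemma unit_translation_periodic:
  fixes f :: "'a::nonarch_local_field^'n \<Rightarrow> complex"
  assumes f: "f \<in> invariants m" and a: "a \<in> unit_subgroup m"
  shows "f (a *s x) = f x"
proof (cases "x \<in> unit_sphere")
  case True
  have "x $ i * (a - 1) \<in> ideal_power m" for i
    using True a by (intro ideal_power_mult) (auto simp: unit_sphere_iff unit_subgroup_def)
  then have "vec_cong m (a *s x) x"
    by (simp add: vec_cong_def algebra_simps)
  then show ?thesis
    using a True by (intro invariants_cong[OF f]) (auto simp: unit_sphere_scale unit_subgroup_def)
next
  case False
  then show ?thesis
    using a invariants_zero[OF f] unit_sphere_scale[of a x] by (simp add: unit_subgroup_def)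
qed

text \<open>Finite Fourier analysis, one unit at a time. At level \<open>m\<close> translation by
  \<open>a\<close> has finite order, so \<open>f\<close> is a mean of eigenvectors for roots of
  unity. These remain eigenvectors for the earlier units because the translations commute.\<close>

lemma joint_eigenvectors_span:
  fixes A :: "'a::nonarch_local_field set"
  assumes "finite A" "\<And>a. a \<in> A \<Longrightarrow> absv a = 1"
  shows "(invariants m :: ('a^'n \<Rightarrow> complex) set) \<subseteq> cfun.span (joint_eigenvectors m A)"
  using assms
proof (induction A rule: finite_induct)
  case empty
  show ?case
    by (auto simp: joint_eigenvectors_def intro: cfun.span_base)
next
  case (insert a A)
  have a: "absv a = 1"
    using insert.prems by simp
  obtain N where N: "0 < N" "a ^ N \<in> unit_subgroup m"
    using ex_power_unit_subgroup[OF a] by blast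
  define \<zeta> where "\<zeta> = cis (2 * pi / real N)"
  have \<zeta>N: "\<zeta> ^ N = 1"
    using N(1) unfolding \<zeta>_def Complex.DeMoivre by simp
  have \<zeta>nz: "\<zeta> \<noteq> 0"
    by (simp add: \<zeta>_def)
  have \<zeta>k: "\<zeta> ^ k \<noteq> 1" if "0 < k" "k < N" for k
  proof
    assume "\<zeta> ^ k = 1"
    then have "cos (real k * (2 * pi / real N)) = 1"
      unfolding \<zeta>_def Complex.DeMoivre by (simp add: complex_eq_iff)
    then obtain n :: int where "real k * (2 * pi / real N) = of_int n * 2 * pi"
      unfolding cos_one_2pi_int by blast
    then have "real_of_int (int k) = real_of_int (n * int N)"
      using N(1) by (simp add: field_simps)
    then have "int k = n * int N"
      by (simp only: of_int_eq_iff)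
    then show False
      using that by (metis dvd_triv_right int_dvd_int_iff nat_dvd_not_less)
  qed
  have "f \<in> cfun.span (joint_eigenvectors m (insert a A))" if f: "f \<in> joint_eigenvectors m A" for f :: "'a^'n \<Rightarrow> complex"
  proof -
    have fm: "f \<in> invariants m"
      using f by (simp add: joint_eigenvectors_def)
    define T where "T k = unit_translation (a ^ k) f" for k
    \<comment> \<open>Up to the factor \<open>N\<close>, the projection of \<open>f\<close> to the
      eigenspace of eigenvalue \<open>\<zeta> ^ j\<close>.\<close>
    define g where "g j = (\<Sum>k<N. cscale (inverse \<zeta> ^ (j * k)) (T k))" for j
    have TN: "T N = T 0"
      using unit_translation_periodic[OF fm N(2)] by (simp add: T_def unit_translation_def fun_eq_iff)
    have Tm: "T k \<in> invariants m" for k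
      unfolding T_def using a by (intro unit_translation_invariants fm) (simp add: absv_power)
    have gm: "g j \<in> invariants m" for j
      unfolding g_def using Tm
      by (intro cfun.subspace_sum[OF subspace_invariants] cfun.subspace_scale[OF subspace_invariants])
    have gx: "g j x = (\<Sum>k<N. inverse \<zeta> ^ (j * k) * T k x)" for j x
      by (simp add: g_def sum_fun_apply cscale_def)
    have "unit_translation a (g j) = cscale (\<zeta> ^ j) (g j)" for j
    proof
      fix x
      have "unit_translation a (g j) x = (\<Sum>k<N. inverse \<zeta> ^ (j * k) * T (Suc k) x)"
        by (simp add: unit_translation_def gx T_def mult.commute)
      also have "\<dots> = (\<Sum>k<N. \<zeta> ^ j * (inverse \<zeta> ^ (j * Suc k) * T (Suc k) x))"
        using \<zeta>nz by (intro sum.cong) (auto simp: power_add field_simps)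
      also have "\<dots> = \<zeta> ^ j * (\<Sum>k<N. inverse \<zeta> ^ (j * Suc k) * T (Suc k) x)"
        by (simp only: sum_distrib_left)
      \<comment> \<open>A cyclic shift of the index: the terms for k = N and k = 0 agree.\<close>
      also have "(\<Sum>k<N. inverse \<zeta> ^ (j * Suc k) * T (Suc k) x) = (\<Sum>k<N. inverse \<zeta> ^ (j * k) * T k x)"
      proof -
        have "inverse \<zeta> ^ (j * N) = 1"
          using \<zeta>N by (metis mult.commute power_mult power_inverse inverse_1 power_one)
        then show ?thesis
          using sum.lessThan_Suc[of "\<lambda>k. inverse \<zeta> ^ (j * k) * T k x" N]
            sum.lessThan_Suc_shift[of "\<lambda>k. inverse \<zeta> ^ (j * k) * T k x" N] TN by simp
      qed
      also have "\<zeta> ^ j * (\<Sum>k<N. inverse \<zeta> ^ (j * k) * T k x) = cscale (\<zeta> ^ j) (g j) x"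
        by (simp add: gx cscale_def)
      finally show "unit_translation a (g j) x = cscale (\<zeta> ^ j) (g j) x" .
    qed
    moreover have "\<exists>c. unit_translation b (g j) = cscale c (g j)" if b: "b \<in> A" for b j
    proof -
      obtain c where c: "unit_translation b f = cscale c f"
        using f b by (auto simp: joint_eigenvectors_def)
      have "T k (b *s x) = c * T k x" for k x
        using fun_cong[OF c, of "a ^ k *s x"]
        by (simp add: T_def unit_translation_def cscale_def mult.commute)
      then have "unit_translation b (g j) = cscale c (g j)"
        by (simp add: unit_translation_def gx cscale_def fun_eq_iff sum_distrib_left mult_ac)
      then show ?thesis
        by blast
    qed
    ultimately have "g j \<in> joint_eigenvectors m (insert a A)" for j
      using gm by (auto simp: joint_eigenvectors_def)
    then have "cscale (1 / of_nat N) (\<Sum>j<N. g j) \<in> cfun.span (joint_eigenvectors m (insert a A))"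
      by (intro cfun.span_scale cfun.span_sum cfun.span_base)
    moreover have "cscale (1 / of_nat N) (\<Sum>j<N. g j) = f"
    proof
      fix x
      \<comment> \<open>Fourier inversion: for k > 0 the powers of the nontrivial root
        \<open>inverse \<zeta> ^ k\<close> sum to zero, so only k = 0 survives.\<close>
      have "(\<Sum>j<N. g j x) = (\<Sum>k<N. \<Sum>j<N. inverse \<zeta> ^ (j * k) * T k x)"
        unfolding gx by (rule sum.swap)
      also have "\<dots> = (\<Sum>k<N. if k = 0 then of_nat N * f x else 0)"
      proof (rule sum.cong[OF refl])
        fix k assume k: "k \<in> {..<N}"
        show "(\<Sum>j<N. inverse \<zeta> ^ (j * k) * T k x) = (if k = 0 then of_nat N * f x else 0)"
        proof (cases "k = 0")
          case True
          then show ?thesis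
            by (simp add: T_def unit_translation_def)
        next
          case False
          have 1: "inverse \<zeta> ^ k \<noteq> 1"
            using \<zeta>k[of k] k False by (simp add: power_inverse)
          have "(inverse \<zeta> ^ k) ^ N = 1"
            using \<zeta>N by (metis mult.commute power_mult power_inverse inverse_1 power_one)
          then have "(\<Sum>j<N. (inverse \<zeta> ^ k) ^ j) = 0"
            using geometric_sum[OF 1, of N] by simp
          then have "(\<Sum>j<N. inverse \<zeta> ^ (j * k)) = 0"
            by (simp add: power_mult[symmetric] mult.commute)
          then show ?thesis
            using False by (simp flip: sum_distrib_right)
        qed
      qed
      also have "\<dots> = of_nat N * f x"
        using N(1) by simp
      finally show "cscale (1 / of_nat N) (\<Sum>j<N. g j) x = f x"
        using N(1) by (simp add: cscale_def sum_fun_apply)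
    qed
    ultimately show ?thesis
      by simp
  qed
  then have "cfun.span (joint_eigenvectors m A) \<subseteq> cfun.span (joint_eigenvectors m (insert a A) :: ('a^'n \<Rightarrow> complex) set)"
    by (intro cfun.span_minimal) auto
  then show ?case
    using insert.IH insert.prems by auto
qed

text \<open>At level \<open>m\<close> a unit acts through its class modulo 1 + p^m, so diagonalising
  finitely many representatives diagonalises all units; the eigenvalues of a nonzero eigenvector
  then form a character.\<close>

lemma invariants_span_isotypic:
  "(invariants m :: ('a::nonarch_local_field^'n \<Rightarrow> complex) set) \<subseteq>
    cfun.span (\<Union>\<omega>\<in>{\<omega> \<in> characters. conductor \<omega> \<le> m}. isotypic_invariants \<omega> m)"
proof -
  \<comment> \<open>The level is raised to \<open>Suc m\<close> because a residue of a unit is sure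
    to be a unit only at a positive level, and \<open>m\<close> may be 0.\<close>
  obtain F where F: "finite F" "\<And>x::'a. x \<in> integers \<Longrightarrow> \<exists>r\<in>F. x - r \<in> ideal_power (Suc m)"
    using finite_residues[of "Suc m"] by blast
  define A where "A = {a \<in> F. absv a = 1}"
  have A: "\<exists>a\<in>A. b / a \<in> unit_subgroup m" if b: "absv b = 1" for b
  proof -
    obtain a where a: "a \<in> F" "b - a \<in> ideal_power (Suc m)"
      using F(2)[of b] b by (auto simp: integers_iff)
    have "absv a = 1"
      using ideal_power_less_1[OF a(2)] absv_eqI[of a b] b by (simp add: absv_minus_commute)
    moreover have "b - a \<in> ideal_power m"
      using a(2) ideal_power_antimono[of m "Suc m"] by auto
    ultimately show ?thesis
      using a(1) unit_subgroup_divide[OF b] by (auto simp: A_def)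
  qed
  have "f \<in> cfun.span (\<Union>\<omega>\<in>{\<omega> \<in> characters. conductor \<omega> \<le> m}. isotypic_invariants \<omega> m)"
    if f: "f \<in> joint_eigenvectors m A" for f :: "'a^'n \<Rightarrow> complex"
  \<comment> \<open>The zero function determines no eigenvalues and hence no character.\<close>
  proof (cases "f = 0")
    case True
    then show ?thesis
      by (simp only: cfun.span_zero)
  next
    case False
    have fm: "f \<in> invariants m"
      using f by (simp add: joint_eigenvectors_def)
    obtain x0 where x0: "f x0 \<noteq> 0"
      using False by (auto simp: fun_eq_iff)
    have "\<exists>c. unit_translation b f = cscale c f" if b: "absv b = 1" for b
    proof -
      obtain a where a: "a \<in> A" "b / a \<in> unit_subgroup m"
        using A[OF b] by blast
      then have "a \<noteq> 0"
        by (auto simp: A_def)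
      obtain c where c: "unit_translation a f = cscale c f"
        using f a(1) by (auto simp: joint_eigenvectors_def)
      have "f (b *s x) = f (a *s x)" for x
        using unit_translation_periodic[OF fm a(2), of "a *s x"] \<open>a \<noteq> 0\<close> by simp
      then show ?thesis
        using c by (auto simp: unit_translation_def fun_eq_iff)
    qed
    then obtain c where c: "\<And>b x. absv b = 1 \<Longrightarrow> f (b *s x) = c b * f x"
      unfolding unit_translation_def cscale_def fun_eq_iff by metis
    define \<omega> where "\<omega> b = (if absv b = 1 then c b else 0)" for b
    have c1: "c b = 1" if "b \<in> unit_subgroup m" for b
      using unit_translation_periodic[OF fm that, of x0] c[of b x0] that x0 by (simp add: unit_subgroup_def)
    have cm: "c (a * b) = c a * c b" if "absv a = 1" "absv b = 1" for a b
      using c[of "a * b" x0] c[of a "b *s x0"] c[of b x0] that x0 by (simp add: absv_mult)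
    have nz: "c b \<noteq> 0" if "absv b = 1" for b
    proof -
      have "b \<noteq> 0"
        using that by auto
      then have "c b * c (inverse b) = 1"
        using cm[of b "inverse b"] that c1[of 1] by (simp add: absv_inverse unit_subgroup_def)
      then show ?thesis
        by auto
    qed
    have loc: "c b = c a" if "absv a = 1" "absv b = 1" "b - a \<in> ideal_power m" for a b
    proof -
      have "a \<noteq> 0"
        using that by auto
      then show ?thesis
        using cm[of "b / a" a] c1[OF unit_subgroup_divide[of b a m]] that by (simp add: absv_divide)
    qed
    have "continuous_on integer_units \<omega>"
      unfolding continuous_on_iff
    proof (intro ballI allI impI)
      fix a :: 'a and e :: real assume a: "a \<in> integer_units" and "0 < e"
      show "\<exists>d>0. \<forall>b\<in>integer_units. dist b a < d \<longrightarrow> dist (\<omega> b) (\<omega> a) < e"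
      proof (intro exI[of _ "absv ((prime_elt :: 'a) ^ m)"] conjI ballI impI)
        fix b :: 'a assume "b \<in> integer_units" "dist b a < absv ((prime_elt :: 'a) ^ m)"
        then have "c b = c a" "absv b = 1" "absv a = 1"
          using a loc[of a b] by (auto simp: integer_units_iff dist_absv ideal_power_iff)
        then show "dist (\<omega> b) (\<omega> a) < e"
          using \<open>0 < e\<close> by (simp add: \<omega>_def)
      qed simp
    qed
    then have ch: "\<omega> \<in> characters"
      using cm nz by (auto simp: characters_def integer_units_iff \<omega>_def absv_mult)
    moreover have "conductor \<omega> \<le> m"
      unfolding conductor_eq by (rule Least_le) (auto simp: c1 \<omega>_def unit_subgroup_def)
    moreover have "f \<in> isotypic_invariants \<omega> m"
      using fm c by (intro isotypicI) (auto simp: \<omega>_def)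
    ultimately show ?thesis
      by (intro cfun.span_base) blast
  qed
  then have "cfun.span (joint_eigenvectors m A) \<subseteq>
      cfun.span (\<Union>\<omega>\<in>{\<omega> \<in> characters. conductor \<omega> \<le> m}. isotypic_invariants \<omega> m :: ('a^'n \<Rightarrow> complex) set)"
    by (intro cfun.span_minimal) auto
  moreover have "invariants m \<subseteq> cfun.span (joint_eigenvectors m A :: ('a^'n \<Rightarrow> complex) set)"
    using F(1) by (intro joint_eigenvectors_span) (auto simp: A_def)
  ultimately show ?thesis
    by blast
qed

section \<open>Zonal functions\<close>

lemma not_ideal_power_iff:
  "(x :: 'a) \<notin> ideal_power (Suc m) \<longleftrightarrow> absv ((prime_elt :: 'a::nonarch_local_field) ^ m) \<le> absv x"
  by (auto simp: ideal_power_Suc_iff)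

abbreviation last_index :: "'n::{finite,linorder}"
  where "last_index \<equiv> Max UNIV"

lemma last_basis_vector_nth: "last_basis_vector $ i = (if i = last_index then 1 else 0)"
  by (simp add: last_basis_vector_def axis_def)

lemma last_basis_vector_row: "last_basis_vector v* k = k $ last_index"
  for k :: "'a::nonarch_local_field^'n::{finite,linorder}^'n::{finite,linorder}"
  by (simp add: vector_matrix_mult_def last_basis_vector_nth vec_eq_iff if_distrib[of "\<lambda>z. z * _"] cong: if_cong)

text \<open>The distance from \<open>x\<close> to the line through the last basis vector.\<close>

definition off_axis :: "'a::nonarch_local_field^'n::{finite,linorder} \<Rightarrow> real"
  where "off_axis x = Max ((\<lambda>i. absv (x $ i)) ` (UNIV - {last_index}))"

text \<open>A row shift along a coordinate other than the last fixes e_n, whose entry there is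
  zero.\<close>

lemma stabiliser_invariant_eq_step:
  fixes u :: "'a::nonarch_local_field^'n::{finite,linorder} \<Rightarrow> complex"
  assumes u: "\<And>k x. k \<in> GLO \<Longrightarrow> last_basis_vector v* k = last_basis_vector \<Longrightarrow> u (x v* k) = u x"
    and i: "i \<noteq> last_index" "x $ i \<noteq> 0" "absv (y $ i) = absv (x $ i)"
    and le: "\<And>l. absv (y $ l - x $ l) \<le> absv (x $ i)"
  shows "u y = u x"
proof -
  define k where "k = row_shift i ((1 / x $ i) *s (y - x))"
  have k: "k \<in> GLO" "x v* k = y"
    unfolding k_def using GLO_row_shift[OF i(3,2) le] by auto
  moreover have "last_basis_vector v* k = last_basis_vector"
    using i(1) by (simp add: k_def row_mult_row_shift last_basis_vector_nth)
  ultimately show ?thesis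
    using u by blast
qed

text \<open>The two \<open>itself\<close> parameters fix the types that share the hypothesis n >= 2.
  It provides a coordinate other than the last, so that the maximum in \<open>off_axis\<close> is
  taken over a nonempty set.\<close>

locale higher_dim =
  fixes field_type :: "'a::nonarch_local_field itself" and index_type :: "'n::{finite,linorder} itself"
  assumes card_ge_2: "CARD('n) \<ge> 2"
begin

lemma other_index: "UNIV - {last_index} \<noteq> ({} :: 'n set)"
proof
  assume "UNIV - {last_index} = ({} :: 'n set)"
  then have "(UNIV :: 'n set) = {last_index}"
    by blast
  then have "CARD('n) = card {last_index :: 'n}"
    by (rule arg_cong)
  then show False
    using card_ge_2 by simp
qed

lemma off_axis_attained:
  obtains i where "i \<noteq> last_index" "absv ((x :: ('a, 'n) vec) $ i) = off_axis x"
proof -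
  have "off_axis x \<in> (\<lambda>i. absv (x $ i)) ` (UNIV - {last_index})"
    unfolding off_axis_def using other_index by (intro Max_in) auto
  then obtain i where "off_axis x = absv (x $ i)" "i \<in> UNIV - {last_index}"
    by (rule imageE)
  then show ?thesis
    using that[of i] by simp
qed

lemma off_axis_ge: "i \<noteq> last_index \<Longrightarrow> absv ((x :: ('a, 'n) vec) $ i) \<le> off_axis x"
  unfolding off_axis_def by (intro Max_ge) auto

lemma off_axis_le_iff: "off_axis (x :: ('a, 'n) vec) \<le> c \<longleftrightarrow> (\<forall>i. i \<noteq> last_index \<longrightarrow> absv (x $ i) \<le> c)"
  unfolding off_axis_def using other_index by (subst Max_le_iff) auto

lemma off_axis_scale: "absv a = 1 \<Longrightarrow> off_axis (a *s (x :: ('a, 'n) vec)) = off_axis x"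
  by (simp add: off_axis_def absv_mult)

lemma off_axis_le_ideal_power_cong:
  assumes "vec_cong m x (y :: ('a, 'n) vec)" "off_axis x \<le> absv ((prime_elt :: 'a) ^ m)"
  shows "off_axis y \<le> absv ((prime_elt :: 'a) ^ m)"
  unfolding off_axis_le_iff
proof (intro allI impI)
  fix i :: 'n assume "i \<noteq> last_index"
  then have "absv (x $ i) \<le> absv ((prime_elt :: 'a) ^ m)"
    using assms(2) off_axis_ge order_trans by blast
  moreover have "absv (y $ i - x $ i) \<le> absv ((prime_elt :: 'a) ^ m)"
    using vec_cong_sym[OF assms(1)] by (simp add: vec_cong_def ideal_power_iff)
  ultimately show "absv (y $ i) \<le> absv ((prime_elt :: 'a) ^ m)"
    using absv_add_le[of "x $ i" _ "y $ i - x $ i"] by simp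
qed

lemma off_axis_le_cong:
  fixes x y :: "('a, 'n) vec"
  assumes "vec_cong m x y" "absv ((prime_elt :: 'a) ^ m) < off_axis x"
  shows "off_axis x \<le> off_axis y"
proof -
  obtain i :: 'n where i: "i \<noteq> last_index" "absv (x $ i) = off_axis x"
    by (rule off_axis_attained)
  have "absv (y $ i - x $ i) < absv (x $ i)"
    using vec_cong_sym[OF assms(1)] assms(2) i(2) unfolding vec_cong_def ideal_power_iff
    by (metis order_le_less_trans)
  then have "absv (y $ i) = absv (x $ i)"
    by (rule absv_eqI)
  then show ?thesis
    using off_axis_ge[OF i(1), of y] i(2) by simp
qed

text \<open>The one-sided bound already places \<open>y\<close> beyond the radius, so it applies
  with \<open>x\<close> and \<open>y\<close> exchanged too.\<close>

lemma off_axis_eq_cong: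
  fixes x y :: "('a, 'n) vec"
  assumes "vec_cong m x y" "absv ((prime_elt :: 'a) ^ m) < off_axis x"
  shows "off_axis x = off_axis y"
proof (rule antisym)
  show "off_axis x \<le> off_axis y"
    by (rule off_axis_le_cong[OF assms])
  then have "absv ((prime_elt :: 'a) ^ m) < off_axis y"
    using assms(2) by simp
  then show "off_axis y \<le> off_axis x"
    by (rule off_axis_le_cong[OF vec_cong_sym[OF assms(1)]])
qed

lemma last_coordinate_unit:
  fixes x :: "('a, 'n) vec"
  assumes "x \<in> unit_sphere" "off_axis x < 1"
  shows "absv (x $ last_index) = 1"
proof -
  obtain i where i: "absv (x $ i) = 1"
    using assms(1) by (auto simp: unit_sphere_iff)
  then have "i = last_index"
    using off_axis_ge[of i x] assms(2) by force
  then show ?thesis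
    using i by simp
qed

lemma prime_elt_power_less_1: "m \<noteq> 0 \<Longrightarrow> absv ((prime_elt :: 'a) ^ m) < 1"
  using ideal_power_less_1[of "prime_elt ^ m" m] by (simp add: ideal_power_iff)

lemma off_axis_discrete:
  "absv ((prime_elt :: 'a) ^ Suc m) < off_axis (x :: ('a, 'n) vec) \<Longrightarrow> absv ((prime_elt :: 'a) ^ m) \<le> off_axis x"
  by (rule off_axis_attained[of x]) (metis ideal_power_iff not_ideal_power_iff not_less)

text \<open>Shifts along a coordinate of size \<open>off_axis x\<close> fix e_n and can change every
  other coordinate by up to that size. So the last coordinate counts only modulo that radius, and
  the remaining ones only through their maximum.\<close>

lemma stabiliser_invariant_eq:
  fixes u :: "('a, 'n) vec \<Rightarrow> complex"
  assumes u: "\<And>k x. k \<in> GLO \<Longrightarrow> last_basis_vector v* k = last_basis_vector \<Longrightarrow> u (x v* k) = u x"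
    and xy: "off_axis x = off_axis y" "0 < off_axis x" "absv (x $ last_index - y $ last_index) \<le> off_axis x"
  shows "u x = u y"
proof -
  obtain i where i: "i \<noteq> last_index" "absv (x $ i) = off_axis x"
    by (rule off_axis_attained)
  obtain j where j: "j \<noteq> last_index" "absv (y $ j) = off_axis y"
    by (rule off_axis_attained)
  text \<open>The intermediate vector shares a coordinate of size \<open>off_axis x\<close> with each of \<open>x\<close> and \<open>y\<close>.\<close>
  define z where "z = (\<chi> l. if l = j then y $ j else x $ l)"
  have zi: "absv (z $ i) = absv (x $ i)"
    using i j xy by (simp add: z_def)
  have le: "absv (y $ l - x $ l) \<le> off_axis x" for l
  proof (cases "l = last_index")
    case True
    then show ?thesis
      using xy(3) absv_minus_commute by metis
  next
    case False
    then show ?thesis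
      using off_axis_ge[of l x] off_axis_ge[of l y] xy(1) by (intro absv_diff_le) auto
  qed
  have nz: "x $ i \<noteq> 0" "z $ j \<noteq> 0"
    using i j xy by (auto simp: z_def)
  have "u z = u x"
    using i(2) le xy(2) by (intro stabiliser_invariant_eq_step[OF u i(1) nz(1) zi]) (auto simp: z_def)
  moreover have "u y = u z"
  proof (rule stabiliser_invariant_eq_step[OF u j(1) nz(2)])
    show "absv (y $ j) = absv (z $ j)" "absv (y $ l - z $ l) \<le> absv (z $ j)" for l
      using le[of l] j(2) xy(1,2) by (auto simp: z_def)
  qed
  ultimately show ?thesis
    by simp
qed

end

section \<open>The group \<open>B\<close>, zonal functions and their values\<close>

definition line_stabiliser :: "nat \<Rightarrow> ('a::nonarch_local_field^'n::{finite,linorder}^'n::{finite,linorder}) set"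
  where "line_stabiliser m = {k \<in> GLO. \<forall>l. l \<noteq> last_index \<longrightarrow> k $ last_index $ l \<in> ideal_power m}"

definition zonal :: "('a::nonarch_local_field \<Rightarrow> complex) \<Rightarrow> nat \<Rightarrow> ('a^'n::{finite,linorder} \<Rightarrow> complex) \<Rightarrow> bool"
  where "zonal \<omega> m u \<longleftrightarrow> (\<forall>k\<in>line_stabiliser m. \<forall>x. u (x v* k) = \<omega> (k $ last_index $ last_index) * u x)"

text \<open>For m > 0 the last coordinate is a unit on the supporting ball. For m = 0 the ball is
  the whole sphere, where that coordinate may be a nonunit; the constant 1 replaces the character,
  which is trivial on units if its conductor is 0.\<close>

definition axis_function :: "('a::nonarch_local_field \<Rightarrow> complex) \<Rightarrow> nat \<Rightarrow> 'a^'n::{finite,linorder} \<Rightarrow> complex"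
  where "axis_function \<omega> m x =
    (if x \<in> unit_sphere \<and> off_axis x \<le> absv ((prime_elt :: 'a) ^ m)
     then if m = 0 then 1 else \<omega> (x $ last_index) else 0)"

text \<open>A test vector that is congruent to e_n modulo p^m but no longer modulo the next
  power.\<close>

definition tilted_vector :: "nat \<Rightarrow> 'n \<Rightarrow> 'a::nonarch_local_field^'n::{finite,linorder}"
  where "tilted_vector m i = last_basis_vector + axis i (prime_elt ^ m)"

lemma line_stabiliser_GLO: "k \<in> line_stabiliser m \<Longrightarrow> k \<in> GLO"
  by (simp add: line_stabiliser_def)

text \<open>The last row is the image of e_n and so lies on the sphere, and for m > 0 its other
  entries are nonunits. For m = 0 the group is all of \<open>GLO\<close>, and the entry may be a
  nonunit.\<close>

lemma line_stabiliser_unit: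
  assumes k: "k \<in> line_stabiliser m" and m: "m \<noteq> 0"
  shows "absv (k $ last_index $ last_index) = 1"
proof -
  have "k $ last_index \<in> unit_sphere"
    using k by (simp add: line_stabiliser_GLO unit_sphere_GLO last_basis_vector_sphere flip: last_basis_vector_row)
  then obtain i where i: "absv (k $ last_index $ i) = 1"
    by (auto simp: unit_sphere_iff)
  have "i = last_index"
    using k i ideal_power_less_1[OF _ m, of "k $ last_index $ i"] by (force simp: line_stabiliser_def)
  then show ?thesis
    using i by simp
qed

lemma line_stabiliser_row:
  assumes "k \<in> line_stabiliser m"
  shows "vec_cong m (k $ last_index) (k $ last_index $ last_index *s last_basis_vector)"
  using assms by (auto simp: vec_cong_def last_basis_vector_nth line_stabiliser_def)

lemma line_stabiliser_mult_row:
  assumes "b \<in> line_stabiliser m" "r \<in> GLO"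
  shows "(b ** r) $ last_index $ l - b $ last_index $ last_index * r $ last_index $ l \<in> ideal_power m"
  using vec_cong_row_mult[OF GLO_integer_matrices[OF assms(2)] line_stabiliser_row[OF assms(1)]]
  by (simp add: matrix_mult_row vec_cong_def scale_row_mult last_basis_vector_row)

lemma zonal_stabiliser_invariant:
  assumes \<omega>: "\<omega> \<in> characters" and u: "zonal \<omega> m u"
    and k: "k \<in> GLO" "last_basis_vector v* k = last_basis_vector"
  shows "u (x v* k) = u x"
proof -
  have "k $ last_index = last_basis_vector"
    using k(2) by (simp add: last_basis_vector_row)
  then have "k \<in> line_stabiliser m" "k $ last_index $ last_index = 1"
    using k(1) by (auto simp: line_stabiliser_def last_basis_vector_nth)
  then show ?thesis
    using u character_one[OF \<omega>] by (simp add: zonal_def)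
qed

context higher_dim
begin

lemma tilted_vector:
  assumes "i \<noteq> last_index"
  shows "tilted_vector m i \<in> (unit_sphere :: ('a, 'n) vec set)"
    "off_axis (tilted_vector m i :: ('a, 'n) vec) = absv ((prime_elt :: 'a) ^ m)"
    "(tilted_vector m i :: ('a, 'n) vec) $ last_index = 1"
    "vec_cong m (tilted_vector m i :: ('a, 'n) vec) last_basis_vector"
proof -
  let ?t = "tilted_vector m i :: ('a, 'n) vec"
  have t: "?t $ l = (if l = last_index then 1 else if l = i then prime_elt ^ m else 0)" for l
    using assms by (auto simp: tilted_vector_def last_basis_vector_nth axis_def)
  have "absv ((prime_elt :: 'a) ^ m) \<le> 1"
    using ideal_power_integer[of "prime_elt ^ m :: 'a" m] by (simp add: ideal_power_iff)
  then show "?t \<in> unit_sphere"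
    by (auto simp: unit_sphere_iff t intro!: exI[of _ last_index])
  show "?t $ last_index = 1"
    by (simp add: t)
  show "vec_cong m ?t last_basis_vector"
    by (simp add: vec_cong_def t last_basis_vector_nth ideal_power_iff)
  show "off_axis ?t = absv ((prime_elt :: 'a) ^ m)"
  proof (rule antisym)
    show "off_axis ?t \<le> absv ((prime_elt :: 'a) ^ m)"
      by (auto simp: off_axis_le_iff t)
    show "absv ((prime_elt :: 'a) ^ m) \<le> off_axis ?t"
      using off_axis_ge[OF assms, of ?t] assms by (simp add: t)
  qed
qed

lemma off_axis_last_basis_vector: "off_axis (last_basis_vector :: ('a, 'n) vec) = 0"
proof -
  have "off_axis (last_basis_vector :: ('a, 'n) vec) \<le> 0"
    by (simp add: off_axis_le_iff last_basis_vector_nth)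
  moreover obtain i where "absv ((last_basis_vector :: ('a, 'n) vec) $ i) = off_axis (last_basis_vector :: ('a, 'n) vec)"
    by (rule off_axis_attained[of last_basis_vector])
  ultimately show ?thesis
    using absv_nonneg by (metis order_antisym)
qed

lemma axis_function_isotypic:
  assumes \<omega>: "\<omega> \<in> characters" and m: "conductor \<omega> \<le> m"
  shows "axis_function \<omega> m \<in> (isotypic_invariants \<omega> m :: (('a, 'n) vec \<Rightarrow> complex) set)"
proof (rule isotypicI)
  show "axis_function \<omega> m \<in> (invariants m :: (('a, 'n) vec \<Rightarrow> complex) set)"
  proof (rule invariantsI)
    fix x y :: "('a, 'n) vec" assume xy: "x \<in> unit_sphere" "y \<in> unit_sphere" "vec_cong m x y"
    have iff: "off_axis x \<le> absv ((prime_elt :: 'a) ^ m) \<longleftrightarrow> off_axis y \<le> absv ((prime_elt :: 'a) ^ m)"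
      using off_axis_le_ideal_power_cong xy(3) vec_cong_sym by blast
    have "\<omega> (x $ last_index) = \<omega> (y $ last_index)"
      if "off_axis x \<le> absv ((prime_elt :: 'a) ^ m)" "m \<noteq> 0"
    proof (rule character_cong[OF \<omega> m])
      have "off_axis x < 1" "off_axis y < 1"
        using that iff prime_elt_power_less_1[OF that(2)] by auto
      then show "absv (x $ last_index) = 1" "absv (y $ last_index) = 1"
        using xy last_coordinate_unit by auto
      show "x $ last_index - y $ last_index \<in> ideal_power m"
        using xy(3) by (simp add: vec_cong_def)
    qed
    then show "axis_function \<omega> m x = axis_function \<omega> m y"
      using xy iff by (simp add: axis_function_def)
  qed (simp add: axis_function_def)
next
  fix a :: 'a and x :: "('a, 'n) vec" assume a: "absv a = 1" and x: "x \<in> unit_sphere"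
  show "axis_function \<omega> m (a *s x) = \<omega> a * axis_function \<omega> m x"
  proof (cases "m = 0")
    case True
    then have "\<omega> a = 1"
      using a m by (intro character_eq_1[OF \<omega> order_refl])
        (auto simp: unit_subgroup_def ideal_power_0 integers_iff intro: absv_diff_le)
    then show ?thesis
      using True a by (simp add: axis_function_def off_axis_scale unit_sphere_scale)
  next
    case False
    have "absv (x $ last_index) = 1" if "off_axis x \<le> absv ((prime_elt :: 'a) ^ m)"
      using that prime_elt_power_less_1[OF False] by (intro last_coordinate_unit x) auto
    then show ?thesis
      using False a by (simp add: axis_function_def off_axis_scale unit_sphere_scale character_mult[OF \<omega> a])
  qed
qed

lemma axis_function_last_basis_vector:
  assumes "\<omega> \<in> characters"
  shows "axis_function \<omega> m (last_basis_vector :: ('a, 'n) vec) = 1"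
  using assms by (simp add: axis_function_def off_axis_last_basis_vector last_basis_vector_sphere
      last_basis_vector_nth character_one)

text \<open>Scaling the last coordinate by a unit \<open>a\<close> close to \<open>1\<close> with \<open>\<omega> a \<noteq> 1\<close> multiplies a zonal function by
  \<open>\<omega> a\<close>, but moves \<open>x\<close> within an orbit of the stabiliser of \<open>e\<^sub>n\<close>.\<close>

lemma zonal_eq_0_off_axis:
  fixes u :: "('a, 'n) vec \<Rightarrow> complex"
  assumes \<omega>: "\<omega> \<in> characters" and u: "zonal \<omega> m u" and x: "x \<in> unit_sphere"
    and far: "absv ((prime_elt :: 'a) ^ conductor \<omega>) < off_axis x"
  shows "u x = 0"
proof (cases "conductor \<omega>")
  case 0
  have "off_axis x \<le> 1"
    using x by (simp add: off_axis_le_iff unit_sphere_iff)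
  then show ?thesis
    using far 0 by simp
next
  case (Suc c)
  \<comment> \<open>One level below the conductor the character is still nontrivial, and
    discreteness of distances improves \<open>far\<close> just enough for the distance to bound
    \<open>a - 1\<close>.\<close>
  then obtain a where a: "a \<in> unit_subgroup c" "\<omega> a \<noteq> 1"
    using ex_character_neq_1[of c \<omega>] by auto
  have a1: "absv a = 1" "absv (a - 1) \<le> off_axis x"
    using a(1) off_axis_discrete[of c x] far Suc by (auto simp: unit_subgroup_def ideal_power_iff)
  define e where "e = (last_basis_vector :: ('a, 'n) vec)"
  \<comment> \<open>This is the diagonal matrix with last entry \<open>a\<close> and all other
    diagonal entries 1.\<close>
  define k where "k = row_shift last_index ((1 / e $ last_index) *s (a *s e - e))"
  have "absv (a * e $ l - e $ l) \<le> 1" for l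
    using a1(1) by (auto simp: e_def last_basis_vector_nth intro: absv_diff_le)
  then have k: "k \<in> GLO" "e v* k = a *s e"
    using GLO_row_shift[of "a *s e" last_index e] a1(1) unfolding k_def by (auto simp: e_def last_basis_vector_nth)
  then have row: "k $ last_index = a *s e"
    by (simp add: e_def last_basis_vector_row)
  then have kB: "k \<in> line_stabiliser m"
    using k(1) by (auto simp: line_stabiliser_def e_def last_basis_vector_nth)
  have xk: "(x v* k) $ l = (if l = last_index then a * x $ last_index else x $ l)" for l
    by (simp add: k_def row_mult_row_shift e_def last_basis_vector_nth algebra_simps)
  have "off_axis (x v* k) = off_axis x"
    unfolding off_axis_def by (rule arg_cong[of _ _ Max], rule image_cong) (auto simp: xk)
  moreover have "absv ((a - 1) * x $ last_index) \<le> off_axis x * 1"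
    unfolding absv_mult using a1(2) x order_trans[OF absv_nonneg a1(2)]
    by (intro mult_mono) (auto simp: unit_sphere_iff)
  then have "absv ((x v* k) $ last_index - x $ last_index) \<le> off_axis x"
    by (simp add: xk algebra_simps)
  moreover have "0 < off_axis x"
    using far absv_nonneg order_le_less_trans by blast
  ultimately have "u (x v* k) = u x"
    using stabiliser_invariant_eq[OF zonal_stabiliser_invariant[OF \<omega> u], of "x v* k" x] by simp
  moreover have "u (x v* k) = \<omega> a * u x"
    using u kB row by (simp add: zonal_def e_def last_basis_vector_nth)
  ultimately have "(\<omega> a - 1) * u x = 0"
    by (simp add: algebra_simps)
  then show ?thesis
    using a(2) by simp
qed

text \<open>Modulo p^m such an \<open>x\<close> is its last coordinate times e_n.\<close>

lemma isotypic_near_axis: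
  fixes u :: "('a, 'n) vec \<Rightarrow> complex"
  assumes u: "u \<in> isotypic_invariants \<omega> m" and m: "m \<noteq> 0"
    and x: "x \<in> unit_sphere" "off_axis x \<le> absv ((prime_elt :: 'a) ^ m)"
  shows "u x = \<omega> (x $ last_index) * u last_basis_vector"
proof -
  have xn: "absv (x $ last_index) = 1"
    using x prime_elt_power_less_1[OF m] by (intro last_coordinate_unit) auto
  have "vec_cong m x (x $ last_index *s last_basis_vector)"
    using x(2) off_axis_ge[of _ x]
    by (auto simp: vec_cong_def last_basis_vector_nth ideal_power_iff intro: order_trans)
  then have "u x = u (x $ last_index *s last_basis_vector)"
    using u xn x isotypic_invariants_subset
    by (intro invariants_cong[of u m]) (auto simp: unit_sphere_scale last_basis_vector_sphere)
  then show ?thesis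
    using isotypic_scale[OF u xn] by simp
qed

text \<open>Apart from the factor given by the character of the last coordinate, \<open>u\<close> is
  constant on the annulus at distance \<open>absv (prime_elt ^ m)\<close> and zero inside it.
  Filling the inner ball with the annulus value removes the dependence on the finer level; farther
  out \<open>u\<close> already has level \<open>m\<close> by its stabiliser invariance.\<close>

lemma zonal_lower_level:
  fixes u :: "('a, 'n) vec \<Rightarrow> complex"
  assumes \<omega>: "\<omega> \<in> characters" and m: "conductor \<omega> \<le> m"
    and u: "u \<in> isotypic_invariants \<omega> (Suc m)" "zonal \<omega> (Suc m) u" "u last_basis_vector = 0"
  shows "\<exists>C. u + cscale C (axis_function \<omega> (Suc m)) \<in> isotypic_invariants \<omega> m"
proof -
  let ?r = "\<lambda>m. absv ((prime_elt :: 'a) ^ m)"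
  obtain i :: 'n where i: "i \<noteq> last_index"
    using other_index by blast
  define x0 where "x0 = (tilted_vector m i :: ('a, 'n) vec)"
  note x0 = tilted_vector[OF i, of m, folded x0_def]
  \<comment> \<open>The value of \<open>u\<close> on the annulus, read off at a vector with last
    coordinate 1.\<close>
  define C where "C = u x0"
  define v where "v = u + cscale C (axis_function \<omega> (Suc m))"
  note stab = stabiliser_invariant_eq[OF zonal_stabiliser_invariant[OF \<omega> u(2)]]
  have near: "v x = C * \<omega> (x $ last_index)" if x: "x \<in> unit_sphere" "off_axis x \<le> ?r (Suc m)" for x
    using isotypic_near_axis[OF u(1) _ x] u(3) x by (simp add: v_def cscale_def axis_function_def)
  have far: "v x = u x" if "?r (Suc m) < off_axis x" for x
    using that by (simp add: v_def cscale_def axis_function_def)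
  have vm: "v x = C * (if m = 0 then 1 else \<omega> (x $ last_index))" if x: "x \<in> unit_sphere" "off_axis x \<le> ?r m" for x
  proof (cases "off_axis x \<le> ?r (Suc m)")
    case True
    have "absv (x $ last_index) = 1"
      using True prime_elt_power_less_1[of "Suc m"] by (intro last_coordinate_unit x(1)) auto
    then have "\<omega> (x $ last_index) = 1" if "m = 0"
      using m that by (intro character_eq_1[OF \<omega> order_refl])
        (auto simp: unit_subgroup_def ideal_power_0 integers_iff intro: absv_diff_le)
    then show ?thesis
      using near[OF x(1) True] by simp
  next
    case False
    then have eq: "off_axis x = ?r m"
      using off_axis_discrete[of m x] x(2) by simp
    have pos: "0 < ?r m"
      by simp
    show ?thesis
    proof (cases "m = 0")
      case True
      \<comment> \<open>At level 0 the annulus has distance 1, which bounds the difference of any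
        two integral last coordinates.\<close>
      have "absv (x $ last_index - x0 $ last_index) \<le> 1"
        using x(1) x0(3) by (intro absv_diff_le) (auto simp: unit_sphere_iff)
      then have "u x = u x0"
        using eq pos True x0(2) by (intro stab) auto
      then show ?thesis
        using far[of x] False True by (simp add: C_def)
    next
      case m0: False
      have xn: "absv (x $ last_index) = 1"
        using x(2) prime_elt_power_less_1[OF m0] by (intro last_coordinate_unit x(1)) auto
      then have nz: "x $ last_index \<noteq> 0"
        by auto
      \<comment> \<open>Normalising the last coordinate to 1 brings the point into the orbit of
        \<open>x0\<close>; isotypy restores the factor.\<close>
      define y where "y = (1 / x $ last_index) *s x"
      have "off_axis y = off_axis x"
        unfolding y_def using xn by (intro off_axis_scale) (simp add: absv_divide)
      moreover have "y $ last_index = 1"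
        using nz by (simp add: y_def)
      ultimately have "u y = u x0"
        using eq pos x0(2,3) by (intro stab) auto
      moreover have "x = x $ last_index *s y"
        using nz by (simp add: y_def vec_eq_iff)
      then have "u x = \<omega> (x $ last_index) * u y"
        using isotypic_scale[OF u(1) xn] by metis
      ultimately show ?thesis
        using far[of x] False m0 by (simp add: C_def)
    qed
  qed
  have iso: "v \<in> isotypic_invariants \<omega> (Suc m)"
    unfolding v_def using u(1) axis_function_isotypic[OF \<omega>, of "Suc m"] m
    by (intro cfun.subspace_add[OF subspace_isotypic] cfun.subspace_scale[OF subspace_isotypic]) auto
  have "v \<in> invariants m"
  proof (rule invariantsI)
    fix x :: "('a, 'n) vec" assume "x \<notin> unit_sphere"
    then show "v x = 0"
      using iso isotypic_invariants_subset invariants_zero by blast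
  next
    fix x y :: "('a, 'n) vec" assume xy: "x \<in> unit_sphere" "y \<in> unit_sphere" "vec_cong m x y"
    show "v x = v y"
    proof (cases "off_axis x \<le> ?r m")
      case True
      then have True': "off_axis y \<le> ?r m"
        using off_axis_le_ideal_power_cong xy(3) by blast
      have "\<omega> (x $ last_index) = \<omega> (y $ last_index)" if m0: "m \<noteq> 0"
      proof (rule character_cong[OF \<omega> m])
        show "absv (x $ last_index) = 1" "absv (y $ last_index) = 1"
          using True True' prime_elt_power_less_1[OF m0] xy(1,2) by (auto intro!: last_coordinate_unit)
        show "x $ last_index - y $ last_index \<in> ideal_power m"
          using xy(3) by (simp add: vec_cong_def)
      qed
      then show ?thesis
        using vm[OF xy(1) True] vm[OF xy(2) True'] by auto
    next
      case False
      then have gt: "?r m < off_axis x"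
        by simp
      then have eq: "off_axis x = off_axis y"
        using off_axis_eq_cong[OF xy(3)] by blast
      \<comment> \<open>A difference of last coordinates below the distance to the line is invisible
        to \<open>u\<close>.\<close>
      have "absv (x $ last_index - y $ last_index) \<le> ?r m"
        using xy(3) by (simp add: vec_cong_def ideal_power_iff)
      moreover have "0 < off_axis x"
        using gt absv_nonneg order_le_less_trans by blast
      ultimately have "u x = u y"
        using gt eq by (intro stab) auto
      moreover have "?r (Suc m) \<le> ?r m"
        using ideal_power_antimono[of m "Suc m", where 'a='a] by (auto simp: ideal_power_iff)
      ultimately show ?thesis
        using far[of x] far[of y] gt eq by auto
    qed
  qed
  then have "v \<in> isotypic_invariants \<omega> m"
    using isotypic_scale[OF iso] by (intro isotypicI) auto
  then show ?thesis
    unfolding v_def by blast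
qed

end

section \<open>Irreducibility and the orthogonal decompositions\<close>

locale haar_sphere = higher_dim field_type index_type
  for field_type :: "'a::nonarch_local_field itself" and index_type :: "'n::{finite,linorder} itself" +
  fixes \<mu> :: "(('a, 'n) vec, 'n) vec measure"
  assumes haar: "haar_probability \<mu>"
begin

section \<open>The harmonic spaces as nonzero submodules, and uniqueness of zonal harmonics\<close>

lemma harmonics_subset: "conductor \<omega> \<le> m \<Longrightarrow> harmonics \<mu> \<omega> m \<subseteq> isotypic_invariants \<omega> m"
  by (auto simp: harmonics_def)

lemma harmonics_smooth: "conductor \<omega> \<le> m \<Longrightarrow> f \<in> harmonics \<mu> \<omega> m \<Longrightarrow> f \<in> smooth_functions"
  using harmonics_subset isotypic_invariants_subset invariants_smooth by blast

lemma isotypic_smooth: "f \<in> isotypic_invariants \<omega> m \<Longrightarrow> f \<in> smooth_functions"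
  using isotypic_invariants_subset invariants_smooth by blast

lemma harmonics_orthogonal_lower:
  assumes m: "conductor \<omega> \<le> l" "l < m" and f: "f \<in> harmonics \<mu> \<omega> m" and g: "g \<in> isotypic_invariants \<omega> l"
  shows "inner_prod \<mu> f g = 0"
proof -
  have "g \<in> isotypic_invariants \<omega> (m - 1)"
    by (rule subsetD[OF isotypic_mono g]) (use m in simp)
  then show ?thesis
    using f m by (simp add: harmonics_def)
qed

lemma harmonics_orthogonal_levels:
  assumes "conductor \<omega> \<le> l" "conductor \<omega> \<le> m" "l \<noteq> m" "f \<in> harmonics \<mu> \<omega> l" "g \<in> harmonics \<mu> \<omega> m"
  shows "inner_prod \<mu> f g = 0"
proof (cases "l < m")
  case True
  then have "inner_prod \<mu> g f = 0"
    using assms harmonics_subset[OF assms(1)] by (intro harmonics_orthogonal_lower[of \<omega> l m]) auto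
  then show ?thesis
    using inner_prod_commute[of \<mu> f g] by simp
next
  case False
  then show ?thesis
    using assms harmonics_subset[OF assms(2)] by (intro harmonics_orthogonal_lower[of \<omega> m l]) auto
qed

lemma subspace_harmonics:
  assumes "conductor \<omega> \<le> m"
  shows "cfun.subspace (harmonics \<mu> \<omega> m)"
proof (cases "m = conductor \<omega>")
  case True
  then show ?thesis
    by (simp add: harmonics_def subspace_isotypic)
next
  case False
  show ?thesis
  proof (rule cfun.subspaceI)
    show "0 \<in> harmonics \<mu> \<omega> m"
      using False cfun.subspace_0[OF subspace_isotypic] by (simp add: harmonics_def inner_prod_zero_left)
  next
    fix f g assume fg: "f \<in> harmonics \<mu> \<omega> m" "g \<in> harmonics \<mu> \<omega> m"
    have "inner_prod \<mu> (f + g) h = inner_prod \<mu> f h + inner_prod \<mu> g h"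
      if "h \<in> isotypic_invariants \<omega> (m - 1)" for h
      using harmonics_smooth[OF assms] fg isotypic_smooth[OF that] by (intro inner_prod_add_left[OF haar])
    then show "f + g \<in> harmonics \<mu> \<omega> m"
      using False fg cfun.subspace_add[OF subspace_isotypic, of f \<omega> m g]
      by (simp add: harmonics_def)
  next
    fix c f assume "f \<in> harmonics \<mu> \<omega> m"
    then show "cscale c f \<in> harmonics \<mu> \<omega> m"
      using False cfun.subspace_scale[OF subspace_isotypic, of f \<omega> m c]
      by (simp add: harmonics_def inner_prod_scale_left)
  qed
qed

lemma right_translation_adjoint:
  assumes k: "k \<in> GLO" "l \<in> GLO" "k ** l = mat 1" and fg: "f \<in> smooth_functions" "g \<in> smooth_functions"
  shows "inner_prod \<mu> (right_translation k f) g = inner_prod \<mu> f (right_translation l g)"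
proof -
  have "right_translation k (right_translation l g) = g"
    unfolding right_translation_mult k(3) by (simp add: right_translation_def)
  then show ?thesis
    using inner_prod_right_translation[OF haar fg(1) right_translation_smooth[OF k(2) fg(2)] k(1)] by simp
qed

text \<open>Translations are unitary and preserve the lower isotypic space, hence also its
  orthogonal complement.\<close>

lemma right_translation_harmonics:
  assumes m: "conductor \<omega> \<le> m" and k: "k \<in> GLO" and f: "f \<in> harmonics \<mu> \<omega> m"
  shows "right_translation k f \<in> harmonics \<mu> \<omega> m"
proof -
  obtain l where l: "l \<in> GLO" "k ** l = mat 1" "l ** k = mat 1"
    using GLO_inverse[OF k] .
  have "right_translation k f \<in> isotypic_invariants \<omega> m"
    using right_translation_isotypic[OF k] f harmonics_subset[OF m] by blast
  moreover have "inner_prod \<mu> (right_translation k f) g = 0"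
    if "m \<noteq> conductor \<omega>" "g \<in> isotypic_invariants \<omega> (m - 1)" for g
  proof -
    have "inner_prod \<mu> f (right_translation l g) = 0"
      using that m by (intro harmonics_orthogonal_lower[OF _ _ f, of "m - 1"] right_translation_isotypic l(1)) auto
    then show ?thesis
      using right_translation_adjoint[OF k l(1,2)] harmonics_smooth[OF m f] isotypic_smooth[OF that(2)] by simp
  qed
  ultimately show ?thesis
    by (auto simp: harmonics_def)
qed

lemma K_submodule_harmonics: "conductor \<omega> \<le> m \<Longrightarrow> K_submodule (harmonics \<mu> \<omega> m)"
  unfolding K_submodule_def using subspace_harmonics right_translation_harmonics harmonics_smooth by blast

lemma isotypic_decompose:
  assumes m: "conductor \<omega> \<le> m" and f: "f \<in> isotypic_invariants \<omega> (Suc m)"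
  obtains p where "p \<in> isotypic_invariants \<omega> m" "f - p \<in> harmonics \<mu> \<omega> (Suc m)"
proof -
  obtain p where p: "p \<in> isotypic_invariants \<omega> m"
    "\<And>w. w \<in> isotypic_invariants \<omega> m \<Longrightarrow> inner_prod \<mu> (f - p) w = 0"
    using ex_projection[OF haar subspace_isotypic isotypic_invariants_subset isotypic_smooth[OF f]] by blast
  have "p \<in> isotypic_invariants \<omega> (Suc m)"
    using p(1) isotypic_mono[of m "Suc m"] by auto
  then have "f - p \<in> isotypic_invariants \<omega> (Suc m)"
    using f by (intro cfun.subspace_diff[OF subspace_isotypic])
  then have "f - p \<in> harmonics \<mu> \<omega> (Suc m)"
    using p(2) m by (simp add: harmonics_def)
  then show ?thesis
    using p(1) that by blast
qed

text \<open>At the conductor the axis function itself is a nonzero element. Above it, a zero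
  complement would put that function one level lower, yet it separates e_n from a tilted vector
  congruent to it at that level.\<close>

lemma harmonics_nonzero:
  assumes \<omega>: "\<omega> \<in> characters" and m: "conductor \<omega> \<le> m"
  shows "harmonics \<mu> \<omega> m \<noteq> {0}"
proof
  assume 0: "harmonics \<mu> \<omega> m = {0}"
  define f where "f = (axis_function \<omega> m :: ('a, 'n) vec \<Rightarrow> complex)"
  have f: "f \<in> isotypic_invariants \<omega> m" "f last_basis_vector = 1"
    unfolding f_def by (rule axis_function_isotypic[OF \<omega> m], rule axis_function_last_basis_vector[OF \<omega>])
  show False
  proof (cases "m = conductor \<omega>")
    case True
    then have "f \<in> {0}"
      using f(1) 0 by (simp add: harmonics_def)
    then show False
      using f(2) by simp
  next
    case False
    then obtain l where l: "m = Suc l" "conductor \<omega> \<le> l"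
      using m by (cases m) auto
    obtain p where p: "p \<in> isotypic_invariants \<omega> l" "f - p \<in> harmonics \<mu> \<omega> m"
      using isotypic_decompose[OF l(2)] f(1) l(1) by metis
    then have "f - p = 0"
      using 0 by blast
    then have fl: "f \<in> invariants l"
      using p(1) isotypic_invariants_subset by auto
    obtain i :: 'n where i: "i \<noteq> last_index"
      using other_index by blast
    note t = tilted_vector[OF i, of l]
    have "\<not> absv ((prime_elt :: 'a) ^ l) \<le> absv ((prime_elt :: 'a) ^ m)"
      using not_ideal_power_iff[of "prime_elt ^ m :: 'a" l] by (simp add: l(1) ideal_power_iff)
    then have "f (tilted_vector l i) = 0"
      unfolding f_def axis_function_def t(2) by simp
    moreover have "f (tilted_vector l i) = f last_basis_vector"
      using invariants_cong[OF fl t(1) last_basis_vector_sphere t(4)] .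
    ultimately show False
      using f(2) by simp
  qed
qed

text \<open>At the conductor, the ball around the line and the region of
  \<open>zonal_eq_0_off_axis\<close> together cover the sphere. Above it,
  \<open>zonal_lower_level\<close> gives a lower-level function whose product with \<open>u\<close>
  is the squared norm of \<open>u\<close>.\<close>

lemma zonal_harmonic_eq_0:
  assumes \<omega>: "\<omega> \<in> characters" and m: "conductor \<omega> \<le> m" "m \<noteq> 0"
    and u: "u \<in> harmonics \<mu> \<omega> m" "zonal \<omega> m u" "u last_basis_vector = 0"
  shows "u = 0"
proof -
  have ui: "u \<in> isotypic_invariants \<omega> m"
    using u(1) harmonics_subset[OF m(1)] by blast
  have near: "u x = 0" if "x \<in> unit_sphere" "off_axis x \<le> absv ((prime_elt :: 'a) ^ m)" for x
    using isotypic_near_axis[OF ui m(2) that] u(3) by simp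
  show ?thesis
  proof (cases "m = conductor \<omega>")
    case True
    have "u x = 0" for x
    proof (cases "x \<in> unit_sphere")
      case x: True
      show ?thesis
        using near[OF x] zonal_eq_0_off_axis[OF \<omega> u(2) x] True by (cases "off_axis x \<le> absv ((prime_elt :: 'a) ^ m)") auto
    next
      case False
      then show ?thesis
        using ui isotypic_invariants_subset invariants_zero by blast
    qed
    then show ?thesis
      by auto
  next
    case False
    then obtain l where l: "m = Suc l" "conductor \<omega> \<le> l"
      using m by (cases m) auto
    obtain C where C: "u + cscale C (axis_function \<omega> m) \<in> isotypic_invariants \<omega> l"
      using zonal_lower_level[OF \<omega> l(2), of u] ui u(2,3) unfolding l(1) by blast
    have "inner_prod \<mu> u (u + cscale C (axis_function \<omega> m)) = 0"
      using harmonics_orthogonal_lower[OF l(2) _ u(1) C] l(1) by simp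
    \<comment> \<open>The axis function is supported where \<open>u\<close> vanishes, so its
      contribution drops out pointwise.\<close>
    moreover have "u x * cnj ((u + cscale C (axis_function \<omega> m)) x) = u x * cnj (u x)" for x
      using near[of x] by (simp add: axis_function_def cscale_def)
    then have "inner_prod \<mu> u (u + cscale C (axis_function \<omega> m)) = inner_prod \<mu> u u"
      by (simp only: inner_prod_def)
    ultimately show ?thesis
      using inner_prod_definite[OF haar isotypic_smooth[OF ui]] by simp
  qed
qed

section \<open>Averaging over the group \<open>B\<close>\<close>

definition zonal_weight :: "('a \<Rightarrow> complex) \<Rightarrow> nat \<Rightarrow> (('a, 'n) vec, 'n) vec \<Rightarrow> complex"
  where "zonal_weight \<omega> m k = (if k \<in> line_stabiliser m then cnj (\<omega> (k $ last_index $ last_index)) else 0)"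

text \<open>The average over \<open>B\<close> is written over representatives of all of
  \<open>K\<close>, with weight zero off \<open>B\<close>, so that \<open>sum_transversal\<close>
  applies. It is unnormalised, as only proportionality and nonvanishing matter.\<close>

definition zonal_average :: "('a \<Rightarrow> complex) \<Rightarrow> nat \<Rightarrow> (('a, 'n) vec, 'n) vec set \<Rightarrow>
    (('a, 'n) vec \<Rightarrow> complex) \<Rightarrow> ('a, 'n) vec \<Rightarrow> complex"
  where "zonal_average \<omega> m R f = (\<Sum>r\<in>R. cscale (zonal_weight \<omega> m r) (right_translation r f))"

context
  fixes \<omega> :: "'a \<Rightarrow> complex" and m :: nat and R :: "(('a, 'n) vec, 'n) vec set"
  assumes \<omega>: "\<omega> \<in> characters" and m: "conductor \<omega> \<le> m" "m \<noteq> 0" and R: "transversal m R"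
begin

lemma zonal_weight_cong:
  assumes kl: "k \<in> GLO" "l \<in> GLO" "mat_cong m k l"
  shows "zonal_weight \<omega> m k = zonal_weight \<omega> m l"
proof -
  have d: "k $ last_index $ i - l $ last_index $ i \<in> ideal_power m" for i
    using kl(3) by (simp add: mat_cong_def vec_cong_def)
  have iff: "k $ last_index $ i \<in> ideal_power m \<longleftrightarrow> l $ last_index $ i \<in> ideal_power m" for i
    using ideal_power_add[OF d[of i], of "l $ last_index $ i"] ideal_power_diff[OF _ d[of i], of "k $ last_index $ i"]
    by auto
  then have kl': "k \<in> line_stabiliser m \<longleftrightarrow> l \<in> line_stabiliser m"
    using kl(1,2) by (simp add: line_stabiliser_def)
  have "\<omega> (k $ last_index $ last_index) = \<omega> (l $ last_index $ last_index)" if "k \<in> line_stabiliser m"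
    using that kl' m(2) by (intro character_cong[OF \<omega> m(1)] d) (auto intro: line_stabiliser_unit)
  then show ?thesis
    using kl' by (simp add: zonal_weight_def)
qed

text \<open>Modulo p^m the last row of \<open>b ** r\<close> is b_nn times that of \<open>r\<close>.
  Here \<open>r\<close> ranges over \<open>GLO\<close> because the transversal to be translated is
  one of \<open>K\<close>, not of \<open>B\<close>.\<close>

lemma zonal_weight_mult:
  assumes b: "b \<in> line_stabiliser m" and r: "r \<in> GLO"
  shows "zonal_weight \<omega> m (b ** r) = cnj (\<omega> (b $ last_index $ last_index)) * zonal_weight \<omega> m r"
proof -
  define c where "c = b $ last_index $ last_index"
  have c: "absv c = 1"
    unfolding c_def by (rule line_stabiliser_unit[OF b m(2)])
  then have c0: "c \<noteq> 0"
    by auto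
  note d = line_stabiliser_mult_row[OF b r, folded c_def]
  have iff: "(b ** r) $ last_index $ i \<in> ideal_power m \<longleftrightarrow> r $ last_index $ i \<in> ideal_power m" for i
  proof
    assume "r $ last_index $ i \<in> ideal_power m"
    then show "(b ** r) $ last_index $ i \<in> ideal_power m"
      using ideal_power_add[OF d[of i] ideal_power_mult[of "r $ last_index $ i" m c]] c by simp
  next
    assume "(b ** r) $ last_index $ i \<in> ideal_power m"
    then have "c * r $ last_index $ i \<in> ideal_power m"
      using ideal_power_diff[OF _ d[of i], of "(b ** r) $ last_index $ i"] by simp
    then show "r $ last_index $ i \<in> ideal_power m"
      using c by (simp add: ideal_power_iff absv_mult)
  qed
  then have br: "b ** r \<in> line_stabiliser m \<longleftrightarrow> r \<in> line_stabiliser m"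
    using r GLO_mult[OF line_stabiliser_GLO[OF b] r] by (simp add: line_stabiliser_def)
  have "\<omega> ((b ** r) $ last_index $ last_index) = \<omega> c * \<omega> (r $ last_index $ last_index)" if rl: "r \<in> line_stabiliser m"
  proof -
    have "\<omega> ((b ** r) $ last_index $ last_index) = \<omega> (c * r $ last_index $ last_index)"
      using rl br m(2) c by (intro character_cong[OF \<omega> m(1)] d) (auto simp: absv_mult line_stabiliser_unit)
    then show ?thesis
      using character_mult[OF \<omega> c] line_stabiliser_unit[OF rl m(2)] by simp
  qed
  then show ?thesis
    using br by (simp add: zonal_weight_def c_def)
qed

lemma zonal_average_apply:
  "zonal_average \<omega> m R f x = (\<Sum>r\<in>R. zonal_weight \<omega> m r * f (x v* r))"
  by (simp add: zonal_average_def sum_fun_apply cscale_def right_translation_apply)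

lemma transversal_GLO: "r \<in> R \<Longrightarrow> r \<in> GLO" and finite_transversal: "finite R"
  using R by (auto simp: transversal_def)

text \<open>Replacing \<open>R\<close> by its left translate moves \<open>b\<close> into the
  argument of \<open>f\<close> at the cost of a conjugate character value, which unitarity
  inverts.\<close>

lemma zonal_zonal_average:
  assumes f: "f \<in> isotypic_invariants \<omega> m"
  shows "zonal \<omega> m (zonal_average \<omega> m R f)"
  unfolding zonal_def
proof (intro ballI allI)
  fix b :: "(('a, 'n) vec, 'n) vec" and x :: "('a, 'n) vec" assume b: "b \<in> line_stabiliser m"
  define c where "c = b $ last_index $ last_index"
  have c: "absv c = 1"
    unfolding c_def by (rule line_stabiliser_unit[OF b m(2)])
  have bG: "b \<in> GLO"
    by (rule line_stabiliser_GLO[OF b])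
  have fm: "f \<in> invariants m"
    using f isotypic_invariants_subset by blast
  define G where "G k = zonal_weight \<omega> m k * f (x v* k)" for k
  have G: "G k = G l" if kl: "k \<in> GLO" "l \<in> GLO" "mat_cong m k l" for k l
  proof (cases "x \<in> unit_sphere")
    case True
    then have "f (x v* k) = f (x v* l)"
      using kl by (intro invariants_cong[OF fm] vec_cong_mult_mat) (auto simp: unit_sphere_GLO, auto simp: unit_sphere_iff)
    then show ?thesis
      using zonal_weight_cong[OF kl] by (simp add: G_def)
  next
    case False
    then show ?thesis
      using kl invariants_zero[OF fm] by (simp add: G_def unit_sphere_GLO)
  qed
  have "(\<Sum>r\<in>R. G r) = (\<Sum>r\<in>(**) b ` R. G r)"
    by (rule sum_transversal[OF R transversal_mult_left[OF R bG] G])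
  also have "\<dots> = (\<Sum>r\<in>R. G (b ** r))"
    by (simp add: sum.reindex[OF inj_on_subset[OF inj_on_mult_GLO(1)[OF bG] subset_UNIV]])
  also have "\<dots> = (\<Sum>r\<in>R. cnj (\<omega> c) * (zonal_weight \<omega> m r * f ((x v* b) v* r)))"
    using zonal_weight_mult[OF b transversal_GLO] by (simp add: G_def c_def vector_matrix_mul_assoc mult.assoc)
  also have "\<dots> = cnj (\<omega> c) * zonal_average \<omega> m R f (x v* b)"
    by (simp add: zonal_average_apply sum_distrib_left)
  finally have "zonal_average \<omega> m R f x = cnj (\<omega> c) * zonal_average \<omega> m R f (x v* b)"
    by (simp add: zonal_average_apply G_def)
  then have "\<omega> c * zonal_average \<omega> m R f x = (\<omega> c * cnj (\<omega> c)) * zonal_average \<omega> m R f (x v* b)"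
    by (simp only: mult.assoc)
  also have "\<dots> = zonal_average \<omega> m R f (x v* b)"
    by (simp only: character_mult_cnj[OF \<omega> c] mult_1_left)
  finally show "zonal_average \<omega> m R f (x v* b) = \<omega> (b $ last_index $ last_index) * zonal_average \<omega> m R f x"
    by (simp only: c_def)
qed

text \<open>For \<open>r\<close> in \<open>B\<close> the vector e_n is sent to r_nn e_n modulo p^m,
  and the weight cancels the resulting character value, so all terms agree.\<close>

lemma zonal_average_last_basis_vector:
  assumes f: "f \<in> isotypic_invariants \<omega> m"
  shows "zonal_average \<omega> m R f last_basis_vector = of_nat (card (R \<inter> line_stabiliser m)) * f last_basis_vector"
proof -
  have fm: "f \<in> invariants m"
    using f isotypic_invariants_subset by blast
  have "zonal_weight \<omega> m r * f (last_basis_vector v* r) =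
      (if r \<in> line_stabiliser m then f last_basis_vector else 0)" for r
  proof (cases "r \<in> line_stabiliser m")
    case True
    define c where "c = r $ last_index $ last_index"
    have c: "absv c = 1"
      unfolding c_def by (rule line_stabiliser_unit[OF True m(2)])
    have "f (last_basis_vector v* r) = f (c *s last_basis_vector)"
      using line_stabiliser_row[OF True] c line_stabiliser_GLO[OF True]
      by (intro invariants_cong[OF fm])
        (auto simp: unit_sphere_GLO unit_sphere_scale last_basis_vector_sphere last_basis_vector_row c_def
          simp flip: last_basis_vector_row)
    then show ?thesis
      using True character_mult_cnj[OF \<omega> c] isotypic_scale[OF f c]
      by (simp add: zonal_weight_def c_def mult.assoc[symmetric] mult.commute[of "cnj _"])
  qed (simp add: zonal_weight_def)
  then show ?thesis
    using finite_transversal by (simp add: zonal_average_apply sum.If_cases)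
qed

lemma transversal_line_stabiliser_nonempty: "card (R \<inter> line_stabiliser m) \<noteq> 0"
proof -
  have "mat 1 \<in> GLO"
    by (rule GLO_one)
  then obtain r where r: "r \<in> R" "mat_cong m (mat 1) r"
    using transversalE[OF R] by blast
  have "(mat 1 :: (('a, 'n) vec, 'n) vec) \<in> line_stabiliser m"
    by (auto simp: line_stabiliser_def GLO_one) (simp add: mat_def)
  \<comment> \<open>Membership in \<open>B\<close> is carried from the identity to its
    representative through the weight, which vanishes off \<open>B\<close>.\<close>
  then have "zonal_weight \<omega> m (mat 1) \<noteq> 0"
    by (simp add: zonal_weight_def mat_def character_one[OF \<omega>])
  then have "zonal_weight \<omega> m r \<noteq> 0"
    using zonal_weight_cong[OF GLO_one transversal_GLO[OF r(1)] r(2)] by simp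
  then have "r \<in> line_stabiliser m"
    by (auto simp: zonal_weight_def split: if_splits)
  then show ?thesis
    using r(1) finite_transversal by auto
qed

lemma zonal_average_submodule:
  assumes W: "K_submodule W" and f: "f \<in> W"
  shows "zonal_average \<omega> m R f \<in> W"
  unfolding zonal_average_def
  using W f transversal_GLO unfolding K_submodule_def
  by (intro cfun.subspace_sum cfun.subspace_scale) auto

text \<open>Elements of \<open>B\<close> act on \<open>z\<close> by scalars, so by unitarity all
  translates of \<open>f\<close> under \<open>B\<close> remain orthogonal to
  \<open>z\<close>.\<close>

lemma zonal_average_orthogonal:
  assumes f: "f \<in> smooth_functions" and z: "z \<in> smooth_functions" "zonal \<omega> m z"
    and fz: "inner_prod \<mu> f z = 0"
  shows "inner_prod \<mu> (zonal_average \<omega> m R f) z = 0"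
proof -
  have sm: "cscale (zonal_weight \<omega> m r) (right_translation r f) \<in> smooth_functions" if "r \<in> R" for r
    using that by (intro cfun.subspace_scale[OF subspace_smooth] right_translation_smooth f transversal_GLO)
  have "inner_prod \<mu> (cscale (zonal_weight \<omega> m r) (right_translation r f)) z = 0" if r: "r \<in> R" for r
  proof (cases "r \<in> line_stabiliser m")
    case True
    define c where "c = r $ last_index $ last_index"
    have c: "absv c = 1"
      unfolding c_def by (rule line_stabiliser_unit[OF True m(2)])
    have "right_translation r z = cscale (\<omega> c) z"
      using z(2) True by (simp add: zonal_def right_translation_def cscale_def c_def)
    then have "cnj (\<omega> c) * inner_prod \<mu> (right_translation r f) z = 0"
      using inner_prod_right_translation[OF haar f z(1) transversal_GLO[OF r]] fz
      by (simp add: inner_prod_scale_right)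
    then show ?thesis
      using character_nz[OF \<omega> c] by (simp add: inner_prod_scale_left)
  qed (simp add: inner_prod_scale_left zonal_weight_def)
  then show ?thesis
    unfolding zonal_average_def using inner_prod_sum_left[OF haar sm z(1), of R] by simp
qed

lemma zonal_average_harmonics:
  assumes f: "f \<in> harmonics \<mu> \<omega> m"
  shows "zonal_average \<omega> m R f \<in> harmonics \<mu> \<omega> m" "zonal \<omega> m (zonal_average \<omega> m R f)"
  using zonal_average_submodule[OF K_submodule_harmonics[OF m(1)] f]
    zonal_zonal_average f harmonics_subset[OF m(1)] by auto

text \<open>A harmonic function orthogonal to a zonal one has a zonal average proportional and orthogonal
  to it, hence zero.\<close>

lemma orthogonal_zonal_harmonic:
  assumes z: "z \<in> harmonics \<mu> \<omega> m" "zonal \<omega> m z" "z last_basis_vector \<noteq> 0"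
    and f: "f \<in> harmonics \<mu> \<omega> m" "inner_prod \<mu> f z = 0"
  shows "f last_basis_vector = 0"
proof -
  define y where "y = zonal_average \<omega> m R f"
  define c where "c = y last_basis_vector / z last_basis_vector"
  have zs: "z \<in> smooth_functions"
    by (rule harmonics_smooth[OF m(1) z(1)])
  have y: "y \<in> harmonics \<mu> \<omega> m" "zonal \<omega> m y"
    unfolding y_def by (rule zonal_average_harmonics[OF f(1)])+
  have "y - cscale c z \<in> harmonics \<mu> \<omega> m"
    using y(1) z(1) subspace_harmonics[OF m(1)] by (intro cfun.subspace_diff cfun.subspace_scale)
  moreover have "zonal \<omega> m (y - cscale c z)"
    using y(2) z(2) by (simp add: zonal_def cscale_def algebra_simps)
  moreover have "(y - cscale c z) last_basis_vector = 0"
    using z(3) by (simp add: c_def cscale_def)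
  ultimately have "y - cscale c z = 0"
    by (rule zonal_harmonic_eq_0[OF \<omega> m])
  then have yc: "y = cscale c z"
    by simp
  have "inner_prod \<mu> y z = 0"
    unfolding y_def by (rule zonal_average_orthogonal[OF harmonics_smooth[OF m(1) f(1)] zs z(2) f(2)])
  then have "c * inner_prod \<mu> z z = 0"
    by (simp add: yc inner_prod_scale_left)
  moreover have "inner_prod \<mu> z z \<noteq> 0"
    using inner_prod_definite[OF haar zs] z(3) by auto
  ultimately have "y last_basis_vector = 0"
    using z(3) by (simp add: c_def)
  then show ?thesis
    using zonal_average_last_basis_vector[of f] f(1) harmonics_subset[OF m(1)]
      transversal_line_stabiliser_nonempty by (auto simp: y_def)
qed

end

section \<open>Irreducibility\<close>

lemma submodule_nonzero_at_last_basis_vector: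
  fixes W :: "(('a, 'n) vec \<Rightarrow> complex) set"
  assumes W: "K_submodule W" "W \<noteq> {0}"
  obtains f where "f \<in> W" "f last_basis_vector \<noteq> 0"
proof -
  have sub: "cfun.subspace W" "W \<subseteq> smooth_functions" "\<And>k f. k \<in> GLO \<Longrightarrow> f \<in> W \<Longrightarrow> right_translation k f \<in> W"
    using W(1) by (auto simp: K_submodule_def)
  obtain f where f: "f \<in> W" "f \<noteq> 0"
    using W(2) cfun.subspace_0[OF sub(1)] by blast
  then obtain x where x: "f x \<noteq> 0"
    by (auto simp: fun_eq_iff)
  then have "x \<in> unit_sphere"
    using f(1) sub(2) by (auto simp: smooth_functions_def)
  then obtain k where k: "k \<in> GLO" "last_basis_vector v* k = x"
    using GLO_transitive[OF last_basis_vector_sphere] by blast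
  then have "right_translation k f last_basis_vector \<noteq> 0"
    using x by (simp add: right_translation_apply)
  then show ?thesis
    using sub(3)[OF k(1) f(1)] that by blast
qed

lemma submodule_harmonics_eq:
  assumes \<omega>: "\<omega> \<in> characters" and m: "conductor \<omega> \<le> m" "m \<noteq> 0"
    and W: "K_submodule W" "W \<subseteq> harmonics \<mu> \<omega> m" "W \<noteq> {0}"
  shows "harmonics \<mu> \<omega> m \<subseteq> W"
proof
  fix g assume g: "g \<in> harmonics \<mu> \<omega> m"
  have sub: "cfun.subspace W" "\<And>k f. k \<in> GLO \<Longrightarrow> f \<in> W \<Longrightarrow> right_translation k f \<in> W"
    using W(1) by (auto simp: K_submodule_def)
  obtain R :: "(('a, 'n) vec, 'n) vec set" where R: "transversal m R"
    using ex_transversal by blast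
  obtain f where f: "f \<in> W" "f last_basis_vector \<noteq> 0"
    by (rule submodule_nonzero_at_last_basis_vector[OF W(1,3)])
  define z where "z = zonal_average \<omega> m R f"
  have fH: "f \<in> harmonics \<mu> \<omega> m"
    using f(1) W(2) by blast
  have zW: "z \<in> W"
    unfolding z_def by (rule zonal_average_submodule[OF \<omega> m R W(1) f(1)])
  have z: "z \<in> harmonics \<mu> \<omega> m" "zonal \<omega> m z"
    unfolding z_def by (rule zonal_average_harmonics[OF \<omega> m R fH])+
  have ze: "z last_basis_vector \<noteq> 0"
    using zonal_average_last_basis_vector[OF \<omega> m R, of f] fH harmonics_subset[OF m(1)] f(2)
      transversal_line_stabiliser_nonempty[OF \<omega> m R] by (auto simp: z_def)
  have "W \<subseteq> invariants m"
    using W(2) harmonics_subset[OF m(1)] isotypic_invariants_subset by blast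
  then obtain p where p: "p \<in> W" "\<And>w. w \<in> W \<Longrightarrow> inner_prod \<mu> (g - p) w = 0"
    using ex_projection[OF haar sub(1) _ harmonics_smooth[OF m(1) g]] by blast
  define h where "h = g - p"
  have h: "h \<in> harmonics \<mu> \<omega> m"
    unfolding h_def using g p(1) W(2) by (intro cfun.subspace_diff[OF subspace_harmonics[OF m(1)]]) auto
  have "h x = 0" for x
  proof (cases "x \<in> unit_sphere")
    case True
    then obtain k where k: "k \<in> GLO" "last_basis_vector v* k = x"
      using GLO_transitive[OF last_basis_vector_sphere] by blast
    obtain l where l: "l \<in> GLO" "k ** l = mat 1" "l ** k = mat 1"
      using GLO_inverse[OF k(1)] .
    \<comment> \<open>Stability of \<open>W\<close> keeps every translate of \<open>h\<close>
      orthogonal to \<open>z\<close>, so vanishing at e_n spreads over the sphere by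
      transitivity.\<close>
    have "inner_prod \<mu> (right_translation k h) z = inner_prod \<mu> h (right_translation l z)"
      by (rule right_translation_adjoint[OF k(1) l(1,2) harmonics_smooth[OF m(1) h] harmonics_smooth[OF m(1) z(1)]])
    also have "\<dots> = 0"
      unfolding h_def by (rule p(2)[OF sub(2)[OF l(1) zW]])
    finally have "right_translation k h last_basis_vector = 0"
      by (rule orthogonal_zonal_harmonic[OF \<omega> m R z ze right_translation_harmonics[OF m(1) k(1) h]])
    then show ?thesis
      using k(2) by (simp add: right_translation_apply)
  next
    case False
    then show ?thesis
      using harmonics_smooth[OF m(1) h] by (simp add: smooth_functions_def)
  qed
  then have "g = p"
    by (auto simp: h_def fun_eq_iff)
  then show "g \<in> W"
    using p(1) by simp
qed

text \<open>For \<open>m = 0\<close> all functions involved are constant on the sphere.\<close>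

lemma submodule_invariants_0_eq:
  fixes W :: "(('a, 'n) vec \<Rightarrow> complex) set"
  assumes W: "K_submodule W" "W \<subseteq> invariants 0" "W \<noteq> {0}"
  shows "invariants 0 \<subseteq> W"
proof
  fix g :: "('a, 'n) vec \<Rightarrow> complex" assume g: "g \<in> invariants 0"
  obtain f where f: "f \<in> W" "f last_basis_vector \<noteq> 0"
    by (rule submodule_nonzero_at_last_basis_vector[OF W(1,3)])
  have const: "u x = (if x \<in> unit_sphere then u last_basis_vector else 0)"
    if u: "u \<in> invariants 0" for u :: "('a, 'n) vec \<Rightarrow> complex" and x
    using invariants_zero[OF u] invariants_cong[OF u _ last_basis_vector_sphere vec_cong_0[OF _ last_basis_vector_sphere], of x]
    by simp
  have f0: "f \<in> invariants 0"
    using f(1) W(2) by blast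
  have "g x = g last_basis_vector / f last_basis_vector * f x" for x
    using f(2) const[OF g, of x] const[OF f0, of x] by (cases "x \<in> unit_sphere") simp_all
  then have "g = cscale (g last_basis_vector / f last_basis_vector) f"
    unfolding cscale_def by blast
  then show "g \<in> W"
    using f(1) W(1) cfun.subspace_scale unfolding K_submodule_def by metis
qed

lemma irreducible_harmonics:
  assumes \<omega>: "\<omega> \<in> characters" and m: "conductor \<omega> \<le> m"
  shows "irreducible_K_module (harmonics \<mu> \<omega> m)"
  unfolding irreducible_K_module_def
proof (intro conjI allI impI K_submodule_harmonics[OF m] harmonics_nonzero[OF \<omega> m])
  fix W assume W: "K_submodule W \<and> W \<subseteq> harmonics \<mu> \<omega> m"
  have "harmonics \<mu> \<omega> m \<subseteq> W" if "W \<noteq> {0}"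
  proof (cases "m = 0")
    case True
    have "harmonics \<mu> \<omega> m \<subseteq> invariants 0"
      using harmonics_subset[OF m] isotypic_invariants_subset unfolding True by blast
    then show ?thesis
      using submodule_invariants_0_eq[of W] W that by blast
  next
    case False
    then show ?thesis
      using submodule_harmonics_eq[OF \<omega> m] W that by blast
  qed
  then show "W = {0} \<or> W = harmonics \<mu> \<omega> m"
    using W by blast
qed

section \<open>The orthogonal decompositions\<close>

lemma isotypic_eq_span_harmonics:
  assumes m: "conductor \<omega> \<le> m"
  shows "isotypic_invariants \<omega> m = cfun.span (\<Union>l\<in>{conductor \<omega>..m}. harmonics \<mu> \<omega> l)"
proof
  have "harmonics \<mu> \<omega> l \<subseteq> isotypic_invariants \<omega> m" if "l \<in> {conductor \<omega>..m}" for l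
    using that harmonics_subset[of \<omega> l] isotypic_mono[of l m \<omega>] by auto
  then show "cfun.span (\<Union>l\<in>{conductor \<omega>..m}. harmonics \<mu> \<omega> l) \<subseteq> isotypic_invariants \<omega> m"
    by (intro cfun.span_minimal subspace_isotypic) blast
  show "isotypic_invariants \<omega> m \<subseteq> cfun.span (\<Union>l\<in>{conductor \<omega>..m}. harmonics \<mu> \<omega> l)"
    using m
  proof (induction m rule: dec_induct)
    case base
    show ?case
      by (auto simp: harmonics_def intro: cfun.span_base)
  next
    case (step m)
    show ?case
    proof
      fix f :: "('a, 'n) vec \<Rightarrow> complex" assume f: "f \<in> isotypic_invariants \<omega> (Suc m)"
      obtain p where p: "p \<in> isotypic_invariants \<omega> m" "f - p \<in> harmonics \<mu> \<omega> (Suc m)"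
        by (rule isotypic_decompose[OF step.hyps(1) f])
      let ?S = "\<lambda>m. cfun.span (\<Union>l\<in>{conductor \<omega>..m}. harmonics \<mu> \<omega> l)"
      have "?S m \<subseteq> ?S (Suc m)"
        by (intro cfun.span_mono UN_mono) auto
      then have "p \<in> ?S (Suc m)"
        using step.IH p(1) by blast
      moreover have "f - p \<in> ?S (Suc m)"
        using p(2) step.hyps(1) by (intro cfun.span_base) auto
      ultimately have "p + (f - p) \<in> ?S (Suc m)"
        by (rule cfun.span_add)
      then show "f \<in> ?S (Suc m)"
        by simp
    qed
  qed
qed

text \<open>A scalar matrix at which the two characters differ lies in \<open>K\<close> and acts on
  \<open>f\<close> and \<open>g\<close> by different scalars of modulus 1, whereas the inner product
  is invariant.\<close>

lemma isotypic_orthogonal: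
  assumes \<omega>: "\<omega> \<in> characters" "\<omega>' \<in> characters" "\<omega> \<noteq> \<omega>'"
    and f: "f \<in> isotypic_invariants \<omega> m" and g: "g \<in> isotypic_invariants \<omega>' m'"
  shows "inner_prod \<mu> f g = 0"
proof -
  obtain a where a: "\<omega> a \<noteq> \<omega>' a"
    using \<omega>(3) by (auto simp: fun_eq_iff)
  then have a1: "absv a = 1"
    using character_zero \<omega>(1,2) by metis
  have nz: "a \<noteq> 0"
    using a1 by auto
  define e where "e = (last_basis_vector :: ('a, 'n) vec)"
  define k where "k = (mat a :: (('a, 'n) vec, 'n) vec)"
  have xk: "x v* k = a *s x" for x
    by (simp add: k_def vector_matrix_mult_def mat_def vec_eq_iff if_distrib[of "\<lambda>z. _ * z"] if_distrib[of "\<lambda>z. z * _"] cong: if_cong)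
  have "mat a ** mat (1 / a) = (mat 1 :: (('a, 'n) vec, 'n) vec)" "mat (1 / a) ** mat a = (mat 1 :: (('a, 'n) vec, 'n) vec)"
    using nz by (auto simp: matrix_matrix_mult_def mat_def vec_eq_iff if_distrib[of "\<lambda>z. _ * z"] if_distrib[of "\<lambda>z. z * _"] cong: if_cong)
  moreover have "mat a \<in> (integer_matrices :: (('a, 'n) vec, 'n) vec set)"
    "mat (1 / a) \<in> (integer_matrices :: (('a, 'n) vec, 'n) vec set)"
    using a1 by (auto simp: integer_matrices_def mat_def integers_iff absv_divide)
  ultimately have k: "k \<in> GLO"
    unfolding k_def GLO_def by blast
  have "right_translation k f = cscale (\<omega> a) f" "right_translation k g = cscale (\<omega>' a) g"
    using isotypic_scale[OF f a1] isotypic_scale[OF g a1] by (auto simp: right_translation_def xk cscale_def)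
  then have "\<omega> a * cnj (\<omega>' a) * inner_prod \<mu> f g = inner_prod \<mu> f g"
    using inner_prod_right_translation[OF haar isotypic_smooth[OF f] isotypic_smooth[OF g] k]
    by (auto simp: inner_prod_scale_left inner_prod_scale_right mult.commute)
  then have "\<omega>' a * cnj (\<omega>' a) * (\<omega> a * inner_prod \<mu> f g) = \<omega>' a * inner_prod \<mu> f g"
    by (simp add: algebra_simps)
  then have "(\<omega> a - \<omega>' a) * inner_prod \<mu> f g = 0"
    using character_mult_cnj[OF \<omega>(2) a1] by (simp add: algebra_simps)
  then show ?thesis
    using a by simp
qed

lemma smooth_eq_span_harmonics:
  "smooth_functions = cfun.span (\<Union>i\<in>(SIGMA m:UNIV. {\<omega> \<in> characters. conductor \<omega> \<le> m}).
    (\<lambda>(m, \<omega>). harmonics \<mu> \<omega> m) i)" (is "_ = cfun.span ?U")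
proof
  show "cfun.span ?U \<subseteq> smooth_functions"
    using harmonics_smooth by (intro cfun.span_minimal subspace_smooth) auto
  have "isotypic_invariants \<omega> m \<subseteq> cfun.span ?U" if \<omega>: "\<omega> \<in> characters" "conductor \<omega> \<le> m" for \<omega> m
    unfolding isotypic_eq_span_harmonics[OF \<omega>(2)] using \<omega>(1) by (intro cfun.span_mono) (auto, blast)
  then have "cfun.span (\<Union>\<omega>\<in>{\<omega> \<in> characters. conductor \<omega> \<le> m}. isotypic_invariants \<omega> m) \<subseteq> cfun.span ?U" for m
    by (intro cfun.span_minimal cfun.subspace_span) blast
  then have "invariants m \<subseteq> cfun.span ?U" for m
    using invariants_span_isotypic by blast
  then show "smooth_functions \<subseteq> cfun.span ?U"
    unfolding smooth_eq by blast
qed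

end

theorem theorem2p16:
  fixes \<mu> :: "('a::nonarch_local_field^'n::{finite,linorder}^'n::{finite,linorder}) measure"
  assumes "CARD('n) \<ge> 2" and "haar_probability \<mu>"
  shows "(\<forall>\<omega>\<in>characters. \<forall>m\<ge>conductor \<omega>.
      irreducible_K_module (harmonics \<mu> \<omega> m) \<and>
      orthogonal_direct_sum \<mu> {conductor \<omega>..m} (harmonics \<mu> \<omega>) (isotypic_invariants \<omega> m)) \<and>
    orthogonal_direct_sum \<mu> (SIGMA m:UNIV. {\<omega> \<in> characters. conductor \<omega> \<le> m})
      (\<lambda>(m, \<omega>). harmonics \<mu> \<omega> m) smooth_functions"
proof -
  interpret haar_sphere "TYPE('a)" "TYPE('n)" \<mu>
    using assms by unfold_locales
  have "orthogonal_direct_sum \<mu> {conductor \<omega>..m} (harmonics \<mu> \<omega>) (isotypic_invariants \<omega> m)"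
    if m: "conductor \<omega> \<le> m" for \<omega> m
  proof (rule orthogonal_direct_sumI[OF haar _ _ _ isotypic_eq_span_harmonics[OF m]])
    show "inner_prod \<mu> f g = 0"
      if "i \<in> {conductor \<omega>..m}" "j \<in> {conductor \<omega>..m}" "i \<noteq> j" "f \<in> harmonics \<mu> \<omega> i" "g \<in> harmonics \<mu> \<omega> j" for i j f g
      using that by (intro harmonics_orthogonal_levels[of \<omega> i j]) auto
  qed (auto intro: subspace_harmonics harmonics_smooth)
  moreover have "orthogonal_direct_sum \<mu> (SIGMA m:UNIV. {\<omega> \<in> characters. conductor \<omega> \<le> m})
      (\<lambda>(m, \<omega>). harmonics \<mu> \<omega> m) smooth_functions" (is "orthogonal_direct_sum _ ?I ?V _")
  proof (rule orthogonal_direct_sumI[OF haar _ _ _ smooth_eq_span_harmonics])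
    fix i j f g assume ij: "i \<in> ?I" "j \<in> ?I" "i \<noteq> j" and f: "f \<in> ?V i" and g: "g \<in> ?V j"
    obtain l \<omega> where i: "i = (l, \<omega>)" "\<omega> \<in> characters" "conductor \<omega> \<le> l"
      using ij(1) by auto
    obtain m \<omega>' where j: "j = (m, \<omega>')" "\<omega>' \<in> characters" "conductor \<omega>' \<le> m"
      using ij(2) by auto
    show "inner_prod \<mu> f g = 0"
    \<comment> \<open>Distinct index pairs with equal characters have different levels; different
      characters are orthogonal at any levels.\<close>
    proof (cases "\<omega> = \<omega>'")
      case True
      then show ?thesis
        using f g i j ij(3) by (intro harmonics_orthogonal_levels[of \<omega> l m]) auto
    next
      case False
      then show ?thesis
        using f g i j harmonics_subset[OF i(3)] harmonics_subset[OF j(3)]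
        by (intro isotypic_orthogonal[OF i(2) j(2) False, of f l g m]) auto
    qed
  qed (auto intro: subspace_harmonics harmonics_smooth)
  ultimately show ?thesis
    using irreducible_harmonics by blast
qed

end
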